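(* Let $d\in\{5,6,7,8\}$, let $\alpha'>0$ be a constant, and let $M$ be a $d$-dimensional Riemannian spin manifold with metric $g$, a 3-form $H$, a smooth function $\phi$ (the dilaton), a nowhere vanishing spinor field $\epsilon$ (of the algebraic type described in the context), a vector bundle $E$ with connection $A$ with curvature $F^A$, and a connection $\nabla$ on the tangent bundle $TM$ with curvature $R$. Suppose that the heterotic supersymmetry (Killing spinor) equations $$\nabla^+\epsilon=0,\qquad \left(d\phi-\tfrac12 H\right)\cdot\epsilon=0,\qquad F^A\cdot\epsilon=0$$ hold, and that the anomaly cancellation condition $$dH=\frac{\alpha'}{4}\Big(\mathrm{Tr}(R\wedge R)-\mathrm{Tr}(F^A\wedge F^A)\Big)$$ holds. Then the heterotic equations of motion $$\mathrm{Ric}^g_{ij}-\tfrac14 H_{imn}H_j{}^{mn}+2\nabla^g_i\nabla^g_j\phi-\tfrac{\alpha'}{4}\Big[(F^A)_{imns}(F^A)_j{}^{mns}-R_{imns}R_j{}^{mns}\Big]=0,$$ $$\nabla^g_i\big(e^{-2\phi}H^i{}_{jk}\big)=0,\qquad \nabla^+_i\big(e^{-2\phi}(F^A)^i{}_j\big)=0$$ are satisfied if and only if the connection $\nabla$ on the tangent bundle is an $SU(2)$-instanton when $d=5$, an $SU(3)$-instanton when $d=6$, a $G_2$-instanton when $d=7$, and a $Spin(7)$-instanton when $d=8$ (with respect to the structure defined by $\epsilon$).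
   Context: Conventions. Indices refer to a local orthonormal frame $e_1,\dots,e_d$ and repeated indices are summed. A $p$-form is written $\beta=\frac1{p!}\beta_{i_1\dots i_p}e_{i_1}\wedge\dots\wedge e_{i_p}$. $\nabla^g$ is the Levi-Civita connection and $\mathrm{Ric}^g$ its Ricci tensor (positive on round spheres). $\nabla^{+}=\nabla^g+\frac12H$ is the metric connection with totally skew-symmetric torsion $H$, i.e. $g(\nabla^+_XY,Z)=g(\nabla^g_XY,Z)+\frac12H(X,Y,Z)$. The same symbol denotes the induced connection on the spinor bundle, and on $F^A$ the covariant derivative $\nabla^+$ is coupled to the connection $A$ on $E$. Spinors. The dot denotes Clifford multiplication of forms on spinors, with Clifford generators satisfying $\Gamma^m\Gamma^n+\Gamma^n\Gamma^m=2\delta^{mn}$; thus $d\phi\cdot\epsilon=\partial_m\phi\,\Gamma^m\epsilon$, $H\cdot\epsilon=\frac16H_{mnp}\Gamma^{mnp}\epsilon$, and $F^A\cdot\epsilon=0$ means $F^A_{mn}\Gamma^{mn}\epsilon=0$ (for each endomorphism component). The spinor $\epsilon$ is such that its stabilizer in $Spin(d)$ at each point is $SU(2)$, $SU(3)$, $G_2$, $Spin(7)$ for $d=5,6,7,8$ respectively: any nonzero spinor of the $4$-dimensional complex spin representation for $d=5$; a nonzero chiral spinor for $d=6$; a nonzero real spinor for $d=7$; a nonzero real chiral spinor for $d=8$. Curvatures. $E$ is a real vector bundle with a fibre metric and $A$ is a metric connection on it. In $(F^A)_{imns}$ and $R_{imns}$ the first two indices are the 2-form indices and the last two are the endomorphism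 indices (with respect to an orthonormal frame of $E$, respectively of $TM$): $R_{ijkl}=g(R(e_i,e_j)e_k,e_l)$ with $R(X,Y)=[\nabla_X,\nabla_Y]-\nabla_{[X,Y]}$. The 4-form $\mathrm{Tr}(R\wedge R)$ is defined by $$\mathrm{Tr}(R\wedge R)_{ijkl}=2\big(R_{ijab}R_{klab}+R_{jkab}R_{ilab}+R_{kiab}R_{jlab}\big),$$ and $\mathrm{Tr}(F^A\wedge F^A)$ is defined by the same formula with $F^A$ in place of $R$. Instantons. A connection with curvature $R$ is an $SU(2)$-, $SU(3)$-, $G_2$-, $Spin(7)$-instanton (for $d=5,6,7,8$) if $R_{mn}\Gamma^{mn}\epsilon=0$ for each endomorphism component; equivalently, if for each fixed pair of endomorphism indices the 2-form $R_{\,\cdot\,\cdot\,kl}$ lies, under $\Lambda^2T^*M\cong\mathfrak{so}(d)$, in the Lie algebra $\mathfrak{su}(2)$, $\mathfrak{su}(3)$, $\mathfrak g_2$, $\mathfrak{spin}(7)$ of the stabilizer of $\epsilon$. *)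

theory Defs
  imports "HOL-Analysis.Analysis"
begin

section \<open>Smooth maps on open subsets of coordinate space\<close>

primrec Ck_on :: "nat \<Rightarrow> (real^'d) set \<Rightarrow> (real^'d \<Rightarrow> 'b::real_normed_vector) \<Rightarrow> bool" where
  "Ck_on 0 S f \<longleftrightarrow> continuous_on S f"
| "Ck_on (Suc k) S f \<longleftrightarrow> (\<forall>y\<in>S. f differentiable (at y)) \<and>
      (\<forall>m. Ck_on k S (\<lambda>y. frechet_derivative f (at y) (axis m 1)))"

text \<open>Only used for open sets.\<close>
definition smooth_on :: "(real^'d) set \<Rightarrow> (real^'d \<Rightarrow> 'b::real_normed_vector) \<Rightarrow> bool" where
  "smooth_on S f \<longleftrightarrow> (\<forall>k. Ck_on k S f)"


section \<open>Manifolds, bundles and fields\<close>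

text \<open>
  Every geometric object is given by its local representatives over the charts of an atlas,
  together with the transformation law on overlaps of charts. The vector bundle and the spinor
  bundle are given by transition functions over the same atlas, that is, the charts are taken
  small enough to trivialize them; every atlas has a refinement with this property.
  Local representatives are functions of the coordinates: for a chart \<open>i\<close> they are relevant on
  \<open>img T i\<close>, and transition functions from chart \<open>i\<close> to chart \<open>j\<close> are functions of
  the coordinates of chart \<open>i\<close> on \<open>overlap T i j\<close>. Tangent vectors at a point are
  represented by their coordinate components.
\<close>

record ('i, 'm, 'd) atlas =
  idx :: "'i set"
  dom :: "'i \<Rightarrow> 'm set"
  crd :: "'i \<Rightarrow> 'm \<Rightarrow> real^'d"

definition img :: "('i,'m,'d::finite) atlas \<Rightarrow> 'i \<Rightarrow> (real^'d) set" where
  "img T i = crd T i ` dom T i"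

definition overlap :: "('i,'m,'d::finite) atlas \<Rightarrow> 'i \<Rightarrow> 'i \<Rightarrow> (real^'d) set" where
  "overlap T i j = crd T i ` (dom T i \<inter> dom T j)"

definition pt :: "('i,'m,'d::finite) atlas \<Rightarrow> 'i \<Rightarrow> real^'d \<Rightarrow> 'm" where
  "pt T i y = inv_into (dom T i) (crd T i) y"

definition trans_map :: "('i,'m,'d::finite) atlas \<Rightarrow> 'i \<Rightarrow> 'i \<Rightarrow> real^'d \<Rightarrow> real^'d" where
  "trans_map T i j y = crd T j (pt T i y)"

definition jac :: "('i,'m,'d::finite) atlas \<Rightarrow> 'i \<Rightarrow> 'i \<Rightarrow> real^'d \<Rightarrow> real^'d \<Rightarrow> real^'d" where
  "jac T i j y v = frechet_derivative (trans_map T i j) (at y) v"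

definition smooth_manifold :: "'m topology \<Rightarrow> ('i,'m,'d::finite) atlas \<Rightarrow> bool" where
  "smooth_manifold M T \<longleftrightarrow>
     Hausdorff_space M \<and> second_countable M \<and>
     (\<Union>i\<in>idx T. dom T i) = topspace M \<and>
     (\<forall>i\<in>idx T. openin M (dom T i) \<and> open (img T i) \<and>
        homeomorphic_map (subtopology M (dom T i)) (top_of_set (img T i)) (crd T i)) \<and>
     (\<forall>i\<in>idx T. \<forall>j\<in>idx T. smooth_on (overlap T i j) (trans_map T i j))"

definition smooth_function :: "('i,'m,'d::finite) atlas \<Rightarrow> ('m \<Rightarrow> real) \<Rightarrow> bool" where
  "smooth_function T \<phi> \<longleftrightarrow> (\<forall>i\<in>idx T. smooth_on (img T i) (\<phi> \<circ> pt T i))"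

type_synonym 'd metric = "real^'d \<Rightarrow> real^'d \<Rightarrow> real^'d \<Rightarrow> real"
type_synonym 'd tensor3 = "real^'d \<Rightarrow> real^'d \<Rightarrow> real^'d \<Rightarrow> real^'d \<Rightarrow> real"
type_synonym 'd vfield = "real^'d \<Rightarrow> real^'d"
type_synonym 'd frame = "'d \<Rightarrow> real^'d \<Rightarrow> real^'d"
type_synonym ('d,'r) conn = "real^'d \<Rightarrow> real^'d \<Rightarrow> real^'r^'r"
type_synonym 's cmat = "complex^'s^'s"

definition riemannian_metric ::
    "('i,'m,'d::finite) atlas \<Rightarrow> ('i \<Rightarrow> 'd metric) \<Rightarrow> bool" where
  "riemannian_metric T g \<longleftrightarrow>
     (\<forall>i\<in>idx T.
        (\<forall>y\<in>img T i. bilinear (g i y) \<and> (\<forall>u v. g i y u v = g i y v u) \<and>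
                     (\<forall>u. u \<noteq> 0 \<longrightarrow> g i y u u > 0)) \<and>
        (\<forall>m n. smooth_on (img T i) (\<lambda>y. g i y (axis m 1) (axis n 1)))) \<and>
     (\<forall>i\<in>idx T. \<forall>j\<in>idx T. \<forall>y\<in>overlap T i j. \<forall>u v.
        g j (trans_map T i j y) (jac T i j y u) (jac T i j y v) = g i y u v)"

definition three_form ::
    "('i,'m,'d::finite) atlas \<Rightarrow> ('i \<Rightarrow> 'd tensor3) \<Rightarrow> bool" where
  "three_form T H \<longleftrightarrow>
     (\<forall>i\<in>idx T.
        (\<forall>y\<in>img T i. (\<forall>v w. linear (\<lambda>u. H i y u v w)) \<and>
            (\<forall>u v w. H i y v u w = - H i y u v w \<and> H i y u w v = - H i y u v w)) \<and>
        (\<forall>m n p. smooth_on (img T i) (\<lambda>y. H i y (axis m 1) (axis n 1) (axis p 1)))) \<and>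
     (\<forall>i\<in>idx T. \<forall>j\<in>idx T. \<forall>y\<in>overlap T i j. \<forall>u v w.
        H j (trans_map T i j y) (jac T i j y u) (jac T i j y v) (jac T i j y w) = H i y u v w)"

definition orthonormal_frames ::
    "('i,'m,'d::finite) atlas \<Rightarrow> ('i \<Rightarrow> 'd metric) \<Rightarrow> ('i \<Rightarrow> 'd frame) \<Rightarrow> bool" where
  "orthonormal_frames T g e \<longleftrightarrow>
     (\<forall>i\<in>idx T. (\<forall>a. smooth_on (img T i) (e i a)) \<and>
        (\<forall>y\<in>img T i. \<forall>a b. g i y (e i a y) (e i b y) = (if a = b then 1 else 0)))"

definition bundle_transitions ::
    "('i,'m,'d::finite) atlas \<Rightarrow> ('i \<Rightarrow> 'i \<Rightarrow> real^'d \<Rightarrow> real^'r^'r) \<Rightarrow> bool" where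
  "bundle_transitions T h \<longleftrightarrow>
     (\<forall>i\<in>idx T. \<forall>j\<in>idx T.
        smooth_on (overlap T i j) (h i j) \<and> (\<forall>y\<in>overlap T i j. invertible (h i j y))) \<and>
     (\<forall>i\<in>idx T. \<forall>j\<in>idx T. \<forall>k\<in>idx T.
        \<forall>y\<in>crd T i ` (dom T i \<inter> dom T j \<inter> dom T k).
          h j k (trans_map T i j y) ** h i j y = h i k y)"

text \<open>Local trivializations by orthonormal frames of the fibre metric.\<close>
definition metric_bundle ::
    "('i,'m,'d::finite) atlas \<Rightarrow> ('i \<Rightarrow> 'i \<Rightarrow> real^'d \<Rightarrow> real^'r^'r) \<Rightarrow> bool" where
  "metric_bundle T h \<longleftrightarrow> bundle_transitions T h \<and>
     (\<forall>i\<in>idx T. \<forall>j\<in>idx T. \<forall>y\<in>overlap T i j. orthogonal_matrix (h i j y))"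

definition tangent_transitions ::
    "('i,'m,'d::finite) atlas \<Rightarrow> 'i \<Rightarrow> 'i \<Rightarrow> real^'d \<Rightarrow> real^'d^'d" where
  "tangent_transitions T i j y = matrix (jac T i j y)"

text \<open>Connection forms \<open>A i y v\<close> (\<open>v\<close> a tangent vector), the covariant derivative being
  \<open>d + A\<close>; the overlap condition says that \<open>d + A\<close> commutes with the change of
  trivialization.\<close>
definition connection ::
    "('i,'m,'d::finite) atlas \<Rightarrow> ('i \<Rightarrow> 'i \<Rightarrow> real^'d \<Rightarrow> real^'r^'r) \<Rightarrow>
     ('i \<Rightarrow> ('d,'r) conn) \<Rightarrow> bool" where
  "connection T h A \<longleftrightarrow>
     (\<forall>i\<in>idx T. (\<forall>y\<in>img T i. linear (A i y)) \<and>
                (\<forall>m. smooth_on (img T i) (\<lambda>y. A i y (axis m 1)))) \<and>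
     (\<forall>i\<in>idx T. \<forall>j\<in>idx T. \<forall>y\<in>overlap T i j. \<forall>v.
        A j (trans_map T i j y) (jac T i j y v) ** h i j y + frechet_derivative (h i j) (at y) v
          = h i j y ** A i y v)"

definition metric_connection ::
    "('i,'m,'d::finite) atlas \<Rightarrow> ('i \<Rightarrow> 'i \<Rightarrow> real^'d \<Rightarrow> real^'r^'r) \<Rightarrow>
     ('i \<Rightarrow> ('d,'r) conn) \<Rightarrow> bool" where
  "metric_connection T h A \<longleftrightarrow> connection T h A \<and>
     (\<forall>i\<in>idx T. \<forall>y\<in>img T i. \<forall>v. transpose (A i y v) = - A i y v)"


section \<open>Clifford algebra and spinors\<close>

text \<open>The spin representation, extended to the Clifford algebra: for \<open>d = 5, 6, 7, 8\<close> the
  complex dimension is \<open>4, 8, 8, 16\<close> (all Dirac spinors for even \<open>d\<close>).\<close>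
definition clifford_generators :: "('d::finite \<Rightarrow> 's::finite cmat) \<Rightarrow> bool" where
  "clifford_generators \<Gamma> \<longleftrightarrow>
     CARD('s) = 2 ^ (CARD('d) div 2) \<and>
     (\<forall>m n. \<Gamma> m ** \<Gamma> n + \<Gamma> n ** \<Gamma> m = (if m = n then 2 *\<^sub>R mat 1 else 0))"

definition gamma2 :: "('d \<Rightarrow> 's::finite cmat) \<Rightarrow> 'd \<Rightarrow> 'd \<Rightarrow> 's cmat" where
  "gamma2 \<Gamma> m n = (1/2) *\<^sub>R (\<Gamma> m ** \<Gamma> n - \<Gamma> n ** \<Gamma> m)"

definition gamma3 :: "('d \<Rightarrow> 's::finite cmat) \<Rightarrow> 'd \<Rightarrow> 'd \<Rightarrow> 'd \<Rightarrow> 's cmat" where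
  "gamma3 \<Gamma> m n p = (1/6) *\<^sub>R
     (\<Gamma> m ** \<Gamma> n ** \<Gamma> p + \<Gamma> n ** \<Gamma> p ** \<Gamma> m + \<Gamma> p ** \<Gamma> m ** \<Gamma> n
      - \<Gamma> n ** \<Gamma> m ** \<Gamma> p - \<Gamma> m ** \<Gamma> p ** \<Gamma> n - \<Gamma> p ** \<Gamma> n ** \<Gamma> m)"

definition cliff_vec :: "('d::finite \<Rightarrow> 's::finite cmat) \<Rightarrow> real^'d \<Rightarrow> 's cmat" where
  "cliff_vec \<Gamma> w = (\<Sum>a\<in>UNIV. (w $ a) *\<^sub>R \<Gamma> a)"

definition spin_group :: "('d::finite \<Rightarrow> 's::finite cmat) \<Rightarrow> 's cmat set" where
  "spin_group \<Gamma> =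
     {foldr (**) (map (cliff_vec \<Gamma>) ws) (mat 1) | ws. even (length ws) \<and> (\<forall>w\<in>set ws. norm w = 1)}"

text \<open>For even \<open>d\<close>; the order of the product only affects its sign.\<close>
definition chirality :: "('d::finite \<Rightarrow> 's::finite cmat) \<Rightarrow> 'd list \<Rightarrow> 's cmat" where
  "chirality \<Gamma> ds = mat (\<i> ^ (CARD('d) div 2)) ** foldr (**) (map \<Gamma> ds) (mat 1)"

definition chiral :: "('d::finite \<Rightarrow> 's::finite cmat) \<Rightarrow> complex^'s \<Rightarrow> bool" where
  "chiral \<Gamma> \<psi> \<longleftrightarrow> (\<forall>ds. distinct ds \<and> set ds = UNIV \<longrightarrow>
     chirality \<Gamma> ds *v \<psi> = \<psi> \<or> chirality \<Gamma> ds *v \<psi> = - \<psi>)"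

text \<open>A \<open>Spin(d)\<close>-invariant real structure on the spin representation. For \<open>d = 7\<close>, with
  generators squaring to \<open>+1\<close>, the generators themselves anticommute with it.\<close>
definition real_structure ::
    "('d::finite \<Rightarrow> 's::finite cmat) \<Rightarrow> (complex^'s \<Rightarrow> complex^'s) \<Rightarrow> bool" where
  "real_structure \<Gamma> J \<longleftrightarrow>
     (\<forall>u v. J (u + v) = J u + J v) \<and> (\<forall>c v. J (c *s v) = cnj c *s J v) \<and> (\<forall>v. J (J v) = v) \<and>
     (\<forall>m n v. J (gamma2 \<Gamma> m n *v v) = gamma2 \<Gamma> m n *v J v)"

definition spinor_type ::
    "('d::finite \<Rightarrow> 's::finite cmat) \<Rightarrow> (complex^'s \<Rightarrow> complex^'s) \<Rightarrow> complex^'s \<Rightarrow> bool" where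
  "spinor_type \<Gamma> J \<psi> \<longleftrightarrow> \<psi> \<noteq> 0 \<and>
     (CARD('d) \<in> {6, 8} \<longrightarrow> chiral \<Gamma> \<psi>) \<and> (CARD('d) \<in> {7, 8} \<longrightarrow> J \<psi> = \<psi>)"

definition frame_comps :: "'d::finite metric \<Rightarrow> 'd frame \<Rightarrow> real^'d \<Rightarrow> real^'d \<Rightarrow> real^'d" where
  "frame_comps g e y v = (\<chi> a. g y v (e a y))"

text \<open>Lifts to \<open>Spin(d)\<close> of the transition functions between the local orthonormal frames: the
  intertwining condition says that \<open>\<sigma> i j y\<close> covers the rotation from the frame of chart \<open>i\<close> to
  that of chart \<open>j\<close>, so that Clifford multiplication is globally defined. In particular these
  rotations lie in \<open>SO(d)\<close>.\<close>
definition spin_structure ::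
    "('i,'m,'d::finite) atlas \<Rightarrow> ('i \<Rightarrow> 'd metric) \<Rightarrow> ('i \<Rightarrow> 'd frame) \<Rightarrow>
     ('d \<Rightarrow> 's::finite cmat) \<Rightarrow> ('i \<Rightarrow> 'i \<Rightarrow> real^'d \<Rightarrow> 's cmat) \<Rightarrow> bool" where
  "spin_structure T g e \<Gamma> \<sigma> \<longleftrightarrow> orthonormal_frames T g e \<and>
     (\<forall>i\<in>idx T. \<forall>j\<in>idx T. smooth_on (overlap T i j) (\<sigma> i j) \<and>
        (\<forall>y\<in>overlap T i j. \<sigma> i j y \<in> spin_group \<Gamma> \<and>
           (\<forall>v. \<sigma> i j y ** cliff_vec \<Gamma> (frame_comps (g i) (e i) y v) =
                cliff_vec \<Gamma> (frame_comps (g j) (e j) (trans_map T i j y) (jac T i j y v)) ** \<sigma> i j y))) \<and>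
     (\<forall>i\<in>idx T. \<forall>j\<in>idx T. \<forall>k\<in>idx T.
        \<forall>y\<in>crd T i ` (dom T i \<inter> dom T j \<inter> dom T k).
          \<sigma> j k (trans_map T i j y) ** \<sigma> i j y = \<sigma> i k y)"

definition spinor_field ::
    "('i,'m,'d::finite) atlas \<Rightarrow> ('i \<Rightarrow> 'i \<Rightarrow> real^'d \<Rightarrow> 's::finite cmat) \<Rightarrow>
     ('i \<Rightarrow> real^'d \<Rightarrow> complex^'s) \<Rightarrow> bool" where
  "spinor_field T \<sigma> \<epsilon> \<longleftrightarrow>
     (\<forall>i\<in>idx T. smooth_on (img T i) (\<epsilon> i)) \<and>
     (\<forall>i\<in>idx T. \<forall>j\<in>idx T. \<forall>y\<in>overlap T i j. \<epsilon> j (trans_map T i j y) = \<sigma> i j y *v \<epsilon> i y)"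


section \<open>Covariant derivatives and curvature in a chart\<close>

definition covd :: "('d::finite,'r::finite) conn \<Rightarrow> 'd vfield \<Rightarrow> (real^'d \<Rightarrow> real^'r) \<Rightarrow>
    real^'d \<Rightarrow> real^'r" where
  "covd A X s y = frechet_derivative s (at y) (X y) + A y (X y) *v s y"

definition lie :: "'d::finite vfield \<Rightarrow> 'd vfield \<Rightarrow> 'd vfield" where
  "lie X Y y = frechet_derivative Y (at y) (X y) - frechet_derivative X (at y) (Y y)"

definition curv :: "('d::finite,'r::finite) conn \<Rightarrow> 'd vfield \<Rightarrow> 'd vfield \<Rightarrow>
    (real^'d \<Rightarrow> real^'r) \<Rightarrow> real^'d \<Rightarrow> real^'r" where
  "curv A X Y s y = covd A X (covd A Y s) y - covd A Y (covd A X s) y - covd A (lie X Y) s y"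

text \<open>\<open>(levi_civita g y u) $ k $ n = u\<^sup>m \<Gamma>\<^sup>k\<^sub>m\<^sub>n\<close> with the Christoffel symbols
  \<open>\<Gamma>\<^sup>k\<^sub>m\<^sub>n = g\<^sup>k\<^sup>l (\<partial>\<^sub>m g\<^sub>l\<^sub>n + \<partial>\<^sub>n g\<^sub>l\<^sub>m - \<partial>\<^sub>l g\<^sub>m\<^sub>n) / 2\<close>.\<close>
definition gram :: "'d::finite metric \<Rightarrow> real^'d \<Rightarrow> real^'d^'d" where
  "gram g y = (\<chi> m n. g y (axis m 1) (axis n 1))"

definition dgram :: "'d::finite metric \<Rightarrow> real^'d \<Rightarrow> 'd \<Rightarrow> 'd \<Rightarrow> 'd \<Rightarrow> real" where
  "dgram g y m l n = frechet_derivative (\<lambda>z. g z (axis l 1) (axis n 1)) (at y) (axis m 1)"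

definition levi_civita :: "'d::finite metric \<Rightarrow> ('d,'d) conn" where
  "levi_civita g y u = (\<chi> k n. \<Sum>m\<in>UNIV. \<Sum>l\<in>UNIV. u $ m * matrix_inv (gram g y) $ k $ l *
      (dgram g y m l n + dgram g y n l m - dgram g y l m n) / 2)"

definition nabla_plus :: "'d::finite metric \<Rightarrow> 'd tensor3 \<Rightarrow> 'd frame \<Rightarrow>
    'd vfield \<Rightarrow> 'd vfield \<Rightarrow> 'd vfield" where
  "nabla_plus g H e X Y y = covd (levi_civita g) X Y y
      + (1/2) *\<^sub>R (\<Sum>a\<in>UNIV. H y (X y) (Y y) (e a y) *\<^sub>R e a y)"

text \<open>The connection induced by \<open>\<nabla>\<^sup>+\<close> on spinors. With \<open>\<omega>\<^sub>a\<^sub>b = g(\<nabla>\<^sup>+\<^sub>X e\<^sub>a, e\<^sub>b)\<close> and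
  generators squaring to \<open>+1\<close>, the matrix \<open>S = - 1/4 \<omega>\<^sub>a\<^sub>b \<Gamma>\<^sup>a\<^sup>b\<close> is the element of the spin Lie
  algebra with \<open>S \<Gamma>\<^sub>a - \<Gamma>\<^sub>a S = \<omega>\<^sub>a\<^sub>b \<Gamma>\<^sub>b\<close>, that is, Clifford multiplication is parallel for
  \<open>d + S\<close>.\<close>
definition spin_nabla_plus :: "'d::finite metric \<Rightarrow> 'd tensor3 \<Rightarrow> 'd frame \<Rightarrow>
    ('d \<Rightarrow> 's::finite cmat) \<Rightarrow> 'd vfield \<Rightarrow> (real^'d \<Rightarrow> complex^'s) \<Rightarrow> real^'d \<Rightarrow> complex^'s" where
  "spin_nabla_plus g H e \<Gamma> X \<psi> y = frechet_derivative \<psi> (at y) (X y)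
      - (1/4) *\<^sub>R (\<Sum>a\<in>UNIV. \<Sum>b\<in>UNIV.
          g y (nabla_plus g H e X (e a) y) (e b y) *\<^sub>R (gamma2 \<Gamma> a b *v \<psi> y))"

text \<open>Frame components, the first two indices being the form indices. On \<open>TM\<close> the coordinate
  trivialization is not orthonormal and the endomorphism components are taken with respect to
  \<open>e\<close>; the trivializations of \<open>E\<close> are orthonormal.\<close>
definition curvT :: "('d::finite,'d) conn \<Rightarrow> 'd metric \<Rightarrow> 'd frame \<Rightarrow> real^'d \<Rightarrow>
    'd \<Rightarrow> 'd \<Rightarrow> 'd \<Rightarrow> 'd \<Rightarrow> real" where
  "curvT C g e y i j k l = g y (curv C (e i) (e j) (e k) y) (e l y)"

definition curvE :: "('d::finite,'r::finite) conn \<Rightarrow> 'd frame \<Rightarrow> real^'d \<Rightarrow>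
    'd \<Rightarrow> 'd \<Rightarrow> 'r \<Rightarrow> 'r \<Rightarrow> real" where
  "curvE A e y i j k l = curv A (e i) (e j) (\<lambda>_. axis k 1) y $ l"

definition ricci :: "'d::finite metric \<Rightarrow> 'd frame \<Rightarrow> real^'d \<Rightarrow> 'd \<Rightarrow> 'd \<Rightarrow> real" where
  "ricci g e y i j = (\<Sum>a\<in>UNIV. curvT (levi_civita g) g e y a i j a)"

definition hessian :: "'d::finite metric \<Rightarrow> 'd frame \<Rightarrow> (real^'d \<Rightarrow> real) \<Rightarrow> real^'d \<Rightarrow>
    'd \<Rightarrow> 'd \<Rightarrow> real" where
  "hessian g e f y i j =
      frechet_derivative (\<lambda>z. frechet_derivative f (at z) (e j z)) (at y) (e i y)
      - frechet_derivative f (at y) (covd (levi_civita g) (e i) (e j) y)"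

text \<open>The exterior derivative, evaluated on vectors extended to constant coordinate fields.\<close>
definition ext_d3 :: "'d::finite tensor3 \<Rightarrow> real^'d \<Rightarrow>
    real^'d \<Rightarrow> real^'d \<Rightarrow> real^'d \<Rightarrow> real^'d \<Rightarrow> real" where
  "ext_d3 H y v0 v1 v2 v3 =
      frechet_derivative (\<lambda>z. H z v1 v2 v3) (at y) v0
      - frechet_derivative (\<lambda>z. H z v0 v2 v3) (at y) v1
      + frechet_derivative (\<lambda>z. H z v0 v1 v3) (at y) v2
      - frechet_derivative (\<lambda>z. H z v0 v1 v2) (at y) v3"

definition tr_wedge :: "('d \<Rightarrow> 'd \<Rightarrow> 'r::finite \<Rightarrow> 'r \<Rightarrow> real) \<Rightarrow> 'd \<Rightarrow> 'd \<Rightarrow> 'd \<Rightarrow> 'd \<Rightarrow> real" where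
  "tr_wedge R i j k l = 2 * (\<Sum>a\<in>UNIV. \<Sum>b\<in>UNIV.
      R i j a b * R k l a b + R j k a b * R i l a b + R k i a b * R j l a b)"

definition cov_tensor3 :: "'d::finite metric \<Rightarrow> 'd tensor3 \<Rightarrow>
    'd vfield \<Rightarrow> 'd vfield \<Rightarrow> 'd vfield \<Rightarrow> 'd vfield \<Rightarrow> real^'d \<Rightarrow> real" where
  "cov_tensor3 g B X Y Z W y =
      frechet_derivative (\<lambda>z. B z (Y z) (Z z) (W z)) (at y) (X y)
      - B y (covd (levi_civita g) X Y y) (Z y) (W y)
      - B y (Y y) (covd (levi_civita g) X Z y) (W y)
      - B y (Y y) (Z y) (covd (levi_civita g) X W y)"

text \<open>Covariant derivative of a 2-form \<open>\<Phi>\<close> with values in the endomorphisms of \<open>E\<close>, given as an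
  operator \<open>\<Phi> Y Z s\<close> on vector fields and sections, with respect to \<open>\<nabla>\<^sup>+\<close> coupled to \<open>A\<close>.\<close>
definition cov_plus_endo2 :: "'d::finite metric \<Rightarrow> 'd tensor3 \<Rightarrow> 'd frame \<Rightarrow> ('d,'r::finite) conn \<Rightarrow>
    ('d vfield \<Rightarrow> 'd vfield \<Rightarrow> (real^'d \<Rightarrow> real^'r) \<Rightarrow> real^'d \<Rightarrow> real^'r) \<Rightarrow>
    'd vfield \<Rightarrow> 'd vfield \<Rightarrow> 'd vfield \<Rightarrow> (real^'d \<Rightarrow> real^'r) \<Rightarrow> real^'d \<Rightarrow> real^'r" where
  "cov_plus_endo2 g H e A \<Phi> X Y Z s y =
      covd A X (\<Phi> Y Z s) y
      - \<Phi> (nabla_plus g H e X Y) Z s y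
      - \<Phi> Y (nabla_plus g H e X Z) s y
      - \<Phi> Y Z (covd A X s) y"


section \<open>Supersymmetry, anomaly cancellation, equations of motion, instantons\<close>

text \<open>\<open>R\<^sub>m\<^sub>n \<Gamma>\<^sup>m\<^sup>n \<psi> = 0\<close> for each endomorphism component.\<close>
definition curv_annihilates :: "('d::finite \<Rightarrow> 's::finite cmat) \<Rightarrow>
    ('d \<Rightarrow> 'd \<Rightarrow> 'r \<Rightarrow> 'r \<Rightarrow> real) \<Rightarrow> complex^'s \<Rightarrow> bool" where
  "curv_annihilates \<Gamma> R \<psi> \<longleftrightarrow>
     (\<forall>k l. (\<Sum>m\<in>UNIV. \<Sum>n\<in>UNIV. R m n k l *\<^sub>R (gamma2 \<Gamma> m n *v \<psi>)) = 0)"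

definition gravitino_eq ::
    "('i,'m,'d::finite) atlas \<Rightarrow> ('i \<Rightarrow> 'd metric) \<Rightarrow> ('i \<Rightarrow> 'd tensor3) \<Rightarrow> ('i \<Rightarrow> 'd frame) \<Rightarrow>
     ('d \<Rightarrow> 's::finite cmat) \<Rightarrow> ('i \<Rightarrow> real^'d \<Rightarrow> complex^'s) \<Rightarrow> bool" where
  "gravitino_eq T g H e \<Gamma> \<epsilon> \<longleftrightarrow>
     (\<forall>i\<in>idx T. \<forall>y\<in>img T i. \<forall>a. spin_nabla_plus (g i) (H i) (e i) \<Gamma> (e i a) (\<epsilon> i) y = 0)"

definition dilatino_eq ::
    "('i,'m,'d::finite) atlas \<Rightarrow> ('i \<Rightarrow> 'd tensor3) \<Rightarrow> ('m \<Rightarrow> real) \<Rightarrow> ('i \<Rightarrow> 'd frame) \<Rightarrow>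
     ('d \<Rightarrow> 's::finite cmat) \<Rightarrow> ('i \<Rightarrow> real^'d \<Rightarrow> complex^'s) \<Rightarrow> bool" where
  "dilatino_eq T H \<phi> e \<Gamma> \<epsilon> \<longleftrightarrow>
     (\<forall>i\<in>idx T. \<forall>y\<in>img T i.
        (\<Sum>m\<in>UNIV. frechet_derivative (\<phi> \<circ> pt T i) (at y) (e i m y) *\<^sub>R (\<Gamma> m *v \<epsilon> i y))
        - (1/2) *\<^sub>R ((1/6) *\<^sub>R (\<Sum>m\<in>UNIV. \<Sum>n\<in>UNIV. \<Sum>p\<in>UNIV.
            H i y (e i m y) (e i n y) (e i p y) *\<^sub>R (gamma3 \<Gamma> m n p *v \<epsilon> i y))) = 0)"

definition gaugino_eq ::
    "('i,'m,'d::finite) atlas \<Rightarrow> ('i \<Rightarrow> ('d,'r::finite) conn) \<Rightarrow> ('i \<Rightarrow> 'd frame) \<Rightarrow>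
     ('d \<Rightarrow> 's::finite cmat) \<Rightarrow> ('i \<Rightarrow> real^'d \<Rightarrow> complex^'s) \<Rightarrow> bool" where
  "gaugino_eq T A e \<Gamma> \<epsilon> \<longleftrightarrow>
     (\<forall>i\<in>idx T. \<forall>y\<in>img T i. curv_annihilates \<Gamma> (curvE (A i) (e i) y) (\<epsilon> i y))"

definition anomaly_cancellation ::
    "real \<Rightarrow> ('i,'m,'d::finite) atlas \<Rightarrow> ('i \<Rightarrow> 'd metric) \<Rightarrow> ('i \<Rightarrow> 'd tensor3) \<Rightarrow>
     ('i \<Rightarrow> 'd frame) \<Rightarrow> ('i \<Rightarrow> ('d,'r::finite) conn) \<Rightarrow> ('i \<Rightarrow> ('d,'d) conn) \<Rightarrow> bool" where
  "anomaly_cancellation \<alpha> T g H e A C \<longleftrightarrow>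
     (\<forall>i\<in>idx T. \<forall>y\<in>img T i. \<forall>a b c d.
        ext_d3 (H i) y (e i a y) (e i b y) (e i c y) (e i d y) =
        \<alpha> / 4 * (tr_wedge (curvT (C i) (g i) (e i) y) a b c d
                 - tr_wedge (curvE (A i) (e i) y) a b c d))"

definition metric_eom ::
    "real \<Rightarrow> ('i,'m,'d::finite) atlas \<Rightarrow> ('i \<Rightarrow> 'd metric) \<Rightarrow> ('i \<Rightarrow> 'd tensor3) \<Rightarrow> ('m \<Rightarrow> real) \<Rightarrow>
     ('i \<Rightarrow> 'd frame) \<Rightarrow> ('i \<Rightarrow> ('d,'r::finite) conn) \<Rightarrow> ('i \<Rightarrow> ('d,'d) conn) \<Rightarrow> bool" where
  "metric_eom \<alpha> T g H \<phi> e A C \<longleftrightarrow>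
     (\<forall>i\<in>idx T. \<forall>y\<in>img T i. \<forall>a b.
        ricci (g i) (e i) y a b
        - 1/4 * (\<Sum>m\<in>UNIV. \<Sum>n\<in>UNIV.
            H i y (e i a y) (e i m y) (e i n y) * H i y (e i b y) (e i m y) (e i n y))
        + 2 * hessian (g i) (e i) (\<phi> \<circ> pt T i) y a b
        - \<alpha> / 4 *
          ((\<Sum>m\<in>UNIV. \<Sum>n\<in>UNIV. \<Sum>s\<in>UNIV.
              curvE (A i) (e i) y a m n s * curvE (A i) (e i) y b m n s)
           - (\<Sum>m\<in>UNIV. \<Sum>n\<in>UNIV. \<Sum>s\<in>UNIV.
              curvT (C i) (g i) (e i) y a m n s * curvT (C i) (g i) (e i) y b m n s)) = 0)"

definition H_eom ::
    "('i,'m,'d::finite) atlas \<Rightarrow> ('i \<Rightarrow> 'd metric) \<Rightarrow> ('i \<Rightarrow> 'd tensor3) \<Rightarrow> ('m \<Rightarrow> real) \<Rightarrow>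
     ('i \<Rightarrow> 'd frame) \<Rightarrow> bool" where
  "H_eom T g H \<phi> e \<longleftrightarrow>
     (\<forall>i\<in>idx T. \<forall>y\<in>img T i. \<forall>b c.
        (\<Sum>a\<in>UNIV. cov_tensor3 (g i) (\<lambda>z u v w. exp (- 2 * \<phi> (pt T i z)) * H i z u v w)
           (e i a) (e i a) (e i b) (e i c) y) = 0)"

definition F_eom ::
    "('i,'m,'d::finite) atlas \<Rightarrow> ('i \<Rightarrow> 'd metric) \<Rightarrow> ('i \<Rightarrow> 'd tensor3) \<Rightarrow> ('m \<Rightarrow> real) \<Rightarrow>
     ('i \<Rightarrow> 'd frame) \<Rightarrow> ('i \<Rightarrow> ('d,'r::finite) conn) \<Rightarrow> bool" where
  "F_eom T g H \<phi> e A \<longleftrightarrow>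
     (\<forall>i\<in>idx T. \<forall>y\<in>img T i. \<forall>b k.
        (\<Sum>a\<in>UNIV. cov_plus_endo2 (g i) (H i) (e i) (A i)
           (\<lambda>Y Z s z. exp (- 2 * \<phi> (pt T i z)) *\<^sub>R curv (A i) Y Z s z)
           (e i a) (e i a) (e i b) (\<lambda>_. axis k 1) y) = 0)"

text \<open>An \<open>SU(2)\<close>-, \<open>SU(3)\<close>-, \<open>G\<^sub>2\<close>-, \<open>Spin(7)\<close>-instanton for \<open>d = 5, 6, 7, 8\<close>, with respect to
  the structure given by the stabilizer of \<open>\<epsilon>\<close>.\<close>
definition instanton ::
    "('i,'m,'d::finite) atlas \<Rightarrow> ('i \<Rightarrow> 'd metric) \<Rightarrow> ('i \<Rightarrow> 'd frame) \<Rightarrow>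
     ('d \<Rightarrow> 's::finite cmat) \<Rightarrow> ('i \<Rightarrow> real^'d \<Rightarrow> complex^'s) \<Rightarrow> ('i \<Rightarrow> ('d,'d) conn) \<Rightarrow> bool" where
  "instanton T g e \<Gamma> \<epsilon> C \<longleftrightarrow>
     (\<forall>i\<in>idx T. \<forall>y\<in>img T i. curv_annihilates \<Gamma> (curvT (C i) (g i) (e i) y) (\<epsilon> i y))"

end

theory Submission
  imports Defs
begin

text \<open>
  Everything is local in a chart. Write \<open>\<gamma>\<^sub>a\<close> for Clifford multiplication by the frame vector
  \<open>e\<^sub>a\<close>. The integrability condition \<open>R\<^sup>+\<^sub>i\<^sub>j\<^sub>a\<^sub>b \<gamma>\<^sub>a \<gamma>\<^sub>b \<epsilon> = 0\<close> of \<open>\<nabla>\<^sup>+\<epsilon> = 0\<close> is contracted with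
  \<open>\<gamma>\<^sub>j\<close>; the Bianchi identity with torsion, the \<open>\<nabla>\<^sup>+\<close>-derivative of the dilatino equation and
  the anomaly condition turn the result into \<open>E\<^sub>i\<^sub>a \<gamma>\<^sub>a \<epsilon> + \<alpha>/8 R\<^sub>i\<^sub>j\<^sub>s\<^sub>t \<gamma>\<^sub>j S\<^sub>s\<^sub>t \<epsilon> = 0\<close>, where
  \<open>S\<^sub>s\<^sub>t = R\<^sub>k\<^sub>l\<^sub>s\<^sub>t \<gamma>\<^sub>k \<gamma>\<^sub>l\<close>, the symmetric part of \<open>E\<close> is the metric equation and the
  skew part is a multiple of the \<open>H\<close> equation. For an instanton \<open>S\<^sub>s\<^sub>t \<epsilon> = 0\<close>, hence
  \<open>E = 0\<close>, since the square of Clifford multiplication by a vector is its squared norm.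
  Conversely, if \<open>E = 0\<close> then contraction with \<open>\<gamma>\<^sub>i\<close> gives \<open>\<Sum>\<^sub>s\<^sub>t S\<^sub>s\<^sub>t S\<^sub>s\<^sub>t \<epsilon> = 0\<close>, and each
  \<open>S\<^sub>s\<^sub>t\<close> is skew for an invariant inner product, so \<open>S\<^sub>s\<^sub>t \<epsilon> = 0\<close>. The gauge equation holds in
  any case, by the same contraction applied to \<open>\<nabla>\<^sup>+(F \<cdot> \<epsilon>) = 0\<close>.
\<close>

section \<open>Calculus of smooth maps\<close>

text \<open>The products of generators in \<open>c2\<close> and \<open>c3\<close> are not
  antisymmetrized. Reordering them costs anticommutators, hence traces of the coefficients, and
  exactly these traces are the Ricci tensor, the divergence of \<open>H\<close> and the quadratic
  terms in \<open>R\<close> and \<open>F\<close>. One reordering identity, \<open>c3_cyclic\<close>,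
  therefore serves the curvature of \<open>\<nabla>\<^sup>+\<close>, the two trace 4-forms and the
  derivative of \<open>F\<close>. The Ricci tensor of a connection with torsion is in general not
  symmetric, which is why the metric and \<open>H\<close> equations arrive as the two parts of a
  single matrix. The converse needs positivity, but the generators are not assumed Hermitian; an
  inner product that makes all of them isometries is built by averaging. On the analytic side the
  statement speaks of operators on moving frames. They are reduced to tensors with constant
  coordinate vectors as arguments: these commute, so no bracket terms arise, and the frame enters
  only through its connection coefficients, which cancel against the rotation of the generators
  because Clifford multiplication is parallel.\<close>

abbreviation pd :: "real^'d \<Rightarrow> (real^'d \<Rightarrow> 'b::real_normed_vector) \<Rightarrow> real^'d \<Rightarrow> 'b" where
  "pd u f y \<equiv> frechet_derivative f (at y) u"

lemma differentiable_has_frechet_derivative: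
  "f differentiable F \<Longrightarrow> (f has_derivative frechet_derivative f F) F"
  by (simp add: frechet_derivative_works)

lemma pd_eqI: "(f has_derivative D) (at y) \<Longrightarrow> pd u f y = D u"
  using frechet_derivative_at[of f D y] by simp

text \<open>\<open>frechet_derivative\<close> is a choice operator, so the equality must also cover
  points without a derivative: both functions have the same set of derivatives, hence the same
  choice.\<close>

lemma frechet_derivative_cong_open:
  assumes "open S" "y \<in> S" "\<And>z. z \<in> S \<Longrightarrow> f z = h z"
  shows "frechet_derivative f (at y) = frechet_derivative h (at y)"
proof -
  have "(f has_derivative D) (at y) \<longleftrightarrow> (h has_derivative D) (at y)" for D
    by (intro iffI; erule has_derivative_transform_within_open[OF _ assms(1,2)]) (auto simp: assms(3))
  then show ?thesis
    unfolding frechet_derivative_def by simp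
qed

lemma differentiable_cong_open:
  assumes "open S" "y \<in> S" "\<And>z. z \<in> S \<Longrightarrow> f z = h z" "f differentiable (at y)"
  shows "h differentiable (at y)"
  using assms has_derivative_transform_within_open[of f _ y UNIV S h]
  unfolding differentiable_def by auto

lemma Ck_on_cong:
  assumes "open S" "\<And>z. z \<in> S \<Longrightarrow> f z = h z" "Ck_on k S f"
  shows "Ck_on k S h"
  using assms(2,3)
proof (induction k arbitrary: f h)
  case 0
  then show ?case using continuous_on_cong[of S S f h] by simp
next
  case (Suc k)
  have "Ck_on k S (pd (axis m 1) h)" for m
  proof (rule Suc.IH)
    show "pd (axis m 1) f z = pd (axis m 1) h z" if "z \<in> S" for z
      using frechet_derivative_cong_open[OF assms(1) that Suc.prems(1)] by simp
    show "Ck_on k S (pd (axis m 1) f)" using Suc.prems(2) by simp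
  qed
  moreover have "h differentiable (at y)" if "y \<in> S" for y
    using differentiable_cong_open[OF assms(1) that Suc.prems(1)] Suc.prems(2) that by simp
  ultimately show ?case by simp
qed

lemma Ck_on_continuous: "Ck_on k S f \<Longrightarrow> continuous_on S f"
  by (cases k)
    (auto intro!: continuous_at_imp_continuous_on differentiable_imp_continuous_within)

lemma Ck_on_Suc_imp: "Ck_on (Suc k) S f \<Longrightarrow> Ck_on k S f"
proof (induction k arbitrary: f)
  case 0
  then show ?case using Ck_on_continuous[of "Suc 0" S f] by simp
next
  case (Suc k)
  then show ?case by (metis Ck_on.simps(2))
qed

lemma Ck_on_const: "Ck_on k S (\<lambda>y. c)"
  by (induction k arbitrary: c) auto

lemma Ck_on_add:
  assumes "open S" "Ck_on k S f" "Ck_on k S h"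
  shows "Ck_on k S (\<lambda>y. f y + h y)"
  using assms(2,3)
proof (induction k arbitrary: f h)
  case 0
  then show ?case by (simp add: continuous_on_add)
next
  case (Suc k)
  have fd: "f differentiable (at y)" "h differentiable (at y)" if "y \<in> S" for y
    using Suc.prems that by auto
  have "Ck_on k S (pd (axis m 1) (\<lambda>y. f y + h y))" for m
  proof (rule Ck_on_cong[OF assms(1)])
    show "Ck_on k S (\<lambda>y. pd (axis m 1) f y + pd (axis m 1) h y)"
      using Suc by auto
    show "pd (axis m 1) f z + pd (axis m 1) h z = pd (axis m 1) (\<lambda>y. f y + h y) z" if "z \<in> S" for z
      by (simp add: pd_eqI[OF has_derivative_add[OF differentiable_has_frechet_derivative[OF fd(1)]
          differentiable_has_frechet_derivative[OF fd(2)]]] that)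
  qed
  then show ?case using fd by (auto intro!: derivative_intros)
qed

text \<open>Covers every product in the sequel. The Leibniz rule leaves one factor undifferentiated,
  so the induction step also uses that \<open>Ck_on (Suc k)\<close> implies
  \<open>Ck_on k\<close>.\<close>

lemma Ck_on_bilinear:
  assumes "bounded_bilinear p" "open S" "Ck_on k S f" "Ck_on k S h"
  shows "Ck_on k S (\<lambda>y. p (f y) (h y))"
  using assms(3,4)
proof (induction k arbitrary: f h)
  case 0
  then show ?case by (simp add: bounded_bilinear.continuous_on[OF assms(1)])
next
  case (Suc k)
  have fd: "f differentiable (at y)" "h differentiable (at y)" if "y \<in> S" for y
    using Suc.prems that by auto
  have D: "((\<lambda>y. p (f y) (h y)) has_derivative (\<lambda>u. p (f y) (pd u h y) + p (pd u f y) (h y))) (at y)"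
    if "y \<in> S" for y
    using bounded_bilinear.FDERIV[OF assms(1) differentiable_has_frechet_derivative[OF fd(1)[OF that]]
        differentiable_has_frechet_derivative[OF fd(2)[OF that]]] .
  have "Ck_on k S (pd (axis m 1) (\<lambda>y. p (f y) (h y)))" for m
  proof (rule Ck_on_cong[OF assms(2)])
    show "Ck_on k S (\<lambda>y. p (f y) (pd (axis m 1) h y) + p (pd (axis m 1) f y) (h y))"
      using Suc.IH Ck_on_Suc_imp[OF Suc.prems(1)] Ck_on_Suc_imp[OF Suc.prems(2)] Suc.prems
      by (intro Ck_on_add assms) auto
    show "p (f z) (pd (axis m 1) h z) + p (pd (axis m 1) f z) (h z) =
        pd (axis m 1) (\<lambda>y. p (f y) (h y)) z" if "z \<in> S" for z
      by (simp add: pd_eqI[OF D[OF that]])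
  qed
  then show ?case using D by (auto simp: differentiable_def)
qed

lemma smooth_on_cong:
  "open S \<Longrightarrow> smooth_on S f \<Longrightarrow> (\<And>z. z \<in> S \<Longrightarrow> f z = h z) \<Longrightarrow> smooth_on S h"
  unfolding smooth_on_def using Ck_on_cong by blast

lemma smooth_on_differentiable: "smooth_on S f \<Longrightarrow> y \<in> S \<Longrightarrow> f differentiable (at y)"
  unfolding smooth_on_def by (metis Ck_on.simps(2))

lemma smooth_on_has_derivative:
  "smooth_on S f \<Longrightarrow> y \<in> S \<Longrightarrow> (f has_derivative (\<lambda>u. pd u f y)) (at y)"
  by (rule differentiable_has_frechet_derivative[OF smooth_on_differentiable])

lemma smooth_on_const: "smooth_on S (\<lambda>y. c)"
  by (simp add: smooth_on_def Ck_on_const)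

lemma smooth_on_add:
  "open S \<Longrightarrow> smooth_on S f \<Longrightarrow> smooth_on S h \<Longrightarrow> smooth_on S (\<lambda>y. f y + h y)"
  by (simp add: smooth_on_def Ck_on_add)

lemma smooth_on_bilinear:
  "bounded_bilinear p \<Longrightarrow> open S \<Longrightarrow> smooth_on S f \<Longrightarrow> smooth_on S h \<Longrightarrow>
    smooth_on S (\<lambda>y. p (f y) (h y))"
  by (simp add: smooth_on_def Ck_on_bilinear)

text \<open>A linear map is a bilinear one with the constant scalar 1 in the other slot, so no
  second induction is required.\<close>

lemma smooth_on_linear:
  assumes "bounded_linear L" "open S" "smooth_on S f"
  shows "smooth_on S (\<lambda>y. L (f y))"
proof -
  interpret bounded_linear L by (rule assms(1))
  have "bounded_bilinear (\<lambda>(r::real) x. r *\<^sub>R L x)"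
    by (rule bounded_bilinear.comp[OF bounded_bilinear_scaleR bounded_linear_ident assms(1)])
  from smooth_on_bilinear[OF this assms(2) smooth_on_const[of S 1] assms(3)]
  show ?thesis by simp
qed

lemma smooth_on_scaleR:
  "open S \<Longrightarrow> smooth_on S f \<Longrightarrow> smooth_on S h \<Longrightarrow> smooth_on S (\<lambda>y. f y *\<^sub>R h y)"
  by (rule smooth_on_bilinear[OF bounded_bilinear_scaleR])

lemma smooth_on_mult:
  "open S \<Longrightarrow> smooth_on S f \<Longrightarrow> smooth_on S h \<Longrightarrow>
    smooth_on S (\<lambda>y. f y * h y :: 'b::real_normed_algebra)"
  by (rule smooth_on_bilinear[OF bounded_bilinear_mult])

lemma smooth_on_minus: "open S \<Longrightarrow> smooth_on S f \<Longrightarrow> smooth_on S (\<lambda>y. - f y)"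
  by (rule smooth_on_linear[OF bounded_linear_minus[OF bounded_linear_ident]])

lemma smooth_on_diff:
  "open S \<Longrightarrow> smooth_on S f \<Longrightarrow> smooth_on S h \<Longrightarrow> smooth_on S (\<lambda>y. f y - h y)"
  using smooth_on_add[of S f "\<lambda>y. - h y"] smooth_on_minus[of S h] by simp

lemma smooth_on_sum:
  assumes "open S" "\<And>a. a \<in> I \<Longrightarrow> smooth_on S (f a)"
  shows "smooth_on S (\<lambda>y. \<Sum>a\<in>I. f a y)"
  using assms(2)
proof (induction I rule: infinite_finite_induct)
  case (insert a I)
  then show ?case using smooth_on_add[OF assms(1), of "f a" "\<lambda>y. \<Sum>a\<in>I. f a y"] by simp
qed (simp_all add: smooth_on_const)

lemma linear_pd: "smooth_on S f \<Longrightarrow> y \<in> S \<Longrightarrow> linear (\<lambda>u. pd u f y)"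
  by (rule linear_frechet_derivative[OF smooth_on_differentiable])

lemma vec_axis_expand: "u = (\<Sum>m\<in>UNIV. (u $ m) *\<^sub>R axis m 1)" for u :: "real^'d"
  using basis_expansion[of u] by (simp add: scalar_mult_eq_scaleR)

lemma smooth_on_pd_axis:
  assumes "smooth_on S f" shows "smooth_on S (pd (axis m 1) f)"
  unfolding smooth_on_def
proof
  fix k
  have "Ck_on (Suc k) S f" using assms unfolding smooth_on_def by blast
  then show "Ck_on k S (pd (axis m 1) f)" by simp
qed

text \<open>\<open>Ck_on\<close> differentiates along coordinate axes only; other directions follow
  by linearity of the derivative.\<close>

lemma smooth_on_pd:
  fixes f :: "real^'d \<Rightarrow> 'b::real_normed_vector"
  assumes "open S" "smooth_on S f" shows "smooth_on S (pd u f)"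
proof (rule smooth_on_cong[OF assms(1)])
  show "smooth_on S (\<lambda>y. \<Sum>m\<in>UNIV. (u $ m) *\<^sub>R pd (axis m 1) f y)"
    by (intro smooth_on_sum smooth_on_scaleR smooth_on_const assms smooth_on_pd_axis)
  show "(\<Sum>m\<in>UNIV. (u $ m) *\<^sub>R pd (axis m 1) f y) = pd u f y" if "y \<in> S" for y
  proof -
    interpret linear "\<lambda>u. pd u f y" by (rule linear_pd[OF assms(2) that])
    show ?thesis by (simp add: sum[symmetric] scaleR[symmetric] vec_axis_expand[of u, symmetric])
  qed
qed

lemma pd_bilinear:
  assumes "bounded_bilinear p" "smooth_on S f" "smooth_on S h" "y \<in> S"
  shows "pd u (\<lambda>y. p (f y) (h y)) y = p (pd u f y) (h y) + p (f y) (pd u h y)"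
  by (subst pd_eqI[OF bounded_bilinear.FDERIV[OF assms(1) smooth_on_has_derivative[OF assms(2,4)]
    smooth_on_has_derivative[OF assms(3,4)]]]) simp

lemma pd_linear:
  assumes "bounded_linear L" "smooth_on S f" "y \<in> S"
  shows "pd u (\<lambda>y. L (f y)) y = L (pd u f y)"
  by (rule pd_eqI[OF bounded_linear.has_derivative[OF assms(1) smooth_on_has_derivative[OF assms(2,3)]]])

lemma pd_add:
  assumes "smooth_on S f" "smooth_on S h" "y \<in> S"
  shows "pd u (\<lambda>y. f y + h y) y = pd u f y + pd u h y"
  by (rule pd_eqI[OF has_derivative_add[OF smooth_on_has_derivative[OF assms(1,3)]
    smooth_on_has_derivative[OF assms(2,3)]]])

lemma pd_diff:
  assumes "smooth_on S f" "smooth_on S h" "y \<in> S"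
  shows "pd u (\<lambda>y. f y - h y) y = pd u f y - pd u h y"
  by (rule pd_eqI[OF has_derivative_diff[OF smooth_on_has_derivative[OF assms(1,3)]
    smooth_on_has_derivative[OF assms(2,3)]]])

lemma pd_sum:
  assumes "\<And>a. a \<in> I \<Longrightarrow> smooth_on S (f a)" "y \<in> S"
  shows "pd u (\<lambda>y. \<Sum>a\<in>I. f a y) y = (\<Sum>a\<in>I. pd u (f a) y)"
  by (rule pd_eqI[OF has_derivative_sum]) (rule smooth_on_has_derivative[OF assms])

lemma pd_scaleR:
  assumes "smooth_on S f" "smooth_on S h" "y \<in> S"
  shows "pd u (\<lambda>y. f y *\<^sub>R h y) y = pd u f y *\<^sub>R h y + f y *\<^sub>R pd u h y"
  by (rule pd_bilinear[OF bounded_bilinear_scaleR assms])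

lemma pd_cong:
  assumes "open S" "\<And>z. z \<in> S \<Longrightarrow> f z = h z" "y \<in> S" 
  shows "pd u f y = pd u h y"
  using frechet_derivative_cong_open[of S y f h] assms by simp

text \<open>The Leibniz rule for a tensor field evaluated on a vector field: differentiate the
  tensor with its argument frozen, and add the tensor on the derivative of the argument. Expanding
  in a basis reduces it to products with scalar functions.\<close>

lemma family_of_linear_maps:
  fixes L :: "real^'d \<Rightarrow> 'a::euclidean_space \<Rightarrow> 'b::real_normed_vector"
  assumes S: "open S" and lin: "\<And>z. z \<in> S \<Longrightarrow> linear (L z)"
    and sm: "\<And>b. b \<in> Basis \<Longrightarrow> smooth_on S (\<lambda>z. L z b)" and X: "smooth_on S X"
  shows smooth_on_family: "smooth_on S (\<lambda>z. L z (X z))"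
    and pd_family: "y \<in> S \<Longrightarrow>
      pd u (\<lambda>z. L z (X z)) y = pd u (\<lambda>z. L z (X y)) y + L y (pd u X y)"
proof -
  have exp: "L z x = (\<Sum>b\<in>Basis. (x \<bullet> b) *\<^sub>R L z b)" if "z \<in> S" for z x
  proof -
    interpret linear "L z" by (rule lin[OF that])
    show ?thesis by (simp add: sum[symmetric] scaleR[symmetric] euclidean_representation)
  qed
  have Xb: "smooth_on S (\<lambda>z. X z \<bullet> b)" for b
    by (rule smooth_on_linear[OF bounded_linear_inner_left S X])
  show "smooth_on S (\<lambda>z. L z (X z))"
    by (rule smooth_on_cong[OF S _ exp[symmetric]])
      (intro smooth_on_sum S smooth_on_scaleR Xb sm, simp)
  assume y: "y \<in> S"
  have "pd u (\<lambda>z. L z (X z)) y = pd u (\<lambda>z. \<Sum>b\<in>Basis. (X z \<bullet> b) *\<^sub>R L z b) y"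
    by (rule pd_cong[OF S exp y])
  also have "\<dots> = (\<Sum>b\<in>Basis. (X y \<bullet> b) *\<^sub>R pd u (\<lambda>z. L z b) y)
      + (\<Sum>b\<in>Basis. (pd u X y \<bullet> b) *\<^sub>R L y b)"
    by (subst pd_sum[of _ S])
      (auto simp: y sum.distrib pd_scaleR[OF Xb sm y] pd_linear[OF bounded_linear_inner_left X y]
        add.commute intro!: smooth_on_scaleR S Xb sm)
  also have "(\<Sum>b\<in>Basis. (pd u X y \<bullet> b) *\<^sub>R L y b) = L y (pd u X y)"
    by (rule exp[OF y, symmetric])
  also have "(\<Sum>b\<in>Basis. (X y \<bullet> b) *\<^sub>R pd u (\<lambda>z. L z b) y)
      = pd u (\<lambda>z. \<Sum>b\<in>Basis. (X y \<bullet> b) *\<^sub>R L z b) y"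
    by (subst pd_sum[of _ S])
      (auto simp: y pd_linear[OF bounded_linear_scaleR_right sm y]
         intro!: smooth_on_scaleR S smooth_on_const sm)
  also have "\<dots> = pd u (\<lambda>z. L z (X y)) y"
    by (rule pd_cong[OF S exp[symmetric] y])
  finally show "pd u (\<lambda>z. L z (X z)) y = pd u (\<lambda>z. L z (X y)) y + L y (pd u X y)" .
qed

text \<open>The mean value theorem twice: along \<open>u\<close> for the difference of
  \<open>f\<close> across \<open>h v\<close>, and along \<open>v\<close> for the resulting
  difference of \<open>pd u f\<close>.\<close>

lemma second_difference_mean_value:
  fixes f :: "real^'d \<Rightarrow> real"
  assumes f: "smooth_on S f" and S: "open S" and h: "h > 0"
    and sub: "\<And>s t. 0 \<le> s \<Longrightarrow> s \<le> h \<Longrightarrow> 0 \<le> t \<Longrightarrow> t \<le> h \<Longrightarrow> y + s *\<^sub>R u + t *\<^sub>R v \<in> S"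
  shows "\<exists>s t. 0 \<le> s \<and> s \<le> h \<and> 0 \<le> t \<and> t \<le> h \<and>
    f (y + h *\<^sub>R u + h *\<^sub>R v) - f (y + h *\<^sub>R u) - f (y + h *\<^sub>R v) + f y =
    h * h * pd v (pd u f) (y + s *\<^sub>R u + t *\<^sub>R v)"
proof -
  have D1: "((\<lambda>s. k (y + s *\<^sub>R u + t *\<^sub>R v)) has_real_derivative pd u k (y + s *\<^sub>R u + t *\<^sub>R v)) (at s)"
    and D2: "((\<lambda>t. k (y + s *\<^sub>R u + t *\<^sub>R v)) has_real_derivative pd v k (y + s *\<^sub>R u + t *\<^sub>R v)) (at t)"
    if "smooth_on S k" "0 \<le> s" "s \<le> h" "0 \<le> t" "t \<le> h" for k :: "real^'d \<Rightarrow> real" and s t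
  proof -
    let ?p = "y + s *\<^sub>R u + t *\<^sub>R v"
    have p: "?p \<in> S" using sub that by simp
    note k = smooth_on_has_derivative[OF that(1) p]
    interpret linear "\<lambda>u. pd u k ?p" by (rule linear_pd[OF that(1) p])
    have "((\<lambda>s. y + s *\<^sub>R u + t *\<^sub>R v) has_derivative (\<lambda>r. r *\<^sub>R u)) (at s)"
      "((\<lambda>t. y + s *\<^sub>R u + t *\<^sub>R v) has_derivative (\<lambda>r. r *\<^sub>R v)) (at t)"
      by (auto intro!: derivative_eq_intros)
    from this[THEN has_derivative_compose, OF k]
    show "((\<lambda>s. k (y + s *\<^sub>R u + t *\<^sub>R v)) has_real_derivative pd u k ?p) (at s)"
      and "((\<lambda>t. k (y + s *\<^sub>R u + t *\<^sub>R v)) has_real_derivative pd v k ?p) (at t)"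
      by (auto simp: has_field_derivative_def scaleR mult_commute_abs)
  qed
  \<comment> \<open>The zero multiples stay unsimplified so that every term is literally the curve
    at one of its end points.\<close>
  obtain s where s: "0 < s" "s < h" and
    1: "(f (y + h *\<^sub>R u + h *\<^sub>R v) - f (y + h *\<^sub>R u + 0 *\<^sub>R v))
        - (f (y + 0 *\<^sub>R u + h *\<^sub>R v) - f (y + 0 *\<^sub>R u + 0 *\<^sub>R v)) =
     (h - 0) * (pd u f (y + s *\<^sub>R u + h *\<^sub>R v) - pd u f (y + s *\<^sub>R u + 0 *\<^sub>R v))"
    by (rule exE[OF MVT2[OF h, of "\<lambda>s. f (y + s *\<^sub>R u + h *\<^sub>R v) - f (y + s *\<^sub>R u + 0 *\<^sub>R v)"
       "\<lambda>s. pd u f (y + s *\<^sub>R u + h *\<^sub>R v) - pd u f (y + s *\<^sub>R u + 0 *\<^sub>R v)"]])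
      (use h in \<open>auto intro!: DERIV_diff D1[OF f] simp del: scale_zero_left\<close>)
  obtain t where t: "0 < t" "t < h" and
    2: "pd u f (y + s *\<^sub>R u + h *\<^sub>R v) - pd u f (y + s *\<^sub>R u + 0 *\<^sub>R v) =
     (h - 0) * pd v (pd u f) (y + s *\<^sub>R u + t *\<^sub>R v)"
    by (rule exE[OF MVT2[OF h, of "\<lambda>t. pd u f (y + s *\<^sub>R u + t *\<^sub>R v)"
       "\<lambda>t. pd v (pd u f) (y + s *\<^sub>R u + t *\<^sub>R v)"]])
      (use h s in \<open>auto intro!: D2[OF smooth_on_pd[OF S f]] simp del: scale_zero_left\<close>)
  show ?thesis
    using 1 2 s t by (intro exI[of _ s] exI[of _ t]) (auto simp: algebra_simps)
qed

text \<open>The second difference is symmetric in \<open>u\<close> and \<open>v\<close>, so the two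
  mixed derivatives agree at two points arbitrarily close to \<open>y\<close>; continuity brings
  both values to \<open>y\<close>.\<close>

lemma pd_commute_real:
  fixes f :: "real^'d \<Rightarrow> real"
  assumes S: "open S" and f: "smooth_on S f" and y: "y \<in> S"
  shows "pd u (pd v f) y = pd v (pd u f) y"
proof -
  have cont: "isCont (pd a (pd b f)) y" for a b
    using smooth_on_differentiable[OF smooth_on_pd[OF S smooth_on_pd[OF S f]] y]
    by (rule differentiable_imp_continuous_within)
  have "\<bar>pd u (pd v f) y - pd v (pd u f) y\<bar> < r" if r: "r > 0" for r
  proof -
    have r2: "r / 2 > 0" using r by simp
    obtain d1 where d1: "d1 > 0"
      "\<forall>z. dist z y < d1 \<longrightarrow> dist (pd u (pd v f) z) (pd u (pd v f) y) < r/2"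
      by (rule exE[OF cont[where a = u and b = v, unfolded continuous_at_eps_delta, rule_format, OF r2]])
        (elim conjE, rule that)
    obtain d2 where d2: "d2 > 0"
      "\<forall>z. dist z y < d2 \<longrightarrow> dist (pd v (pd u f) z) (pd v (pd u f) y) < r/2"
      by (rule exE[OF cont[where a = v and b = u, unfolded continuous_at_eps_delta, rule_format, OF r2]])
        (elim conjE, rule that)
    obtain d3 where d3: "d3 > 0" "\<forall>z. dist z y < d3 \<longrightarrow> z \<in> S"
      using S y unfolding open_dist by auto
    \<comment> \<open>With this \<open>h\<close> the whole parallelogram spanned by
      \<open>h u\<close> and \<open>h v\<close> stays within \<open>d\<close> of \<open>y\<close>;
      the summand 1 keeps the denominator positive when both vectors vanish.\<close>
    define d where "d = min d1 (min d2 d3)"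
    define h where "h = d / (2 * (norm u + norm v + 1))"
    have d: "d > 0" using d1(1) d2(1) d3(1) by (auto simp: d_def)
    have N: "norm u + norm v + 1 > 0" by (simp add: add_nonneg_pos)
    have h: "h > 0" using d N by (simp add: h_def)
    have close: "dist (y + s *\<^sub>R u + t *\<^sub>R v) y < d"
      if "0 \<le> s" "s \<le> h" "0 \<le> t" "t \<le> h" for s t
    proof -
      have "dist (y + s *\<^sub>R u + t *\<^sub>R v) y \<le> s * norm u + t * norm v"
        using norm_triangle_ineq[of "s *\<^sub>R u" "t *\<^sub>R v"] that by (simp add: dist_norm add.assoc)
      also have "\<dots> \<le> h * norm u + h * norm v"
        using that by (intro add_mono mult_right_mono) auto
      also have "\<dots> < h * (2 * (norm u + norm v + 1))"
        using h by (simp add: algebra_simps add_pos_nonneg add_nonneg_pos)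
      also have "\<dots> = d"
        unfolding h_def using N by simp
      finally show ?thesis .
    qed
    have close': "dist (y + s *\<^sub>R v + t *\<^sub>R u) y < d"
      if "0 \<le> s" "s \<le> h" "0 \<le> t" "t \<le> h" for s t
      using close[of t s] that by (simp add: add.assoc add.commute add.left_commute)
    have S1: "y + s *\<^sub>R u + t *\<^sub>R v \<in> S" "y + s *\<^sub>R v + t *\<^sub>R u \<in> S"
      if "0 \<le> s" "s \<le> h" "0 \<le> t" "t \<le> h" for s t
      using close[OF that] close'[OF that] d3(2) by (simp_all add: d_def)
    obtain s t where st: "0 \<le> s" "s \<le> h" "0 \<le> t" "t \<le> h"
      "f (y + h *\<^sub>R u + h *\<^sub>R v) - f (y + h *\<^sub>R u) - f (y + h *\<^sub>R v) + f y
       = h * h * pd v (pd u f) (y + s *\<^sub>R u + t *\<^sub>R v)"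
      by (rule exE[OF second_difference_mean_value[OF f S h S1(1)]]) (assumption+, elim exE conjE, rule that)
    obtain s' t' where st': "0 \<le> s'" "s' \<le> h" "0 \<le> t'" "t' \<le> h"
      "f (y + h *\<^sub>R v + h *\<^sub>R u) - f (y + h *\<^sub>R v) - f (y + h *\<^sub>R u) + f y
       = h * h * pd u (pd v f) (y + s' *\<^sub>R v + t' *\<^sub>R u)"
      by (rule exE[OF second_difference_mean_value[OF f S h S1(2)]]) (assumption+, elim exE conjE, rule that)
    have "h * h * pd v (pd u f) (y + s *\<^sub>R u + t *\<^sub>R v) = h * h * pd u (pd v f) (y + s' *\<^sub>R v + t' *\<^sub>R u)"
    proof -
      have e: "y + h *\<^sub>R v + h *\<^sub>R u = y + h *\<^sub>R u + h *\<^sub>R v" by simp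
      from st(5) st'(5)[unfolded e] show ?thesis by linarith
    qed
    then have eq: "pd v (pd u f) (y + s *\<^sub>R u + t *\<^sub>R v) = pd u (pd v f) (y + s' *\<^sub>R v + t' *\<^sub>R u)"
      using h by simp
    show ?thesis
      using d1(2)[rule_format, of "y + s' *\<^sub>R v + t' *\<^sub>R u"] d2(2)[rule_format, of "y + s *\<^sub>R u + t *\<^sub>R v"]
        close[OF st(1-4)] close'[OF st'(1-4)] eq
      unfolding d_def dist_real_def by linarith
  qed
  from this[of "\<bar>pd u (pd v f) y - pd v (pd u f) y\<bar>"] show ?thesis by auto
qed

lemma pd_commute:
  fixes f :: "real^'d \<Rightarrow> 'b::euclidean_space"
  assumes S: "open S" and f: "smooth_on S f" and y: "y \<in> S"
  shows "pd u (pd v f) y = pd v (pd u f) y"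
proof (rule euclidean_eqI)
  fix b :: 'b assume "b \<in> Basis"
  have fb: "smooth_on S (\<lambda>z. f z \<bullet> b)"
    by (rule smooth_on_linear[OF bounded_linear_inner_left S f])
  have *: "pd u (pd v f) y \<bullet> b = pd u (pd v (\<lambda>z. f z \<bullet> b)) y" for u v
  proof -
    have "pd u (pd v f) y \<bullet> b = pd u (\<lambda>z. pd v f z \<bullet> b) y"
      by (rule pd_linear[OF bounded_linear_inner_left smooth_on_pd[OF S f] y, symmetric])
    also have "\<dots> = pd u (pd v (\<lambda>z. f z \<bullet> b)) y"
      by (rule pd_cong[OF S _ y]) (rule pd_linear[OF bounded_linear_inner_left f, symmetric])
    finally show ?thesis .
  qed
  show "pd u (pd v f) y \<bullet> b = pd v (pd u f) y \<bullet> b"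
    unfolding * by (rule pd_commute_real[OF S fb y])
qed

section \<open>Clifford modules\<close>

lemma sum_rotate:
  "(\<Sum>j\<in>I. \<Sum>a\<in>J. \<Sum>b\<in>K. f j a b) = (\<Sum>a\<in>J. \<Sum>b\<in>K. \<Sum>j\<in>I. f j a b)"
  by (subst sum.swap, subst (2) sum.swap) (rule refl)

lemma sum_scaleR_delta:
  fixes r :: "'d::finite \<Rightarrow> real" and v :: "'d \<Rightarrow> 'v::real_vector"
  shows "(\<Sum>x\<in>UNIV. r x *\<^sub>R (if x = y then v x else 0)) = r y *\<^sub>R v y"
    "(\<Sum>x\<in>UNIV. r x *\<^sub>R (if y = x then v x else 0)) = r y *\<^sub>R v y"
proof -
  have "r x *\<^sub>R (if x = y then v x else 0) = (if x = y then r x *\<^sub>R v x else 0)"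
    "r x *\<^sub>R (if y = x then v x else 0) = (if y = x then r x *\<^sub>R v x else 0)" for x
    by auto
  then show "(\<Sum>x\<in>UNIV. r x *\<^sub>R (if x = y then v x else 0)) = r y *\<^sub>R v y"
    "(\<Sum>x\<in>UNIV. r x *\<^sub>R (if y = x then v x else 0)) = r y *\<^sub>R v y"
    by (simp_all add: sum.delta)
qed

text \<open>The spinor space is taken over the reals because all tensor coefficients are real, and
  generators are operators, so that complex matrices are just one instance.\<close>

locale clifford_module =
  fixes \<gamma> :: "'d::finite \<Rightarrow> 'v::real_vector \<Rightarrow> 'v"
  assumes linear_gamma: "linear (\<gamma> m)"
    and clifford: "\<gamma> m (\<gamma> n v) + \<gamma> n (\<gamma> m v) = (if m = n then 2 *\<^sub>R v else 0)"
begin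

sublocale gamma: linear "\<gamma> m" for m
  by (rule linear_gamma)

lemma gamma_swap: "\<gamma> m (\<gamma> n v) = (if m = n then 2 *\<^sub>R v else 0) - \<gamma> n (\<gamma> m v)"
  using clifford[of m n v] by (simp add: algebra_simps)

lemma gamma_square: "\<gamma> m (\<gamma> m v) = v"
  using clifford[of m m v] by (simp flip: scaleR_2)

text \<open>This rule and the next bring the cyclic permutations of a triple product back to the
  standard order.\<close>

lemma gamma_move_right: "\<gamma> b (\<gamma> j (\<gamma> a v)) =
    (if b = j then 2 *\<^sub>R \<gamma> a v else 0) - (if b = a then 2 *\<^sub>R \<gamma> j v else 0) + \<gamma> j (\<gamma> a (\<gamma> b v))"
  using gamma_swap[of b j "\<gamma> a v"] gamma_swap[of b a v]
  by (simp add: gamma.diff gamma.scaleR gamma.zero split: if_splits)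

lemma gamma_move_left: "\<gamma> a (\<gamma> b (\<gamma> j v)) =
    (if b = j then 2 *\<^sub>R \<gamma> a v else 0) - (if a = j then 2 *\<^sub>R \<gamma> b v else 0) + \<gamma> j (\<gamma> a (\<gamma> b v))"
  using gamma_swap[of b j v] gamma_swap[of a j "\<gamma> b v"]
  by (simp add: gamma.diff gamma.scaleR gamma.zero split: if_splits)

section \<open>Contractions with one, two and three generators\<close>

definition c1 :: "('d \<Rightarrow> real) \<Rightarrow> 'v \<Rightarrow> 'v" where
  "c1 w \<psi> = (\<Sum>m\<in>UNIV. w m *\<^sub>R \<gamma> m \<psi>)"

text \<open>For skew \<open>F\<close> this is the contraction with \<open>gamma2\<close>
  (\<open>gamma2_sum\<close>). Without antisymmetrization, \<open>c3\<close> on coefficients that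
  are not totally skew retains the traces from which the field equations are read off.\<close>

definition c2 :: "('d \<Rightarrow> 'd \<Rightarrow> real) \<Rightarrow> 'v \<Rightarrow> 'v" where
  "c2 F \<psi> = (\<Sum>m\<in>UNIV. \<Sum>n\<in>UNIV. F m n *\<^sub>R \<gamma> m (\<gamma> n \<psi>))"

definition c3 :: "('d \<Rightarrow> 'd \<Rightarrow> 'd \<Rightarrow> real) \<Rightarrow> 'v \<Rightarrow> 'v" where
  "c3 T \<psi> = (\<Sum>j\<in>UNIV. \<Sum>a\<in>UNIV. \<Sum>b\<in>UNIV. T j a b *\<^sub>R \<gamma> j (\<gamma> a (\<gamma> b \<psi>)))"

lemmas c_linear_simps = scaleR_sum_right scaleR_sum_left gamma.sum gamma.add gamma.diff gamma.scaleR
  gamma.neg sum.distrib sum_subtractf sum_negf scaleR_add_left scaleR_diff_left scaleR_add_right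
  scaleR_diff_right

lemma c1_add: "c1 (\<lambda>m. v m + w m) \<psi> = c1 v \<psi> + c1 w \<psi>"
  and c1_diff: "c1 (\<lambda>m. v m - w m) \<psi> = c1 v \<psi> - c1 w \<psi>"
  and c1_scale: "c1 (\<lambda>m. r * w m) \<psi> = r *\<^sub>R c1 w \<psi>"
  and c1_zero: "c1 w 0 = 0"
  by (simp_all add: c1_def c_linear_simps)

lemma c2_add: "c2 (\<lambda>m n. F m n + G m n) \<psi> = c2 F \<psi> + c2 G \<psi>"
  and c2_diff: "c2 (\<lambda>m n. F m n - G m n) \<psi> = c2 F \<psi> - c2 G \<psi>"
  and c2_scale: "c2 (\<lambda>m n. r * F m n) \<psi> = r *\<^sub>R c2 F \<psi>"
  and c2_zero: "c2 F 0 = 0"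
  by (simp_all add: c2_def c_linear_simps)

lemma c3_add: "c3 (\<lambda>j a b. S j a b + T j a b) \<psi> = c3 S \<psi> + c3 T \<psi>"
  and c3_diff: "c3 (\<lambda>j a b. S j a b - T j a b) \<psi> = c3 S \<psi> - c3 T \<psi>"
  and c3_scale: "c3 (\<lambda>j a b. r * T j a b) \<psi> = r *\<^sub>R c3 T \<psi>"
  and c3_zero: "c3 T 0 = 0"
  by (simp_all add: c3_def c_linear_simps)

lemma c2_sum: "c2 (\<lambda>m n. \<Sum>k\<in>I. F k m n) \<psi> = (\<Sum>k\<in>I. c2 (F k) \<psi>)"
  by (induction I rule: infinite_finite_induct) (simp_all add: c2_add, simp_all add: c2_def)

lemma linear_c2: "linear (c2 F)"
  by (rule linearI) (simp_all add: c2_def c_linear_simps mult.commute)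

sublocale c2: linear "c2 F" for F
  by (rule linear_c2)

lemma c3_eq_c2: "c3 T \<psi> = (\<Sum>j\<in>UNIV. \<gamma> j (c2 (T j) \<psi>))"
  by (simp add: c2_def c3_def c_linear_simps)

text \<open>Averaging over the two orders of \<open>m\<close> and \<open>n\<close> leaves only
  anticommutators, which are diagonal.\<close>

lemma c1_c1: "c1 w (c1 w \<psi>) = (\<Sum>m\<in>UNIV. (w m)\<^sup>2) *\<^sub>R \<psi>"
proof -
  have "c1 w (c1 w \<psi>) = (\<Sum>m\<in>UNIV. \<Sum>n\<in>UNIV. (w m * w n) *\<^sub>R \<gamma> m (\<gamma> n \<psi>))" (is "?L = ?M")
    by (simp add: c1_def c_linear_simps)
  moreover have "?M = (\<Sum>m\<in>UNIV. \<Sum>n\<in>UNIV. (w m * w n) *\<^sub>R \<gamma> n (\<gamma> m \<psi>))"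
    by (subst sum.swap) (simp add: mult.commute)
  ultimately have "2 *\<^sub>R ?L =
      (\<Sum>m\<in>UNIV. \<Sum>n\<in>UNIV. (w m * w n) *\<^sub>R (\<gamma> m (\<gamma> n \<psi>) + \<gamma> n (\<gamma> m \<psi>)))"
    by (simp add: scaleR_2 scaleR_add_right sum.distrib)
  also have "\<dots> = 2 *\<^sub>R ((\<Sum>m\<in>UNIV. (w m)\<^sup>2) *\<^sub>R \<psi>)"
    by (simp add: clifford sum_scaleR_delta power2_eq_square scaleR_sum_left scaleR_sum_right
        mult.commute)
  finally show ?thesis by (simp only: scaleR_cancel_left) simp
qed

text \<open>Turns an identity on a nonzero spinor into equations for components: a second
  application of \<open>c1 w\<close> gives the squared norm of \<open>w\<close> times the
  spinor.\<close>

lemma c1_eq_0_imp: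
  assumes "c1 w \<psi> = 0" "\<psi> \<noteq> 0"
  shows "w m = 0"
proof -
  have "(\<Sum>m\<in>UNIV. (w m)\<^sup>2) = 0"
    using c1_c1[of w \<psi>] assms by (simp add: c1_zero)
  then show ?thesis by (simp add: sum_nonneg_eq_0_iff)
qed

text \<open>Relabelling moves the cyclic permutation from the coefficients to the generators.
  Restoring the order costs traces: the one over the last two indices vanishes by skewness, and the
  one over the first two is minus the one over first and last. The two rotated sums thus contribute
  2 and 4 copies of the trace, whence the 6.\<close>

lemma c3_cyclic:
  assumes anti: "\<And>j a b. T j b a = - T j a b"
  shows "c3 (\<lambda>j a b. T j a b + T a b j + T b j a) \<psi>
    = 3 *\<^sub>R c3 T \<psi> + 6 *\<^sub>R c1 (\<lambda>a. \<Sum>j\<in>UNIV. T j a j) \<psi>"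
proof -
  let ?t = "c1 (\<lambda>a. \<Sum>j\<in>UNIV. T j a j) \<psi>"
  have tr0: "T j a a = 0" for j a using anti[of j a a] by simp
  have t1: "(\<Sum>j\<in>UNIV. \<Sum>a\<in>UNIV. T j a j *\<^sub>R \<gamma> a \<psi>) = ?t"
    unfolding c1_def by (subst sum.swap) (simp add: scaleR_sum_left)
  have t2: "(\<Sum>j\<in>UNIV. \<Sum>b\<in>UNIV. T j j b *\<^sub>R \<gamma> b \<psi>) = - ?t"
    using t1 by (subst anti) (simp add: sum_negf)
  have split: "(\<Sum>j\<in>UNIV. \<Sum>a\<in>UNIV. \<Sum>b\<in>UNIV. T j a b *\<^sub>R (X j a b - Y j a b + \<gamma> j (\<gamma> a (\<gamma> b \<psi>))))
      = (\<Sum>j\<in>UNIV. \<Sum>a\<in>UNIV. \<Sum>b\<in>UNIV. T j a b *\<^sub>R X j a b)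
      - (\<Sum>j\<in>UNIV. \<Sum>a\<in>UNIV. \<Sum>b\<in>UNIV. T j a b *\<^sub>R Y j a b) + c3 T \<psi>" for X Y
    by (simp only: scaleR_diff_right scaleR_add_right sum_subtractf sum.distrib c3_def)
  have s1: "(\<Sum>j\<in>UNIV. \<Sum>a\<in>UNIV. \<Sum>b\<in>UNIV. T j a b *\<^sub>R (if b = j then 2 *\<^sub>R \<gamma> a \<psi> else 0)) = 2 *\<^sub>R ?t"
    by (simp only: sum_scaleR_delta) (simp add: scaleR_sum_right mult.commute flip: t1)
  have s2: "(\<Sum>j\<in>UNIV. \<Sum>a\<in>UNIV. \<Sum>b\<in>UNIV. T j a b *\<^sub>R (if b = a then 2 *\<^sub>R \<gamma> j \<psi> else 0)) = 0"
    by (simp only: sum_scaleR_delta tr0) simp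
  have s3: "(\<Sum>j\<in>UNIV. \<Sum>a\<in>UNIV. \<Sum>b\<in>UNIV. T j a b *\<^sub>R (if a = j then 2 *\<^sub>R \<gamma> b \<psi> else 0)) = - 2 *\<^sub>R ?t"
  proof -
    have "(\<Sum>a\<in>UNIV. \<Sum>b\<in>UNIV. T j a b *\<^sub>R (if a = j then 2 *\<^sub>R \<gamma> b \<psi> else 0))
        = 2 *\<^sub>R (\<Sum>b\<in>UNIV. T j j b *\<^sub>R \<gamma> b \<psi>)" for j
      by (subst sum.swap, simp only: sum_scaleR_delta) (simp add: scaleR_sum_right mult.commute)
    then show ?thesis using t2 by (simp flip: scaleR_sum_right)
  qed
  have A: "c3 (\<lambda>j a b. T a b j) \<psi> = c3 T \<psi> + 2 *\<^sub>R ?t"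
  proof -
    have "c3 (\<lambda>j a b. T a b j) \<psi> = (\<Sum>j\<in>UNIV. \<Sum>a\<in>UNIV. \<Sum>b\<in>UNIV. T j a b *\<^sub>R \<gamma> b (\<gamma> j (\<gamma> a \<psi>)))"
      unfolding c3_def by (rule sum_rotate)
    also have "\<dots> = (\<Sum>j\<in>UNIV. \<Sum>a\<in>UNIV. \<Sum>b\<in>UNIV. T j a b *\<^sub>R
        ((if b = j then 2 *\<^sub>R \<gamma> a \<psi> else 0) - (if b = a then 2 *\<^sub>R \<gamma> j \<psi> else 0) + \<gamma> j (\<gamma> a (\<gamma> b \<psi>))))"
      by (subst gamma_move_right) (rule refl)
    also have "\<dots> = c3 T \<psi> + 2 *\<^sub>R ?t"
      by (simp add: split s1 s2)
    finally show ?thesis .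
  qed
  have B: "c3 (\<lambda>j a b. T b j a) \<psi> = c3 T \<psi> + 4 *\<^sub>R ?t"
  proof -
    have "c3 (\<lambda>j a b. T b j a) \<psi> = (\<Sum>j\<in>UNIV. \<Sum>a\<in>UNIV. \<Sum>b\<in>UNIV. T j a b *\<^sub>R \<gamma> a (\<gamma> b (\<gamma> j \<psi>)))"
      unfolding c3_def by (rule sum_rotate[symmetric])
    also have "\<dots> = (\<Sum>j\<in>UNIV. \<Sum>a\<in>UNIV. \<Sum>b\<in>UNIV. T j a b *\<^sub>R
        ((if b = j then 2 *\<^sub>R \<gamma> a \<psi> else 0) - (if a = j then 2 *\<^sub>R \<gamma> b \<psi> else 0) + \<gamma> j (\<gamma> a (\<gamma> b \<psi>))))"
      by (subst gamma_move_left) (rule refl)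
    also have "\<dots> = c3 T \<psi> + 4 *\<^sub>R ?t"
      by (simp add: split s1 s3) (simp add: algebra_simps flip: scaleR_add_left)
    finally show ?thesis .
  qed
  show ?thesis
    unfolding c3_add A B
    using scaleR_add_left[of 1 2 "c3 T \<psi>"] scaleR_add_left[of 2 4 ?t] by (simp add: scaleR_2)
qed

text \<open>A bivector acts on vectors by commutator, as an infinitesimal rotation. Two
  anticommutators of size 2, equal by skewness of \<open>W\<close>, make the 4, which is what the
  1/4 in the spin connection compensates.\<close>

lemma c2_gamma:
  assumes anti: "\<And>m n. W n m = - W m n"
  shows "c2 W (\<gamma> a \<psi>) = \<gamma> a (c2 W \<psi>) - 4 *\<^sub>R (\<Sum>c\<in>UNIV. W a c *\<^sub>R \<gamma> c \<psi>)"
proof -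
  have "c2 W (\<gamma> a \<psi>) = (\<Sum>m\<in>UNIV. \<Sum>n\<in>UNIV. W m n *\<^sub>R
      ((if n = a then 2 *\<^sub>R \<gamma> m \<psi> else 0) - (if m = a then 2 *\<^sub>R \<gamma> n \<psi> else 0) + \<gamma> a (\<gamma> m (\<gamma> n \<psi>))))"
    unfolding c2_def
    by (subst gamma_move_left) (rule refl)
  also have "\<dots> = (\<Sum>m\<in>UNIV. W m a *\<^sub>R 2 *\<^sub>R \<gamma> m \<psi>) - (\<Sum>n\<in>UNIV. W a n *\<^sub>R 2 *\<^sub>R \<gamma> n \<psi>) + \<gamma> a (c2 W \<psi>)"
  proof -
    have "(\<Sum>m\<in>UNIV. \<Sum>n\<in>UNIV. W m n *\<^sub>R (if m = a then 2 *\<^sub>R \<gamma> n \<psi> else 0)) = (\<Sum>n\<in>UNIV. W a n *\<^sub>R 2 *\<^sub>R \<gamma> n \<psi>)"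
      by (subst sum.swap) (simp only: sum_scaleR_delta)
    then show ?thesis
      by (simp add: c_linear_simps sum_scaleR_delta c2_def del: scaleR_scaleR)
  qed
  also have "(\<Sum>m\<in>UNIV. W m a *\<^sub>R 2 *\<^sub>R \<gamma> m \<psi>) = - (\<Sum>n\<in>UNIV. W a n *\<^sub>R 2 *\<^sub>R \<gamma> n \<psi>)"
    by (subst anti) (simp add: sum_negf)
  also have "(\<Sum>n\<in>UNIV. W a n *\<^sub>R 2 *\<^sub>R \<gamma> n \<psi>) = 2 *\<^sub>R (\<Sum>n\<in>UNIV. W a n *\<^sub>R \<gamma> n \<psi>)"
    by (simp add: scaleR_sum_right mult.commute)
  finally show ?thesis by (simp add: algebra_simps flip: scaleR_add_left)
qed

lemma c2_c1:
  assumes "\<And>m n. W n m = - W m n"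
  shows "c2 W (c1 w \<psi>) = c1 w (c2 W \<psi>) - 4 *\<^sub>R c1 (\<lambda>c. \<Sum>a\<in>UNIV. w a * W a c) \<psi>"
proof -
  have "c2 W (c1 w \<psi>) = (\<Sum>m\<in>UNIV. w m *\<^sub>R (\<gamma> m (c2 W \<psi>) - 4 *\<^sub>R (\<Sum>c\<in>UNIV. W m c *\<^sub>R \<gamma> c \<psi>)))"
    unfolding c1_def by (simp add: c2.sum c2.scaleR c2_gamma[OF assms])
  also have "\<dots> = c1 w (c2 W \<psi>) - 4 *\<^sub>R (\<Sum>m\<in>UNIV. \<Sum>c\<in>UNIV. (w m * W m c) *\<^sub>R \<gamma> c \<psi>)"
    by (simp add: c1_def c_linear_simps mult.left_commute)
  also have "(\<Sum>m\<in>UNIV. \<Sum>c\<in>UNIV. (w m * W m c) *\<^sub>R \<gamma> c \<psi>) = c1 (\<lambda>c. \<Sum>a\<in>UNIV. w a * W a c) \<psi>"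
    unfolding c1_def by (subst sum.swap) (simp add: scaleR_sum_left)
  finally show ?thesis .
qed

lemma c2_as_c1: "c2 F \<psi> = (\<Sum>n\<in>UNIV. c1 (\<lambda>m. F m n) (\<gamma> n \<psi>))"
  unfolding c1_def c2_def by (rule sum.swap)

text \<open>Commutation with \<open>c2 W\<close> is a derivation, so each index of \<open>F\<close>
  is rotated in turn: the first by \<open>c2_c1\<close>, the second by
  \<open>c2_gamma\<close>.\<close>

lemma c2_c2:
  assumes "\<And>m n. W n m = - W m n"
  shows "c2 W (c2 F \<psi>) = c2 F (c2 W \<psi>)
    - 4 *\<^sub>R c2 (\<lambda>m n. (\<Sum>k\<in>UNIV. F k n * W k m) + (\<Sum>k\<in>UNIV. F m k * W k n)) \<psi>"
proof -
  have "c2 W (c2 F \<psi>) = (\<Sum>n\<in>UNIV. c1 (\<lambda>m. F m n) (c2 W (\<gamma> n \<psi>)))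
      - 4 *\<^sub>R c2 (\<lambda>m n. \<Sum>k\<in>UNIV. F k n * W k m) \<psi>"
    unfolding c2_as_c1[of F] c2_as_c1[of "\<lambda>m n. \<Sum>k\<in>UNIV. F k n * W k m"]
    by (simp add: c2.sum c2_c1[OF assms] sum_subtractf scaleR_sum_right)
  also have "(\<Sum>n\<in>UNIV. c1 (\<lambda>m. F m n) (c2 W (\<gamma> n \<psi>))) = c2 F (c2 W \<psi>)
      - 4 *\<^sub>R (\<Sum>m\<in>UNIV. \<Sum>n\<in>UNIV. \<Sum>c\<in>UNIV. (F m n * W n c) *\<^sub>R \<gamma> m (\<gamma> c \<psi>))"
    unfolding c2_as_c1[of F]
    by (subst sum.swap) (simp add: c2_gamma[OF assms] c1_def c_linear_simps mult.left_commute)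
  also have "(\<Sum>m\<in>UNIV. \<Sum>n\<in>UNIV. \<Sum>c\<in>UNIV. (F m n * W n c) *\<^sub>R \<gamma> m (\<gamma> c \<psi>))
      = c2 (\<lambda>m n. \<Sum>k\<in>UNIV. F m k * W k n) \<psi>"
    unfolding c2_def scaleR_sum_left by (rule sum.cong[OF refl], rule sum.swap)
  finally show ?thesis by (simp add: c2_add scaleR_add_right)
qed

lemma c2_c3:
  assumes "\<And>m n. W n m = - W m n"
  shows "c2 W (c3 T \<psi>) = c3 T (c2 W \<psi>)
    - 4 *\<^sub>R c3 (\<lambda>j a b. (\<Sum>k\<in>UNIV. T k a b * W k j) + (\<Sum>k\<in>UNIV. T j k b * W k a)
        + (\<Sum>k\<in>UNIV. T j a k * W k b)) \<psi>"
proof -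
  have "c2 W (c3 T \<psi>) = (\<Sum>j\<in>UNIV. c2 W (\<gamma> j (c2 (T j) \<psi>)))"
    by (simp add: c3_eq_c2 c2.sum)
  also have "\<dots> = (\<Sum>j\<in>UNIV. \<gamma> j (c2 W (c2 (T j) \<psi>)))
      - 4 *\<^sub>R (\<Sum>j\<in>UNIV. \<Sum>c\<in>UNIV. W j c *\<^sub>R \<gamma> c (c2 (T j) \<psi>))"
    by (simp add: c2_gamma[OF assms] sum_subtractf scaleR_sum_right)
  also have "(\<Sum>j\<in>UNIV. \<Sum>c\<in>UNIV. W j c *\<^sub>R \<gamma> c (c2 (T j) \<psi>))
      = c3 (\<lambda>j a b. \<Sum>k\<in>UNIV. T k a b * W k j) \<psi>"
    unfolding c3_eq_c2 c2_sum
    by (subst sum.swap) (simp add: gamma.sum mult.commute[of "T _ _ _"] c2_scale gamma.scaleR)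
  also have "(\<Sum>j\<in>UNIV. \<gamma> j (c2 W (c2 (T j) \<psi>))) = c3 T (c2 W \<psi>)
      - 4 *\<^sub>R c3 (\<lambda>j a b. (\<Sum>k\<in>UNIV. T j k b * W k a) + (\<Sum>k\<in>UNIV. T j a k * W k b)) \<psi>"
    unfolding c3_eq_c2
    by (simp add: c2_c2[OF assms] gamma.diff gamma.scaleR sum_subtractf scaleR_sum_right)
  finally show ?thesis
    by (simp add: c3_add add.assoc scaleR_add_right)
qed

section \<open>Invariant inner products\<close>

definition invariant_form :: "'d set \<Rightarrow> ('v \<Rightarrow> 'v \<Rightarrow> real) \<Rightarrow> bool" where
  "invariant_form I B \<longleftrightarrow> (\<forall>u. linear (B u)) \<and> (\<forall>u v. B u v = B v u) \<and>
    (\<forall>u. u \<noteq> 0 \<longrightarrow> B u u > 0) \<and> (\<forall>m\<in>I. \<forall>u v. B (\<gamma> m u) (\<gamma> m v) = B u v)"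

text \<open>Generators are adjoined one at a time, averaging over the identity and
  \<open>\<gamma> m\<close>. As \<open>\<gamma> m\<close> squares to 1, the average is invariant
  under it.\<close>

lemma invariant_form_exists:
  fixes B0 :: "'v \<Rightarrow> 'v \<Rightarrow> real"
  assumes "invariant_form {} B0" "finite I"
  shows "\<exists>B. invariant_form I B"
  using assms(2)
proof (induction I rule: finite_induct)
  case empty
  then show ?case using assms(1) by blast
next
  case (insert m I)
  then obtain B where B0: "invariant_form I B" by blast
  have B: "\<And>u. linear (B u)" "\<And>u v. B u v = B v u" "\<And>u. u \<noteq> 0 \<Longrightarrow> B u u > 0"
    and inv: "\<And>n u v. n \<in> I \<Longrightarrow> B (\<gamma> n u) (\<gamma> n v) = B u v"
    using B0 unfolding invariant_form_def by auto
  have nz: "\<gamma> m u \<noteq> 0" if "u \<noteq> 0" for u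
    using that gamma_square[of m u] gamma.zero by metis
  have neg: "B (- u) (- v) = B u v" for u v
    by (metis B(2) linear_neg[OF B(1)] minus_minus)
  \<comment> \<open>Invariance under the earlier generators survives the averaging: moving
    \<open>\<gamma> m\<close> past \<open>\<gamma> n\<close> changes the sign in both arguments, and
    the signs cancel.\<close>
  have mI: "B (\<gamma> m (\<gamma> n u)) (\<gamma> m (\<gamma> n v)) = B (\<gamma> m u) (\<gamma> m v)" if "n \<in> I" for n u v
  proof -
    have "m \<noteq> n" using that insert.hyps by blast
    then show ?thesis
      using inv[OF that, of "\<gamma> m u" "\<gamma> m v"] by (simp add: gamma_swap[of m n] neg)
  qed
  have "invariant_form (insert m I) (\<lambda>u v. B u v + B (\<gamma> m u) (\<gamma> m v))"
    unfolding invariant_form_def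
  proof (intro conjI allI ballI impI)
    show "linear (\<lambda>v. B u v + B (\<gamma> m u) (\<gamma> m v))" for u
      by (rule linearI) (simp_all add: linear_add[OF B(1)] linear_scale[OF B(1)] gamma.add
        gamma.scaleR algebra_simps)
    show "B u v + B (\<gamma> m u) (\<gamma> m v) = B v u + B (\<gamma> m v) (\<gamma> m u)" for u v
      by (simp only: B(2)[of u v] B(2)[of "\<gamma> m u" "\<gamma> m v"])
    show "0 < B u u + B (\<gamma> m u) (\<gamma> m u)" if "u \<noteq> 0" for u
      by (intro add_pos_pos B(3) nz that)
    show "B (\<gamma> n u) (\<gamma> n v) + B (\<gamma> m (\<gamma> n u)) (\<gamma> m (\<gamma> n v)) = B u v + B (\<gamma> m u) (\<gamma> m v)"
      if "n \<in> insert m I" for n u v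
      using that mI inv by (auto simp: gamma_square)
  qed
  then show ?case by blast
qed

text \<open>The adjoint reverses the product of two self-adjoint generators, and skewness of
  \<open>F\<close> turns the reversal into a sign.\<close>

lemma c2_adjoint:
  fixes B :: "'v \<Rightarrow> 'v \<Rightarrow> real" and F :: "'d \<Rightarrow> 'd \<Rightarrow> real" and u v :: 'v
  assumes B: "invariant_form UNIV B" and anti: "\<And>m n. F n m = - F m n"
  shows "B (c2 F u) v = - B u (c2 F v)"
proof -
  have lin: "linear (B u)" and B_sym: "B u v = B v u" for u v
    using B unfolding invariant_form_def by blast+
  note B_linear = linear_sum[OF lin] linear_scale[OF lin]
  have B_sum: "B (\<Sum>k\<in>I. f k) v = (\<Sum>k\<in>I. B (f k) v)" for I v and f :: "'d \<Rightarrow> 'v"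
    unfolding B_sym[of _ v] by (rule linear_sum[OF lin])
  have B_scale: "B (r *\<^sub>R u) v = r * B u v" for r u v
    unfolding B_sym[of _ v] by (simp add: B_linear)
  \<comment> \<open>An isometry that is its own inverse is self-adjoint.\<close>
  have herm: "B (\<gamma> m u) v = B u (\<gamma> m v)" for m u v
    using B gamma_square unfolding invariant_form_def by (metis UNIV_I)
  have "B (c2 F u) v = (\<Sum>m\<in>UNIV. \<Sum>n\<in>UNIV. F m n * B u (\<gamma> n (\<gamma> m v)))"
    by (simp add: c2_def B_sum B_scale herm)
  also have "\<dots> = (\<Sum>n\<in>UNIV. \<Sum>m\<in>UNIV. - F n m * B u (\<gamma> n (\<gamma> m v)))"
    by (subst sum.swap) (simp add: anti[symmetric])
  also have "\<dots> = - B u (c2 F v)"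
    by (simp add: c2_def B_linear sum_negf)
  finally show ?thesis .
qed

text \<open>Contracting the hypothesis with \<open>\<gamma> i\<close> gives \<open>\<Sum>s t. c2 R\<^sub>s\<^sub>t (c2 R\<^sub>s\<^sub>t \<psi>) = 0\<close>, and each
  \<open>c2 R\<^sub>s\<^sub>t\<close> is skew-adjoint for an invariant inner product.\<close>
lemma curvature_annihilates:
  fixes R :: "'d \<Rightarrow> 'd \<Rightarrow> 's::finite \<Rightarrow> 't::finite \<Rightarrow> real"
  assumes B: "invariant_form UNIV B" and anti: "\<And>i j s t. R j i s t = - R i j s t"
    and eq: "\<And>i. (\<Sum>s\<in>UNIV. \<Sum>t\<in>UNIV. c1 (\<lambda>j. R i j s t) (c2 (\<lambda>k l. R k l s t) \<psi>)) = 0"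
  shows "c2 (\<lambda>k l. R k l s t) \<psi> = 0"
proof -
  let ?S = "\<lambda>s t. c2 (\<lambda>k l. R k l s t)"
  have lin: "linear (B u)" and pos: "u \<noteq> 0 \<Longrightarrow> B u u > 0" for u
    using B unfolding invariant_form_def by blast+
  have nonneg: "B u u \<ge> 0" for u
    by (cases "u = 0") (simp_all add: linear_0[OF lin] less_imp_le[OF pos])
  have "0 = (\<Sum>i\<in>UNIV. \<gamma> i (\<Sum>s\<in>UNIV. \<Sum>t\<in>UNIV. c1 (\<lambda>j. R i j s t) (?S s t \<psi>)))"
    by (simp add: eq gamma.zero)
  also have "\<dots> = (\<Sum>i\<in>UNIV. \<Sum>s\<in>UNIV. \<Sum>t\<in>UNIV. \<gamma> i (c1 (\<lambda>j. R i j s t) (?S s t \<psi>)))"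
    by (simp add: gamma.sum)
  also have "\<dots> = (\<Sum>s\<in>UNIV. \<Sum>t\<in>UNIV. \<Sum>i\<in>UNIV. \<gamma> i (c1 (\<lambda>j. R i j s t) (?S s t \<psi>)))"
    by (rule sum_rotate)
  also have "\<dots> = (\<Sum>s\<in>UNIV. \<Sum>t\<in>UNIV. ?S s t (?S s t \<psi>))"
    by (simp add: c1_def c2_def[of _ "?S _ _ _"] gamma.sum gamma.scaleR)
  finally have "0 = B \<psi> (\<Sum>s\<in>UNIV. \<Sum>t\<in>UNIV. ?S s t (?S s t \<psi>))"
    by (metis linear_0[OF lin])
  also have "\<dots> = - (\<Sum>s\<in>UNIV. \<Sum>t\<in>UNIV. B (?S s t \<psi>) (?S s t \<psi>))"
  proof -
    have "B \<psi> (?S s t (?S s t \<psi>)) = - B (?S s t \<psi>) (?S s t \<psi>)" for s t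
      using c2_adjoint[OF B, of "\<lambda>k l. R k l s t" \<psi> "?S s t \<psi>", OF anti] by simp
    then show ?thesis by (simp add: linear_sum[OF lin] sum_negf)
  qed
  finally have "(\<Sum>s\<in>UNIV. \<Sum>t\<in>UNIV. B (?S s t \<psi>) (?S s t \<psi>)) = 0" by simp
  then have "B (?S s t \<psi>) (?S s t \<psi>) = 0"
    by (simp add: sum_nonneg_eq_0_iff sum_nonneg nonneg)
  then show ?thesis using pos[of "?S s t \<psi>"] by fastforce
qed

end

section \<open>The equations of motion at a point\<close>

definition skew3 :: "('d \<Rightarrow> 'd \<Rightarrow> 'd \<Rightarrow> real) \<Rightarrow> bool" where
  "skew3 H \<longleftrightarrow> (\<forall>i j k. H j i k = - H i j k) \<and> (\<forall>i j k. H i k j = - H i j k)"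

lemma skew3D:
  assumes "skew3 H"
  shows "H j i k = - H i j k" "H i k j = - H i j k" "H k j i = - H i j k"
    "H j k i = H i j k" "H k i j = H i j k" "H i i j = 0" "H i j j = 0" "H i j i = 0"
proof -
  have 1: "H j i k = - H i j k" and 2: "H i k j = - H i j k" for i j k
    using assms unfolding skew3_def by blast+
  show "H j i k = - H i j k" "H i k j = - H i j k" by (rule 1, rule 2)
  show 3: "H j k i = H i j k" for i j k using 1[of j i k] 2[of i j k] 2[of j i k] 1[of i j k] by simp
  show "H k i j = H i j k" using 3[of i j k] by simp
  show "H k j i = - H i j k" using 1[of k j i] 3[of j k i] by simp
  show "H i i j = 0" "H i j j = 0" using 1[of i i j] 2[of i j j] by simp_all
  show "H i j i = 0" using 2[of i i j] 1[of i i j] by simp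
qed

definition riemann_like :: "('d \<Rightarrow> 'd \<Rightarrow> 'd \<Rightarrow> 'd \<Rightarrow> real) \<Rightarrow> bool" where
  "riemann_like R \<longleftrightarrow> (\<forall>i j k l. R j i k l = - R i j k l) \<and> (\<forall>i j k l. R i j l k = - R i j k l) \<and>
    (\<forall>i j k l. R i j k l + R j k i l + R k i j l = 0)"

text \<open>The classical argument: four cyclic identities, one for each rotation of the four
  indices, combine so that all but the two desired terms cancel by skewness.\<close>

lemma riemann_like_pair_symmetry:
  assumes "riemann_like R"
  shows "R k l i j = R i j k l"
proof -
  have a: "R j i k l = - R i j k l" and b: "R i j l k = - R i j k l"
    and c: "R i j k l + R j k i l + R k i j l = 0" for i j k l
    using assms unfolding riemann_like_def by blast+
  show ?thesis
    using c[of i j k l] c[of j k l i] c[of k l i j] c[of l i j k]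
      a[of i j k l] a[of k i j l] a[of j k i l] a[of l i j k] a[of k l i j] a[of j l k i] a[of i k l j]
      b[of i j k l] b[of k i j l] b[of j k i l] b[of l i j k] b[of k l i j] b[of j l k i]
      b[of i k l j] b[of i l j k] b[of j l i k] b[of i k j l] b[of l j k i] b[of i l k j]
      a[of i l j k] a[of j l i k] a[of i k j l]
    by linarith
qed

text \<open>Pair symmetry carries the cyclic identity to the last three indices, the ones contracted
  with generators when \<open>i\<close> is kept fixed.\<close>

lemma riemann_like_cyclic_last:
  assumes "riemann_like R"
  shows "R i j a b + R i a b j + R i b j a = 0"
proof -
  have c: "R i j k l + R j k i l + R k i j l = 0" for i j k l
    using assms unfolding riemann_like_def by blast+
  have a: "R i j l k = - R i j k l" for i j k l
    using assms unfolding riemann_like_def by blast+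
  show ?thesis
    using c[of j a b i] riemann_like_pair_symmetry[OF assms] a by (metis add_uminus_conv_diff diff_eq_eq eq_neg_iff_add_eq_0 add.assoc add.commute add_0 minus_add_distrib)
qed

section \<open>Spinor identities behind the field equations\<close>

context clifford_module
begin

text \<open>\<open>G\<close> stands for \<open>\<nabla>\<^sup>+F\<close>, whose cyclic sum is fixed by the Bianchi identity.\<close>
lemma gauge_field_equation:
  assumes f: "\<And>m n. f n m = - f m n" and G: "\<And>p m n. G p n m = - G p m n" and H: "skew3 H"
    and f0: "c2 f \<epsilon> = 0" and G0: "\<And>p. c2 (G p) \<epsilon> = 0"
    and dil: "c1 \<phi> \<epsilon> = (1/12) *\<^sub>R c3 H \<epsilon>"
    and K: "\<And>p m n. K p m n = (\<Sum>k\<in>UNIV. H k m n * f k p)"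
    and bianchi: "\<And>p m n. G p m n + G m n p + G n p m = - (K p m n + K m n p + K n p m)"
    and \<epsilon>: "\<epsilon> \<noteq> 0"
  shows "(\<Sum>j\<in>UNIV. G j j b) = 2 * (\<Sum>j\<in>UNIV. \<phi> j * f j b)"
proof -
  \<comment> \<open>Since \<open>c2 f\<close> kills the spinor, applying it to the dilatino equation
    leaves only commutators: \<open>f\<close> contracted with the dilaton gradient on the left,
    \<open>H\<close> with its indices rotated by \<open>f\<close> on the right.\<close>
  have "c2 f (c1 \<phi> \<epsilon>) = c2 f ((1/12) *\<^sub>R c3 H \<epsilon>)" by (simp only: dil)
  then have "4 *\<^sub>R c1 (\<lambda>c. \<Sum>a\<in>UNIV. \<phi> a * f a c) \<epsilon> = 4 *\<^sub>R (1/12) *\<^sub>R c3 (\<lambda>j a b.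
      (\<Sum>k\<in>UNIV. H k a b * f k j) + (\<Sum>k\<in>UNIV. H j k b * f k a) + (\<Sum>k\<in>UNIV. H j a k * f k b)) \<epsilon>"
    by (simp add: c2_c1[OF f] c2.scaleR c2_c3[OF f] f0 c1_zero c3_zero)
  then have "c1 (\<lambda>c. \<Sum>a\<in>UNIV. \<phi> a * f a c) \<epsilon> = (1/12) *\<^sub>R c3 (\<lambda>j a b.
      (\<Sum>k\<in>UNIV. H k a b * f k j) + (\<Sum>k\<in>UNIV. H j k b * f k a) + (\<Sum>k\<in>UNIV. H j a k * f k b)) \<epsilon>"
    by (simp only: scaleR_cancel_left) simp
  \<comment> \<open>The Bianchi identity identifies the rotated \<open>H\<close> with minus the
    cyclic sum of \<open>G\<close>, which \<open>c3_cyclic\<close> reduces to a trace because every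
    \<open>G p\<close> annihilates the spinor.\<close>
  also have "(\<lambda>j a b. (\<Sum>k\<in>UNIV. H k a b * f k j) + (\<Sum>k\<in>UNIV. H j k b * f k a)
      + (\<Sum>k\<in>UNIV. H j a k * f k b)) = (\<lambda>j a b. (-1) * (G j a b + G a b j + G b j a))"
    by (simp add: bianchi K skew3D(4)[OF H, of j _ b for j b] skew3D(5)[OF H, of _ j a for j a] fun_eq_iff)
  also have "c3 \<dots> \<epsilon> = - 6 *\<^sub>R c1 (\<lambda>a. \<Sum>j\<in>UNIV. G j a j) \<epsilon>"
    unfolding c3_scale by (subst c3_cyclic[OF G]) (simp add: c3_eq_c2 G0 gamma.zero)
  finally have "c1 (\<lambda>c. 2 * (\<Sum>a\<in>UNIV. \<phi> a * f a c) + (\<Sum>j\<in>UNIV. G j c j)) \<epsilon> = 0"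
    by (simp add: c1_add c1_scale)
  from c1_eq_0_imp[OF this \<epsilon>, of b] show ?thesis
    by (simp add: G[of _ _ b, symmetric] G[of _ b] sum_negf)
qed

text \<open>The three products are the cyclic sum of \<open>T j a b\<close>, the trace of
  \<open>R i j\<close> against \<open>R a b\<close>. Skewness of \<open>T\<close> in
  \<open>a\<close>, \<open>b\<close> is all that \<open>c3_cyclic\<close> asks for, and its trace
  term is the quadratic expression of the metric equation.\<close>

lemma c3_trace_square:
  fixes R :: "'d \<Rightarrow> 'd \<Rightarrow> 's::finite \<Rightarrow> 't::finite \<Rightarrow> real"
  assumes R: "\<And>i j s t. R j i s t = - R i j s t"
  shows "c3 (\<lambda>j a b. \<Sum>s\<in>UNIV. \<Sum>t\<in>UNIV.
        R i j s t * R a b s t + R j a s t * R i b s t + R a i s t * R j b s t) \<psi>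
    = 3 *\<^sub>R (\<Sum>s\<in>UNIV. \<Sum>t\<in>UNIV. c1 (\<lambda>j. R i j s t) (c2 (\<lambda>k l. R k l s t) \<psi>))
      + 6 *\<^sub>R c1 (\<lambda>a. \<Sum>j\<in>UNIV. \<Sum>s\<in>UNIV. \<Sum>t\<in>UNIV. R i j s t * R a j s t) \<psi>"
proof -
  define T where "T = (\<lambda>j a b. \<Sum>s\<in>UNIV. \<Sum>t\<in>UNIV. R i j s t * R a b s t)"
  have T: "T j b a = - T j a b" for j a b
    unfolding T_def by (subst R) (simp add: sum_negf)
  have "(\<lambda>j a b. \<Sum>s\<in>UNIV. \<Sum>t\<in>UNIV.
      R i j s t * R a b s t + R j a s t * R i b s t + R a i s t * R j b s t)
    = (\<lambda>j a b. T j a b + T a b j + T b j a)"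
  proof (intro ext)
    fix j a b
    have "R a i s t * R j b s t = R i a s t * R b j s t" for s t
      using R[of a i s t] R[of j b s t] by simp
    then show "(\<Sum>s\<in>UNIV. \<Sum>t\<in>UNIV. R i j s t * R a b s t + R j a s t * R i b s t + R a i s t * R j b s t)
      = T j a b + T a b j + T b j a"
      unfolding T_def by (simp add: sum.distrib mult.commute[of "R j a _ _"])
  qed
  moreover have "c3 T \<psi> = (\<Sum>s\<in>UNIV. \<Sum>t\<in>UNIV. c1 (\<lambda>j. R i j s t) (c2 (\<lambda>k l. R k l s t) \<psi>))"
  proof -
    have "c3 T \<psi> = (\<Sum>j\<in>UNIV. \<Sum>s\<in>UNIV. \<Sum>t\<in>UNIV. R i j s t *\<^sub>R \<gamma> j (c2 (\<lambda>k l. R k l s t) \<psi>))"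
      unfolding c3_eq_c2 T_def by (simp add: c2_sum c2_scale gamma.sum gamma.scaleR)
    also have "\<dots> = (\<Sum>s\<in>UNIV. \<Sum>t\<in>UNIV. \<Sum>j\<in>UNIV. R i j s t *\<^sub>R \<gamma> j (c2 (\<lambda>k l. R k l s t) \<psi>))"
      by (rule sum_rotate)
    finally show ?thesis unfolding c1_def .
  qed
  ultimately show ?thesis
    using c3_cyclic[OF T, where \<psi> = \<psi>] unfolding T_def by simp
qed

text \<open>With \<open>i\<close> fixed, \<open>r\<close>, \<open>N\<close>, \<open>D\<close> and
  \<open>p\<close> stand for the curvature of \<open>\<nabla>\<^sup>+\<close>, for
  \<open>\<nabla>\<^sup>+H\<close>, \<open>dH\<close> and \<open>\<nabla>\<^sup>+d\<phi>\<close>.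
  The curvature annihilates the spinor, so the cyclic identity determines its trace, and the
  differentiated dilatino equation replaces \<open>N\<close> by \<open>p\<close>.\<close>

lemma metric_equation_spinor_form:
  assumes r: "\<And>j a b. r j b a = - r j a b" and r0: "\<And>j. c2 (r j) \<epsilon> = 0"
    and cyc: "\<And>j a b. r j a b + r a b j + r b j a = N j a b + 1/2 * D j a b"
    and p: "c1 p \<epsilon> = (1/12) *\<^sub>R c3 N \<epsilon>"
  shows "c1 (\<lambda>a. 2 * p a - (\<Sum>j\<in>UNIV. r j a j)) \<epsilon> + (1/12) *\<^sub>R c3 D \<epsilon> = 0"
proof -
  have "6 *\<^sub>R c1 (\<lambda>a. \<Sum>j\<in>UNIV. r j a j) \<epsilon> = c3 (\<lambda>j a b. r j a b + r a b j + r b j a) \<epsilon>"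
    by (subst c3_cyclic[OF r]) (simp add: c3_eq_c2[of r] r0 gamma.zero)
  also have "\<dots> = c3 N \<epsilon> + (1/2) *\<^sub>R c3 D \<epsilon>"
    by (simp only: cyc c3_add c3_scale)
  also have "c3 N \<epsilon> = 12 *\<^sub>R c1 p \<epsilon>" by (simp add: p)
  finally have "(1/6) *\<^sub>R 6 *\<^sub>R c1 (\<lambda>a. \<Sum>j\<in>UNIV. r j a j) \<epsilon>
      = (1/6) *\<^sub>R (12 *\<^sub>R c1 p \<epsilon> + (1/2) *\<^sub>R c3 D \<epsilon>)" by simp
  then show ?thesis by (simp add: c1_diff c1_scale scaleR_add_right)
qed

end

text \<open>The curvature of \<open>\<nabla>\<^sup>+\<close> in terms of that of \<open>\<nabla>\<^sup>g\<close>, where \<open>n\<close> stands for \<open>\<nabla>\<^sup>gH\<close>.\<close>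
locale torsion_curvature =
  fixes R :: "'d::finite \<Rightarrow> 'd \<Rightarrow> 'd \<Rightarrow> 'd \<Rightarrow> real"
    and H :: "'d \<Rightarrow> 'd \<Rightarrow> 'd \<Rightarrow> real" and n :: "'d \<Rightarrow> 'd \<Rightarrow> 'd \<Rightarrow> 'd \<Rightarrow> real"
  assumes R: "riemann_like R" and H: "skew3 H" and n: "\<And>i. skew3 (n i)"
begin

definition "Rp i j a b = R i j a b + 1/2 * (n i j a b - n j i a b)
  + 1/4 * (\<Sum>k\<in>UNIV. H j a k * H i k b - H i a k * H j k b)"

text \<open>These are the components of \<open>\<nabla>\<^sup>+H\<close>: each index of
  \<open>H\<close> is corrected by half the torsion.\<close>

definition "np i j a b = n i j a b
  - 1/2 * (\<Sum>k\<in>UNIV. H i j k * H k a b + H i a k * H j k b + H i b k * H j a k)"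

definition "dH i j a b = n i j a b - n j i a b + n a i j b - n b i j a"

lemma Rp_skew: "Rp i j b a = - Rp i j a b"
proof -
  have "(\<Sum>k\<in>UNIV. H j b k * H i k a - H i b k * H j k a) = (\<Sum>k\<in>UNIV. - (H j a k * H i k b - H i a k * H j k b))"
  proof (rule sum.cong[OF refl])
    fix k
    show "H j b k * H i k a - H i b k * H j k a = - (H j a k * H i k b - H i a k * H j k b)"
      unfolding skew3D(2)[OF H, of j b k] skew3D(2)[OF H, of i k a] skew3D(2)[OF H, of j k a]
        skew3D(2)[OF H, of i k b] by simp
  qed
  moreover have "R i j b a = - R i j a b"
    using R unfolding riemann_like_def by blast
  ultimately show ?thesis
    unfolding Rp_def sum_negf skew3D(2)[OF n[of i], of j b a] skew3D(2)[OF n[of j], of i b a] by argo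
qed

text \<open>The Bianchi identity with torsion. The derivatives along \<open>i\<close> add up to 3/2,
  that is 1 from \<open>np\<close> and 1/2 from \<open>dH\<close>; the quadratic terms give -2 times
  1/4, the -1/2 in \<open>np\<close>.\<close>

lemma Rp_cyclic: "Rp i j a b + Rp i a b j + Rp i b j a = np i j a b + 1/2 * dH i j a b"
proof -
  have "(H j a k * H i k b - H i a k * H j k b) + (H a b k * H i k j - H i b k * H a k j)
      + (H b j k * H i k a - H i j k * H b k a)
    = - 2 * (H i j k * H k a b + H i a k * H j k b + H i b k * H j a k)" for k
    by (simp add: skew3D(2)[OF H, of i k b] skew3D(4)[OF H, of a b k] skew3D(2)[OF H, of i k j]
        skew3D(4)[OF H, of a k j] skew3D(5)[OF H, of b j k] skew3D(2)[OF H, of i k a]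
        skew3D(5)[OF H, of b k a] algebra_simps)
  then have q: "(\<Sum>k\<in>UNIV. H j a k * H i k b - H i a k * H j k b)
      + (\<Sum>k\<in>UNIV. H a b k * H i k j - H i b k * H a k j)
      + (\<Sum>k\<in>UNIV. H b j k * H i k a - H i j k * H b k a)
    = - 2 * (\<Sum>k\<in>UNIV. H i j k * H k a b + H i a k * H j k b + H i b k * H j a k)"
    unfolding sum.distrib[symmetric] sum_distrib_left by (rule sum.cong[OF refl])
  have m: "n i a b j = n i j a b" "n i b j a = n i j a b" "n a i b j = - n a i j b"
    using skew3D[OF n] by metis+
  show ?thesis
    unfolding Rp_def np_def dH_def using q riemann_like_cyclic_last[OF R, of i j a b] m by argo
qed

text \<open>The Ricci tensor of the torsion connection has a symmetric part entering the metric
  equation and a skew part, half the divergence of \<open>H\<close>.\<close>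

lemma Rp_trace: "- (\<Sum>j\<in>UNIV. Rp i j a j)
  = (\<Sum>j\<in>UNIV. R j i a j) - 1/4 * (\<Sum>j\<in>UNIV. \<Sum>k\<in>UNIV. H i j k * H a j k)
    + 1/2 * (\<Sum>j\<in>UNIV. n j j i a)"
proof -
  have "- Rp i j a j = R j i a j - 1/4 * (\<Sum>k\<in>UNIV. H i j k * H a j k) + 1/2 * n j j i a" for j
  proof -
    have "R j i a j = - R i j a j" using R unfolding riemann_like_def by blast
    moreover have "H j a k * H i k j - H i a k * H j k j = H i j k * H a j k" for k
      using skew3D[OF H] by (metis (no_types, lifting) diff_zero minus_mult_minus mult.commute mult_zero_right)
    moreover have "n i j a j = 0" "n j i a j = n j j i a" using skew3D[OF n] by metis+
    ultimately show ?thesis unfolding Rp_def by simp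
  qed
  then show ?thesis
    by (simp add: sum.distrib sum_subtractf sum_distrib_left flip: sum_negf)
qed

end

text \<open>Here \<open>\<phi>\<close> stands for \<open>d\<phi>\<close>, \<open>h\<close> for its Hessian and \<open>n\<close> for \<open>\<nabla>\<^sup>gH\<close>.\<close>
lemma (in clifford_module) equations_of_motion_iff_instanton:
  fixes F :: "'d \<Rightarrow> 'd \<Rightarrow> 'r::finite \<Rightarrow> 'r \<Rightarrow> real"
    and Q :: "'d \<Rightarrow> 'd \<Rightarrow> 's::finite \<Rightarrow> 's \<Rightarrow> real"
  assumes tc: "torsion_curvature R H n" and hess: "\<And>i j. h i j = h j i"
    and Q: "\<And>i j s t. Q j i s t = - Q i j s t" and F: "\<And>i j s t. F j i s t = - F i j s t"
    and F0: "\<And>s t. c2 (\<lambda>k l. F k l s t) \<epsilon> = 0"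
    and Rp0: "\<And>i j. c2 (torsion_curvature.Rp R H n i j) \<epsilon> = 0"
    and dil: "\<And>i. c1 (\<lambda>j. h i j - 1/2 * (\<Sum>k\<in>UNIV. H i j k * \<phi> k)) \<epsilon>
      = (1/12) *\<^sub>R c3 (torsion_curvature.np H n i) \<epsilon>"
    and anomaly: "\<And>i j a b. torsion_curvature.dH n i j a b = \<alpha> / 4 * (tr_wedge Q i j a b - tr_wedge F i j a b)"
    and \<alpha>: "\<alpha> > 0" and \<epsilon>: "\<epsilon> \<noteq> 0" and B: "invariant_form UNIV B"
  shows "(\<forall>i a. (\<Sum>j\<in>UNIV. R j i a j) - 1/4 * (\<Sum>j\<in>UNIV. \<Sum>k\<in>UNIV. H i j k * H a j k) + 2 * h i a
      - \<alpha> / 4 * ((\<Sum>j\<in>UNIV. \<Sum>s\<in>UNIV. \<Sum>t\<in>UNIV. F i j s t * F a j s t)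
                - (\<Sum>j\<in>UNIV. \<Sum>s\<in>UNIV. \<Sum>t\<in>UNIV. Q i j s t * Q a j s t)) = 0)
    \<and> (\<forall>i a. (\<Sum>j\<in>UNIV. n j j i a) - 2 * (\<Sum>j\<in>UNIV. \<phi> j * H j i a) = 0)
    \<longleftrightarrow> (\<forall>s t. c2 (\<lambda>k l. Q k l s t) \<epsilon> = 0)"
    (is "(\<forall>i a. ?M i a = 0) \<and> (\<forall>i a. ?A i a = 0) \<longleftrightarrow> ?I")
proof -
  interpret torsion_curvature R H n by (rule tc)
  let ?Z = "\<lambda>i. \<Sum>s\<in>UNIV. \<Sum>t\<in>UNIV. c1 (\<lambda>j. Q i j s t) (c2 (\<lambda>k l. Q k l s t) \<epsilon>)"
  have key: "c1 (\<lambda>a. ?M i a + 1/2 * ?A i a) \<epsilon> + (\<alpha>/8) *\<^sub>R ?Z i = 0" for i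
  proof -
    \<comment> \<open>The coefficients 3 and 6 of \<open>c3_trace_square\<close> are doubled by the
      factor 2 in \<open>tr_wedge\<close>.\<close>
    have tw: "c3 (tr_wedge Y i) \<epsilon> = 6 *\<^sub>R (\<Sum>s\<in>UNIV. \<Sum>t\<in>UNIV. c1 (\<lambda>j. Y i j s t) (c2 (\<lambda>k l. Y k l s t) \<epsilon>))
        + 12 *\<^sub>R c1 (\<lambda>a. \<Sum>j\<in>UNIV. \<Sum>s\<in>UNIV. \<Sum>t\<in>UNIV. Y i j s t * Y a j s t) \<epsilon>"
      if "\<And>i j s t. Y j i s t = - Y i j s t" for Y :: "'d \<Rightarrow> 'd \<Rightarrow> 'x::finite \<Rightarrow> 'x \<Rightarrow> real"
      unfolding tr_wedge_def[abs_def] c3_scale c3_trace_square[of Y, OF that] by (simp add: scaleR_add_right)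
    have "dH i = (\<lambda>j a b. \<alpha> / 4 * (tr_wedge Q i j a b - tr_wedge F i j a b))"
      by (intro ext anomaly)
    then have dH: "c3 (dH i) \<epsilon> = (\<alpha>/4) *\<^sub>R (c3 (tr_wedge Q i) \<epsilon> - c3 (tr_wedge F i) \<epsilon>)"
      by (simp only: c3_scale c3_diff)
    \<comment> \<open>The constants are 1/12 times \<open>\<alpha>/4\<close> times 6 for the spinor
      term and times 12 for the quadratic terms. The spinor term of \<open>F\<close> vanishes by the
      gaugino equation.\<close>
    have D: "(1/12) *\<^sub>R c3 (dH i) \<epsilon> = (\<alpha>/8) *\<^sub>R ?Z i + c1 (\<lambda>a. - (\<alpha> / 4 * ((\<Sum>j\<in>UNIV. \<Sum>s\<in>UNIV. \<Sum>t\<in>UNIV. F i j s t * F a j s t)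
                - (\<Sum>j\<in>UNIV. \<Sum>s\<in>UNIV. \<Sum>t\<in>UNIV. Q i j s t * Q a j s t)))) \<epsilon>"
    proof -
      have 1: "(\<lambda>a. - (\<alpha> / 4 * (X a - Y a))) = (\<lambda>a. \<alpha> / 4 * (Y a - X a))" for X Y :: "'d \<Rightarrow> real"
        by (intro ext) (simp only: right_diff_distrib minus_diff_eq)
      have 2: "(1/12) *\<^sub>R (\<alpha>/4) *\<^sub>R (6 *\<^sub>R Z + 12 *\<^sub>R X - (6 *\<^sub>R 0 + 12 *\<^sub>R Y))
          = (\<alpha>/8) *\<^sub>R Z + (\<alpha>/4) *\<^sub>R (X - Y)" for X Y Z :: 'v
        by (simp add: algebra_simps)
      show ?thesis
        unfolding dH tw[of Q, OF Q] tw[of F, OF F] F0 c1_zero sum.neutral_const 2 1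
        by (simp only: c1_scale c1_diff)
    qed
    have "?M i a + 1/2 * ?A i a = (2 * (h i a - 1/2 * (\<Sum>k\<in>UNIV. H i a k * \<phi> k)) - (\<Sum>j\<in>UNIV. Rp i j a j))
        + - (\<alpha> / 4 * ((\<Sum>j\<in>UNIV. \<Sum>s\<in>UNIV. \<Sum>t\<in>UNIV. F i j s t * F a j s t)
                - (\<Sum>j\<in>UNIV. \<Sum>s\<in>UNIV. \<Sum>t\<in>UNIV. Q i j s t * Q a j s t)))" for a
    proof -
      have "(\<Sum>k\<in>UNIV. H i a k * \<phi> k) = (\<Sum>k\<in>UNIV. \<phi> k * H k i a)"
        by (simp add: skew3D(4)[OF H, of i a] mult.commute)
      then show ?thesis using Rp_trace[of i a] by argo
    qed
    then have "c1 (\<lambda>a. ?M i a + 1/2 * ?A i a) \<epsilon> + (\<alpha>/8) *\<^sub>R ?Z i =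
      c1 (\<lambda>a. 2 * (h i a - 1/2 * (\<Sum>k\<in>UNIV. H i a k * \<phi> k)) - (\<Sum>j\<in>UNIV. Rp i j a j)) \<epsilon> + (1/12) *\<^sub>R c3 (dH i) \<epsilon>"
      by (simp only: c1_add D) (simp only: ac_simps)
    also have "\<dots> = 0"
      by (rule metric_equation_spinor_form[OF Rp_skew Rp0 Rp_cyclic dil])
    finally show ?thesis .
  qed
  have M_sym: "?M i a = ?M a i" for i a
  proof -
    have "R j i a j = R j a i j" for j
      using riemann_like_pair_symmetry[OF R, of a j j i] R unfolding riemann_like_def by (metis minus_minus)
    then show ?thesis by (simp add: hess[of i a] mult.commute)
  qed
  have A_skew: "?A a i = - ?A i a" for i a
    by (subst (1) skew3D(2)[OF n], subst (1) skew3D(2)[OF H]) (simp add: sum_negf)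
  show ?thesis
  proof
    assume ?I
    then have "c1 (\<lambda>a. ?M i a + 1/2 * ?A i a) \<epsilon> = 0" for i
      using key[of i] by (simp add: c1_zero)
    then have z: "?M i a + 1/2 * ?A i a = 0" for i a
      using c1_eq_0_imp[OF _ \<epsilon>] by blast
    \<comment> \<open>Comparing the entries \<open>(i, a)\<close> and \<open>(a, i)\<close>
      separates the symmetric part from the skew one.\<close>
    have split: "m = 0 \<and> s = 0" if "m + 1/2 * s = 0" "m' + 1/2 * s' = 0" "m = m'" "s' = - s"
      for m s m' s' :: real
      using that by simp
    show "(\<forall>i a. ?M i a = 0) \<and> (\<forall>i a. ?A i a = 0)"
      using split[OF z z M_sym A_skew] by blast
  next
    assume as: "(\<forall>i a. ?M i a = 0) \<and> (\<forall>i a. ?A i a = 0)"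
    have M0: "?M i a = 0" and A0: "?A i a = 0" for i a using as by blast+
    \<comment> \<open>The zero is written as a product so that \<open>c1_scale\<close> applies to
      it.\<close>
    have "(\<lambda>a. ?M i a + 1/2 * ?A i a) = (\<lambda>a. 0 * 0)" for i
      unfolding M0 A0 by simp
    then have "?Z i = 0" for i
      using key[of i] \<alpha> by (simp only: c1_scale) simp
    then show ?I
      using curvature_annihilates[of B Q \<epsilon>, OF B Q] by blast
  qed
qed

section \<open>Curvature of a connection in a chart\<close>

lemma family_of_bilinear_maps:
  fixes B :: "real^'d \<Rightarrow> 'a::euclidean_space \<Rightarrow> 'b::euclidean_space \<Rightarrow> 'c::real_normed_vector"
  assumes S: "open S" and lin1: "\<And>z b. z \<in> S \<Longrightarrow> linear (\<lambda>a. B z a b)"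
    and lin2: "\<And>z a. z \<in> S \<Longrightarrow> linear (B z a)"
    and sm: "\<And>a b. smooth_on S (\<lambda>z. B z a b)" and X: "smooth_on S X" and Y: "smooth_on S Y"
  shows smooth_on_family2: "smooth_on S (\<lambda>z. B z (X z) (Y z))"
    and pd_family2: "y \<in> S \<Longrightarrow> pd u (\<lambda>z. B z (X z) (Y z)) y =
      pd u (\<lambda>z. B z (X y) (Y y)) y + B y (pd u X y) (Y y) + B y (X y) (pd u Y y)"
proof -
  have sm1: "smooth_on S (\<lambda>z. B z (X z) b)" for b
    by (rule smooth_on_family[where L = "\<lambda>z a. B z a b", OF S lin1 sm X])
  show "smooth_on S (\<lambda>z. B z (X z) (Y z))"
    by (rule smooth_on_family[where L = "\<lambda>z. B z (X z)", OF S lin2 sm1 Y])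
  assume y: "y \<in> S"
  show "pd u (\<lambda>z. B z (X z) (Y z)) y =
      pd u (\<lambda>z. B z (X y) (Y y)) y + B y (pd u X y) (Y y) + B y (X y) (pd u Y y)"
    using pd_family[where L = "\<lambda>z. B z (X z)", OF S lin2 sm1 Y y]
      pd_family[where L = "\<lambda>z a. B z a (Y y)", OF S lin1 sm X y] by simp
qed

lemma family_of_trilinear_maps:
  fixes B :: "real^'d \<Rightarrow> 'a::euclidean_space \<Rightarrow> 'b::euclidean_space \<Rightarrow> 'e::euclidean_space \<Rightarrow>
    'c::real_normed_vector"
  assumes S: "open S" and lin1: "\<And>z b c. z \<in> S \<Longrightarrow> linear (\<lambda>a. B z a b c)"
    and lin2: "\<And>z a c. z \<in> S \<Longrightarrow> linear (\<lambda>b. B z a b c)"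
    and lin3: "\<And>z a b. z \<in> S \<Longrightarrow> linear (B z a b)"
    and sm: "\<And>a b c. smooth_on S (\<lambda>z. B z a b c)"
    and X: "smooth_on S X" and Y: "smooth_on S Y" and Z: "smooth_on S Z"
  shows smooth_on_family3: "smooth_on S (\<lambda>z. B z (X z) (Y z) (Z z))"
    and pd_family3: "y \<in> S \<Longrightarrow> pd u (\<lambda>z. B z (X z) (Y z) (Z z)) y =
      pd u (\<lambda>z. B z (X y) (Y y) (Z y)) y + B y (pd u X y) (Y y) (Z y)
      + B y (X y) (pd u Y y) (Z y) + B y (X y) (Y y) (pd u Z y)"
proof -
  have f2: "smooth_on S (\<lambda>z. B z (X z) (Y z) c)" for c
    by (rule smooth_on_family2[where B = "\<lambda>z a b. B z a b c", OF S lin1 lin2 sm X Y])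
  show "smooth_on S (\<lambda>z. B z (X z) (Y z) (Z z))"
    by (rule smooth_on_family[where L = "\<lambda>z. B z (X z) (Y z)", OF S lin3 f2 Z])
  assume y: "y \<in> S"
  show "pd u (\<lambda>z. B z (X z) (Y z) (Z z)) y =
      pd u (\<lambda>z. B z (X y) (Y y) (Z y)) y + B y (pd u X y) (Y y) (Z y)
      + B y (X y) (pd u Y y) (Z y) + B y (X y) (Y y) (pd u Z y)"
  proof -
    have "pd u (\<lambda>z. B z (X z) (Y z) (Z y)) y = pd u (\<lambda>z. B z (X y) (Y y) (Z y)) y
        + B y (pd u X y) (Y y) (Z y) + B y (X y) (pd u Y y) (Z y)"
      by (rule pd_family2[where B = "\<lambda>z a b. B z a b (Z y)", OF S lin1 lin2 sm X Y y])
    then show ?thesis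
      using pd_family[where L = "\<lambda>z. B z (X z) (Y z)", OF S lin3 f2 Z y] by simp
  qed
qed

lemma linear_pd_parameter:
  assumes S: "open S" and lin: "\<And>z. z \<in> S \<Longrightarrow> linear (L z)" and sm: "\<And>b. smooth_on S (\<lambda>z. L z b)"
    and y: "y \<in> S"
  shows "linear (\<lambda>b. pd u (\<lambda>z. L z b) y)"
proof (rule linearI)
  show "pd u (\<lambda>z. L z (a + b)) y = pd u (\<lambda>z. L z a) y + pd u (\<lambda>z. L z b) y" for a b
    by (subst pd_add[OF sm sm y, symmetric]) (rule pd_cong[OF S _ y], simp add: linear_add[OF lin])
  show "pd u (\<lambda>z. L z (r *\<^sub>R a)) y = r *\<^sub>R pd u (\<lambda>z. L z a) y" for r a
    by (subst pd_linear[OF bounded_linear_scaleR_right sm y, symmetric])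
      (rule pd_cong[OF S _ y], simp add: linear_scale[OF lin])
qed

lemma smooth_on_axis_imp:
  fixes L :: "real^'d \<Rightarrow> real^'n \<Rightarrow> 'b::real_normed_vector"
  assumes S: "open S" and lin: "\<And>z. z \<in> S \<Longrightarrow> linear (L z)"
    and sm: "\<And>m. smooth_on S (\<lambda>z. L z (axis m 1))"
  shows "smooth_on S (\<lambda>z. L z u)"
proof (rule smooth_on_family[OF S lin _ smooth_on_const])
  fix b :: "real^'n" assume "b \<in> Basis"
  then obtain m where "b = axis m 1" by (auto simp: Basis_vec_def)
  then show "smooth_on S (\<lambda>z. L z b)" using sm by simp
qed

text \<open>The tensorial form of \<open>curv\<close>: the local curvature form evaluated on
  constant vectors and on a single fibre vector, with no fields left to differentiate.\<close>

definition curv_op :: "('d::finite,'r::finite) conn \<Rightarrow> real^'d \<Rightarrow> real^'d \<Rightarrow> real^'d \<Rightarrow> real^'r \<Rightarrow> real^'r" where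
  "curv_op A y u v s = pd u (\<lambda>z. A z v *v s) y - pd v (\<lambda>z. A z u *v s) y
    + A y u *v (A y v *v s) - A y v *v (A y u *v s)"

text \<open>Instantiated for the gauge connection, for the given connection on the tangent bundle
  and for the Levi-Civita connection.\<close>

locale chart_connection =
  fixes U :: "(real^'d::finite) set" and A :: "('d,'r::finite) conn"
  assumes open_U: "open U" and linear_conn: "\<And>y. y \<in> U \<Longrightarrow> linear (A y)"
    and smooth_conn: "\<And>u s. smooth_on U (\<lambda>z. A z u *v s)"
begin

lemma linear_conn_vector: "y \<in> U \<Longrightarrow> linear (\<lambda>u. A y u *v s)"
  by (rule linearI) (simp_all add: linear_add[OF linear_conn] linear_scale[OF linear_conn]
      matrix_vector_mult_add_rdistrib scaleR_matrix_vector_assoc)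

lemma
  assumes X: "smooth_on U X" and s: "smooth_on U s"
  shows smooth_on_conn_apply: "smooth_on U (\<lambda>z. A z (X z) *v s z)"
    and pd_conn_apply: "y \<in> U \<Longrightarrow> pd u (\<lambda>z. A z (X z) *v s z) y =
      pd u (\<lambda>z. A z (X y) *v s y) y + A y (pd u X y) *v s y + A y (X y) *v pd u s y"
  by (rule smooth_on_family2[where B = "\<lambda>z u s. A z u *v s", OF open_U linear_conn_vector
        matrix_vector_mul_linear smooth_conn X s]
      pd_family2[where B = "\<lambda>z u s. A z u *v s", OF open_U linear_conn_vector
        matrix_vector_mul_linear smooth_conn X s]; assumption)+

lemma smooth_on_pd_field:
  assumes "smooth_on U s" "smooth_on U X"
  shows "smooth_on U (\<lambda>z. pd (X z) s z)"
  using smooth_on_family[where L = "\<lambda>z u. pd u s z", OF open_U linear_pd[OF assms(1)]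
      smooth_on_pd[OF open_U assms(1)] assms(2)] .

lemma pd_pd_field:
  assumes "smooth_on U s" "smooth_on U X" "y \<in> U"
  shows "pd u (\<lambda>z. pd (X z) s z) y = pd u (pd (X y) s) y + pd (pd u X y) s y"
  using pd_family[where L = "\<lambda>z u. pd u s z", OF open_U linear_pd[OF assms(1)]
      smooth_on_pd[OF open_U assms(1)] assms(2,3)] .

lemma smooth_on_covd:
  assumes "smooth_on U s" "smooth_on U X"
  shows "smooth_on U (covd A X s)"
  unfolding covd_def
  by (intro smooth_on_add open_U smooth_on_pd_field smooth_on_conn_apply assms)

lemma covd_covd:
  assumes X: "smooth_on U X" and Y: "smooth_on U Y" and s: "smooth_on U s" and y: "y \<in> U"
  shows "covd A X (covd A Y s) y = pd (X y) (pd (Y y) s) y + pd (pd (X y) Y y) s y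
    + pd (X y) (\<lambda>z. A z (Y y) *v s y) y + A y (pd (X y) Y y) *v s y
    + A y (Y y) *v pd (X y) s y + A y (X y) *v pd (Y y) s y + A y (X y) *v (A y (Y y) *v s y)"
proof -
  have "pd (X y) (covd A Y s) y = pd (X y) (\<lambda>z. pd (Y z) s z) y + pd (X y) (\<lambda>z. A z (Y z) *v s z) y"
    unfolding covd_def by (rule pd_add[OF smooth_on_pd_field[OF s Y] smooth_on_conn_apply[OF Y s] y])
  then show ?thesis
    unfolding covd_def[of A X] pd_pd_field[OF s Y y] pd_conn_apply[OF Y s y]
    by (simp add: covd_def matrix_vector_right_distrib)
qed

text \<open>Second derivatives of \<open>s\<close> cancel by symmetry, and derivatives of the vector
  fields cancel against the bracket term.\<close>

lemma curv_eq_curv_op: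
  assumes X: "smooth_on U X" and Y: "smooth_on U Y" and s: "smooth_on U s" and y: "y \<in> U"
  shows "curv A X Y s y = curv_op A y (X y) (Y y) (s y)"
  unfolding curv_def covd_covd[OF X Y s y] covd_covd[OF Y X s y] curv_op_def
  by (simp add: covd_def lie_def linear_diff[OF linear_pd[OF s y]]
      linear_diff[OF linear_conn_vector[OF y]] pd_commute[OF open_U s y, of "X y" "Y y"])

lemma curv_op_skew: "curv_op A y v u s = - curv_op A y u v s"
  by (simp add: curv_op_def)

lemma linear_pd_conn:
  assumes y: "y \<in> U"
  shows linear_pd_conn_form: "linear (\<lambda>v. pd u (\<lambda>z. A z v *v s) y)"
    and linear_pd_conn_vector: "linear (\<lambda>s. pd u (\<lambda>z. A z v *v s) y)"
    and linear_pd_conn_direction: "linear (\<lambda>u. pd u (\<lambda>z. A z v *v s) y)"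
  using linear_pd_parameter[OF open_U linear_conn_vector smooth_conn y]
    linear_pd_parameter[OF open_U matrix_vector_mul_linear smooth_conn y]
    linear_pd[OF smooth_conn y] by auto

lemma linear_curv_op:
  assumes y: "y \<in> U"
  shows linear_curv_op1: "linear (\<lambda>u. curv_op A y u v s)"
    and linear_curv_op2: "linear (\<lambda>v. curv_op A y u v s)"
    and linear_curv_op3: "linear (curv_op A y u v)"
proof -
  note lin = linear_pd_conn[OF y] linear_conn_vector[OF y]
  have 1: "linear (\<lambda>u. curv_op A y u v s)" for v s
    by (rule linearI) (simp_all add: curv_op_def lin[THEN linear_add] lin[THEN linear_scale]
        matrix_vector_right_distrib matrix_vector_mult_scaleR algebra_simps)
  show "linear (\<lambda>u. curv_op A y u v s)" by (rule 1)
  show "linear (\<lambda>v. curv_op A y u v s)"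
    using linear_compose_neg[OF 1, of u s] unfolding curv_op_skew[of y u] by simp
  show "linear (curv_op A y u v)"
    by (rule linearI; simp only: curv_op_def lin(2)[THEN linear_add] lin(2)[THEN linear_scale])
      (simp_all add: matrix_vector_right_distrib matrix_vector_mult_scaleR algebra_simps)
qed

lemma smooth_on_conn_conn: "smooth_on U (\<lambda>z. A z u *v (A z v *v s))"
  by (rule smooth_on_conn_apply[OF smooth_on_const smooth_conn])

lemma smooth_on_curv_op: "smooth_on U (\<lambda>z. curv_op A z u v s)"
  unfolding curv_op_def
  by (intro smooth_on_diff smooth_on_add open_U smooth_on_pd smooth_conn smooth_on_conn_conn)

text \<open>Covariant in the fibre only. For constant vectors in the form slots this suffices for
  the Bianchi identity; a torsion-free correction would cancel there.\<close>

definition "cov_curv y u v w s =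
  pd u (\<lambda>z. curv_op A z v w s) y + A y u *v curv_op A y v w s - curv_op A y v w (A y u *v s)"

text \<open>Expanded on constant vectors, the second derivatives of the connection form cancel in
  pairs and the remaining terms cancel as in the Jacobi identity.\<close>

lemma differential_bianchi:
  assumes y: "y \<in> U"
  shows "cov_curv y u v w s + cov_curv y v w u s + cov_curv y w u v s = 0"
proof -
  have D: "pd u (\<lambda>z. curv_op A z v w s) y = pd u (pd v (\<lambda>z. A z w *v s)) y - pd u (pd w (\<lambda>z. A z v *v s)) y
     + (pd u (\<lambda>z. A z v *v (A y w *v s)) y + A y v *v pd u (\<lambda>z. A z w *v s) y)
     - (pd u (\<lambda>z. A z w *v (A y v *v s)) y + A y w *v pd u (\<lambda>z. A z v *v s) y)" for u v w
  proof -
    have AA: "pd u (\<lambda>z. A z v *v (A z w *v s)) y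
        = pd u (\<lambda>z. A z v *v (A y w *v s)) y + A y v *v pd u (\<lambda>z. A z w *v s) y" for v w
      using pd_conn_apply[OF smooth_on_const[of U v] smooth_conn[of w s] y, of u]
      by (simp add: linear_0[OF linear_conn_vector[OF y]])
    show ?thesis
      unfolding curv_op_def AA[symmetric]
      by (simp add: pd_diff[OF _ _ y] pd_add[OF _ _ y] smooth_on_diff smooth_on_add open_U
          smooth_on_pd smooth_conn smooth_on_conn_conn)
  qed
  show ?thesis
    unfolding cov_curv_def D
    unfolding curv_op_def
      pd_commute[OF open_U smooth_conn y, where u = u and v = v]
      pd_commute[OF open_U smooth_conn y, where u = w and v = u]
      pd_commute[OF open_U smooth_conn y, where u = v and v = w]
    by (simp add: matrix_vector_right_distrib matrix_vector_mult_diff_distrib algebra_simps)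
qed

end

section \<open>The Levi-Civita connection and an orthonormal frame\<close>

locale framed_chart =
  fixes U :: "(real^'d::finite) set" and g :: "'d metric" and e :: "'d frame"
  assumes open_chart: "open U"
    and bilinear_g: "\<And>y. y \<in> U \<Longrightarrow> bilinear (g y)"
    and sym_g: "\<And>y u v. y \<in> U \<Longrightarrow> g y u v = g y v u"
    and pos_g: "\<And>y u. y \<in> U \<Longrightarrow> u \<noteq> 0 \<Longrightarrow> g y u u > 0"
    and smooth_g_axis: "\<And>m n. smooth_on U (\<lambda>y. g y (axis m 1) (axis n 1))"
    and smooth_e: "\<And>a. smooth_on U (e a)"
    and orthonormal: "\<And>y a b. y \<in> U \<Longrightarrow> g y (e a y) (e b y) = (if a = b then 1 else 0)"
begin

lemma linear_g:
  assumes "y \<in> U"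
  shows linear_g1: "linear (\<lambda>u. g y u v)" and linear_g2: "linear (g y u)"
  using bilinear_g[OF assms] unfolding bilinear_def by auto

lemma smooth_g: "smooth_on U (\<lambda>y. g y u v)"
proof -
  have A: "smooth_on U (\<lambda>y. g y (axis m 1) v)" for m
    by (rule smooth_on_axis_imp[OF open_chart linear_g2 smooth_g_axis])
  show ?thesis
    by (rule smooth_on_axis_imp[where L = "\<lambda>y u. g y u v", OF open_chart linear_g1 A])
qed

text \<open>Orthonormality makes the map \<open>\<Psi>\<close> from coefficients to vectors
  injective; the frame has as many members as there are coordinates, so it is also
  surjective.\<close>

lemma frame_expansion:
  assumes y: "y \<in> U"
  shows "u = (\<Sum>a\<in>UNIV. g y u (e a y) *\<^sub>R e a y)"
proof -
  define \<Psi> where "\<Psi> c = (\<Sum>a\<in>UNIV. (c $ a) *\<^sub>R e a y)" for c :: "real^'d"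
  have lin: "linear \<Psi>"
    by (rule linearI) (simp_all add: \<Psi>_def scaleR_add_left sum.distrib scaleR_sum_right)
  have coord: "g y (\<Psi> c) (e b y) = c $ b" for c b
    by (simp add: \<Psi>_def linear_sum[OF linear_g1[OF y]] linear_scale[OF linear_g1[OF y]]
        orthonormal[OF y] if_distrib[of "\<lambda>x. _ * x"] cong: if_cong)
  have "inj \<Psi>"
    by (rule injI) (metis coord vec_eq_iff)
  then have "surj \<Psi>" using linear_injective_imp_surjective[OF lin] by simp
  then obtain c where "u = \<Psi> c" by blast
  then show ?thesis using coord[of c] by (simp add: \<Psi>_def)
qed

lemma frame_eqI:
  assumes "y \<in> U" "\<And>a. g y u (e a y) = g y v (e a y)"
  shows "u = v"
  using frame_expansion[OF assms(1), of u] frame_expansion[OF assms(1), of v] assms(2) by simp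

lemma g_frame: "y \<in> U \<Longrightarrow> g y u v = (\<Sum>a\<in>UNIV. g y u (e a y) * g y v (e a y))"
  by (subst (1) frame_expansion[of y v], assumption)
    (simp add: linear_sum[OF linear_g2] linear_scale[OF linear_g2] mult.commute)

lemma linear_frame:
  fixes L :: "real^'d \<Rightarrow> 'b::real_vector"
  assumes "y \<in> U" "linear L"
  shows "L u = (\<Sum>a\<in>UNIV. g y u (e a y) *\<^sub>R L (e a y))"
  by (subst (1) frame_expansion[OF assms(1), of u])
    (simp add: linear_sum[OF assms(2)] linear_scale[OF assms(2)])

section \<open>The Levi-Civita connection from the metric\<close>

abbreviation "dg y u v w \<equiv> pd u (\<lambda>z. g z v w) y"

lemma linear_dg:
  assumes y: "y \<in> U"
  shows linear_dg1: "linear (\<lambda>u. dg y u v w)" and linear_dg2: "linear (\<lambda>v. dg y u v w)"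
    and linear_dg3: "linear (\<lambda>w. dg y u v w)"
  using linear_pd[OF smooth_g y] linear_pd_parameter[OF open_chart linear_g1 smooth_g y]
    linear_pd_parameter[OF open_chart linear_g2 smooth_g y] by auto

lemma dg_sym: "y \<in> U \<Longrightarrow> dg y u v w = dg y u w v"
  by (rule pd_cong[OF open_chart sym_g])

abbreviation "lc y u v \<equiv> levi_civita g y u *v v"

lemma g_axis_gram: "y \<in> U \<Longrightarrow> g y u (axis l 1) = (gram g y *v u) $ l"
  by (subst vec_axis_expand[of u])
    (simp add: linear_sum[OF linear_g1] linear_scale[OF linear_g1] gram_def matrix_vector_mult_def
      sym_g[of y "axis l 1"] mult.commute)

lemma invertible_gram:
  assumes y: "y \<in> U"
  shows "invertible (gram g y)"
proof -
  have "x = 0" if "gram g y *v x = 0" for x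
  proof (rule ccontr)
    assume "x \<noteq> 0"
    have "g y x x = (\<Sum>l\<in>UNIV. x $ l * g y x (axis l 1))"
      by (subst (2) vec_axis_expand[of x])
        (simp add: linear_sum[OF linear_g2[OF y]] linear_scale[OF linear_g2[OF y]])
    also have "\<dots> = 0" by (simp add: g_axis_gram[OF y] that)
    finally show False using pos_g[OF y \<open>x \<noteq> 0\<close>] by simp
  qed
  then show ?thesis
    using matrix_left_invertible_ker[of "gram g y"] by (auto simp: invertible_left_inverse)
qed

text \<open>The Koszul formula on constant vectors, from which torsion-freeness, metric
  compatibility and smoothness follow without the inverse Gram matrix.\<close>

lemma koszul:
  assumes y: "y \<in> U"
  shows "g y (lc y u v) w = (dg y u w v + dg y v w u - dg y w u v) / 2"
proof -
  let ?K = "\<lambda>w. (dg y u w v + dg y v w u - dg y w u v) / 2"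
  \<comment> \<open>The Christoffel symbols with lowered index, contracted with \<open>u\<close> and
    \<open>v\<close>.\<close>
  define k where "k = (\<chi> l. ?K (axis l 1))"
  have exp: "?K (axis l 1) = (\<Sum>m\<in>UNIV. \<Sum>n\<in>UNIV. u $ m * v $ n * (dgram g y m l n + dgram g y n l m - dgram g y l m n) / 2)"
    for l
  proof -
    have L: "L u v = (\<Sum>m\<in>UNIV. \<Sum>n\<in>UNIV. u $ m * v $ n * L (axis m 1) (axis n 1))"
      if "\<And>v. linear (\<lambda>u. L u v)" "\<And>u. linear (L u)" for L :: "real^'d \<Rightarrow> real^'d \<Rightarrow> real"
    proof -
      have "L u v = (\<Sum>m\<in>UNIV. u $ m * L (axis m 1) v)"
        by (subst vec_axis_expand[of u]) (simp add: linear_sum[OF that(1)] linear_scale[OF that(1)])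
      also have "\<dots> = (\<Sum>m\<in>UNIV. \<Sum>n\<in>UNIV. u $ m * v $ n * L (axis m 1) (axis n 1))"
        by (subst vec_axis_expand[of v])
          (simp add: linear_sum[OF that(2)] linear_scale[OF that(2)] sum_distrib_left mult.assoc)
      finally show ?thesis .
    qed
    show ?thesis
      unfolding L[of "\<lambda>u v. dg y u (axis l 1) v", OF linear_dg1[OF y] linear_dg3[OF y]]
        L[of "\<lambda>u v. dg y v (axis l 1) u", OF linear_dg3[OF y] linear_dg1[OF y]]
        L[of "\<lambda>u v. dg y (axis l 1) u v", OF linear_dg2[OF y] linear_dg3[OF y]]
        dgram_def sum.distrib[symmetric] sum_subtractf[symmetric] sum_divide_distrib
      by (simp add: algebra_simps)
  qed
  have "lc y u v = matrix_inv (gram g y) *v k"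
  proof (rule vec_eq_iff[THEN iffD2, rule_format])
    fix i
    have "lc y u v $ i = (\<Sum>n\<in>UNIV. \<Sum>m\<in>UNIV. \<Sum>l\<in>UNIV. matrix_inv (gram g y) $ i $ l *
        (u $ m * v $ n * (dgram g y m l n + dgram g y n l m - dgram g y l m n) / 2))"
      unfolding levi_civita_def matrix_vector_mult_def vec_lambda_beta sum_distrib_right
      by (simp add: ac_simps)
    also have "\<dots> = (\<Sum>l\<in>UNIV. \<Sum>m\<in>UNIV. \<Sum>n\<in>UNIV. matrix_inv (gram g y) $ i $ l *
        (u $ m * v $ n * (dgram g y m l n + dgram g y n l m - dgram g y l m n) / 2))"
      by (subst sum_rotate, subst sum_rotate, subst (2) sum.swap) (rule refl)
    also have "\<dots> = (matrix_inv (gram g y) *v k) $ i"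
      unfolding matrix_vector_mult_def k_def exp by (simp add: sum_distrib_left)
    finally show "lc y u v $ i = (matrix_inv (gram g y) *v k) $ i" .
  qed
  moreover have inv: "gram g y ** matrix_inv (gram g y) = mat 1"
    using someI_ex[OF invertible_gram[OF y, unfolded invertible_def]] by (simp add: matrix_inv_def)
  ultimately have "gram g y *v lc y u v = k"
    by (simp add: matrix_vector_mul_assoc inv)
  then have axis: "g y (lc y u v) (axis l 1) = ?K (axis l 1)" for l
    by (simp add: g_axis_gram[OF y] k_def)
  have lin: "linear ?K"
    by (rule linearI) (simp_all add: linear_dg[OF y, THEN linear_add] linear_dg[OF y, THEN linear_scale]
        algebra_simps add_divide_distrib diff_divide_distrib)
  have exp: "L w = (\<Sum>l\<in>UNIV. w $ l * L (axis l 1))" if "linear L" for L :: "real^'d \<Rightarrow> real"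
    by (subst vec_axis_expand[of w]) (simp add: linear_sum[OF that] linear_scale[OF that])
  show ?thesis
    unfolding exp[OF lin] exp[OF linear_g2[OF y]] axis ..
qed

lemma lc_sym: "y \<in> U \<Longrightarrow> lc y u v = lc y v u"
  by (rule frame_eqI) (auto simp: koszul intro: dg_sym)

text \<open>Metric compatibility: in the sum of two Koszul formulas with \<open>v\<close> and
  \<open>w\<close> exchanged, everything but the derivative along \<open>u\<close> cancels.\<close>

lemma dg_lc:
  assumes y: "y \<in> U"
  shows "dg y u v w = g y (lc y u v) w + g y v (lc y u w)"
  using koszul[OF y, of u v w] koszul[OF y, of u w v] sym_g[OF y, of v "lc y u w"]
    dg_sym[OF y, of w v u] dg_sym[OF y, of w u v] dg_sym[OF y, of u v w] by argo

lemma smooth_dg: "smooth_on U (\<lambda>z. dg z u v w)"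
  by (rule smooth_on_pd[OF open_chart smooth_g])

text \<open>Expansion in the smooth frame avoids differentiating a matrix inverse.\<close>

lemma smooth_lc: "smooth_on U (\<lambda>z. lc z u v)"
proof (rule smooth_on_cong[OF open_chart])
  show "smooth_on U (\<lambda>z. \<Sum>a\<in>UNIV. ((1/2) *\<^sub>R (dg z u (e a z) v + dg z v (e a z) u - dg z (e a z) u v)) *\<^sub>R e a z)"
    by (intro smooth_on_sum smooth_on_scaleR smooth_on_add smooth_on_diff smooth_on_const open_chart smooth_e
      smooth_on_family[where L = "\<lambda>z w. dg z u w v" for u v, OF open_chart linear_dg2 smooth_dg smooth_e]
      smooth_on_family[where L = "\<lambda>z w. dg z w u v" for u v, OF open_chart linear_dg1 smooth_dg smooth_e])
  show "(\<Sum>a\<in>UNIV. ((1/2) *\<^sub>R (dg z u (e a z) v + dg z v (e a z) u - dg z (e a z) u v)) *\<^sub>R e a z) = lc z u v"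
    if "z \<in> U" for z
    by (subst frame_expansion[OF that, of "lc z u v"]) (simp add: koszul[OF that])
qed

lemma linear_levi_civita: "linear (levi_civita g y)"
proof (rule linearI)
  show "levi_civita g y (u + v) = levi_civita g y u + levi_civita g y v" for u v
    by (simp only: levi_civita_def vec_eq_iff vec_lambda_beta vector_add_component distrib_right
        add_divide_distrib sum.distrib) simp
  show "levi_civita g y (r *\<^sub>R u) = r *\<^sub>R levi_civita g y u" for r u
    by (simp add: levi_civita_def vec_eq_iff sum_distrib_left mult.assoc)
qed

sublocale lc: chart_connection U "levi_civita g"
  by (rule chart_connection.intro) (rule open_chart linear_levi_civita smooth_lc)+

lemma lc_bianchi:
  assumes y: "y \<in> U"
  shows "curv_op (levi_civita g) y u v w + curv_op (levi_civita g) y v w u + curv_op (levi_civita g) y w u v = 0"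
proof -
  have s: "pd a (\<lambda>z. lc z b c) y = pd a (\<lambda>z. lc z c b) y" for a b c
    by (rule pd_cong[OF open_chart lc_sym y])
  show ?thesis
    unfolding curv_op_def s[of u v w] s[of v w u] s[of w u v]
      lc_sym[OF y, of v w] lc_sym[OF y, of w u] lc_sym[OF y, of u v] by simp
qed

text \<open>The direction is a fixed vector rather than a field, so that two such derivatives
  commute up to curvature alone (\<open>nab_nab\<close>).\<close>

definition nab :: "real^'d \<Rightarrow> 'd vfield \<Rightarrow> 'd vfield" where
  "nab u X y = pd u X y + lc y u (X y)"

lemma covd_lc: "covd (levi_civita g) X Y y = nab (X y) Y y"
  by (simp add: covd_def nab_def)

lemma smooth_g_fields: "smooth_on U X \<Longrightarrow> smooth_on U Y \<Longrightarrow> smooth_on U (\<lambda>z. g z (X z) (Y z))"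
  by (rule smooth_on_family2[OF open_chart linear_g1 linear_g2 smooth_g])

lemma pd_g_fields:
  assumes "smooth_on U X" "smooth_on U Y" "y \<in> U"
  shows "pd u (\<lambda>z. g z (X z) (Y z)) y = g y (nab u X y) (Y y) + g y (X y) (nab u Y y)"
proof -
  have "pd u (\<lambda>z. g z (X z) (Y z)) y =
      dg y u (X y) (Y y) + g y (pd u X y) (Y y) + g y (X y) (pd u Y y)"
    by (rule pd_family2[OF open_chart linear_g1 linear_g2 smooth_g assms])
  then show ?thesis
    by (simp add: nab_def dg_lc[OF assms(3)] linear_add[OF linear_g1[OF assms(3)]]
        linear_add[OF linear_g2[OF assms(3)]])
qed

lemma smooth_nab: "smooth_on U X \<Longrightarrow> smooth_on U (nab u X)"
  using lc.smooth_on_covd[OF _ smooth_on_const, of X u] by (simp add: covd_lc[abs_def] eta_contract_eq)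

lemma nab_nab:
  assumes "smooth_on U X" "y \<in> U"
  shows "nab u (nab v X) y - nab v (nab u X) y = curv_op (levi_civita g) y u v (X y)"
proof -
  have "covd (levi_civita g) (\<lambda>_. u) X = nab u X" for u X
    by (rule ext) (rule covd_lc)
  moreover have "lie (\<lambda>_. u) (\<lambda>_. v) y = 0" by (simp add: lie_def)
  ultimately show ?thesis
    using lc.curv_eq_curv_op[OF smooth_on_const smooth_on_const assms, of u v]
    by (simp add: curv_def covd_lc nab_def linear_0[OF linear_pd[OF assms]] linear_0[OF linear_levi_civita])
qed

text \<open>Second derivatives of \<open>g x w\<close>, with \<open>x\<close> and \<open>w\<close>
  constant, commute; by compatibility the mixed products are symmetric in \<open>u\<close> and
  \<open>v\<close> and drop out of the difference.\<close>

lemma curv_op_lc_skew: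
  assumes y: "y \<in> U"
  shows "g y (curv_op (levi_civita g) y u v x) w = - g y (curv_op (levi_civita g) y u v w) x"
proof -
  note c = smooth_on_const[of U]
  have "pd u (pd v (\<lambda>z. g z x w)) y = g y (nab u (nab v (\<lambda>_. x)) y) w + g y (nab v (\<lambda>_. x) y) (nab u (\<lambda>_. w) y)
      + g y (nab u (\<lambda>_. x) y) (nab v (\<lambda>_. w) y) + g y x (nab u (nab v (\<lambda>_. w)) y)" for u v
  proof -
    have "pd u (pd v (\<lambda>z. g z x w)) y =
        pd u (\<lambda>z. g z (nab v (\<lambda>_. x) z) w + g z x (nab v (\<lambda>_. w) z)) y"
      by (rule pd_cong[OF open_chart _ y]) (rule pd_g_fields[OF c c])
    also have "\<dots> = pd u (\<lambda>z. g z (nab v (\<lambda>_. x) z) w) y + pd u (\<lambda>z. g z x (nab v (\<lambda>_. w) z)) y"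
      by (rule pd_add[OF smooth_g_fields[OF smooth_nab[OF c] c] smooth_g_fields[OF c smooth_nab[OF c]] y])
    finally show ?thesis
      by (simp add: pd_g_fields[OF smooth_nab[OF c] c y] pd_g_fields[OF c smooth_nab[OF c] y])
  qed
  from this[of u v] this[of v u] have
    "g y (nab u (nab v (\<lambda>_. x)) y - nab v (nab u (\<lambda>_. x)) y) w
      + g y x (nab u (nab v (\<lambda>_. w)) y - nab v (nab u (\<lambda>_. w)) y) = 0"
    using pd_commute[OF open_chart smooth_g[of x w] y, where u = u and v = v]
    by (simp add: linear_diff[OF linear_g1[OF y]] linear_diff[OF linear_g2[OF y]])
  then show ?thesis
    by (simp add: nab_nab[OF c y] sym_g[OF y, of x])
qed

definition "riem y i j k l = g y (curv_op (levi_civita g) y (e i y) (e j y) (e k y)) (e l y)"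

lemma riemann_like_riem:
  assumes y: "y \<in> U"
  shows "riemann_like (riem y)"
  unfolding riemann_like_def riem_def
proof (intro conjI allI)
  fix i j k l
  let ?R = "curv_op (levi_civita g) y"
  show "g y (?R (e j y) (e i y) (e k y)) (e l y) = - g y (?R (e i y) (e j y) (e k y)) (e l y)"
    by (subst lc.curv_op_skew) (rule linear_neg[OF linear_g1[OF y]])
  show "g y (?R (e i y) (e j y) (e l y)) (e k y) = - g y (?R (e i y) (e j y) (e k y)) (e l y)"
    by (rule curv_op_lc_skew[OF y])
  show "g y (?R (e i y) (e j y) (e k y)) (e l y) + g y (?R (e j y) (e k y) (e i y)) (e l y)
      + g y (?R (e k y) (e i y) (e j y)) (e l y) = 0"
    unfolding linear_add[OF linear_g1[OF y], symmetric] lc_bianchi[OF y] by (rule linear_0[OF linear_g1[OF y]])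
qed

lemma ricci_eq: "y \<in> U \<Longrightarrow> ricci g e y i j = (\<Sum>a\<in>UNIV. riem y a i j a)"
  by (simp add: ricci_def curvT_def riem_def lc.curv_eq_curv_op[OF smooth_e smooth_e smooth_e])

end

section \<open>Torsion\<close>

locale torsion_chart = framed_chart U g e
  for U :: "(real^'d::finite) set" and g :: "'d metric" and e :: "'d frame" +
  fixes H :: "'d tensor3"
  assumes linear_H1: "\<And>y v w. y \<in> U \<Longrightarrow> linear (\<lambda>u. H y u v w)"
    and H_swap12: "\<And>y u v w. y \<in> U \<Longrightarrow> H y v u w = - H y u v w"
    and H_swap23: "\<And>y u v w. y \<in> U \<Longrightarrow> H y u w v = - H y u v w"
    and smooth_H_axis: "\<And>m n p. smooth_on U (\<lambda>y. H y (axis m 1) (axis n 1) (axis p 1))"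
begin

lemma linear_H:
  assumes y: "y \<in> U"
  shows linear_H2: "linear (\<lambda>v. H y u v w)" and linear_H3: "linear (H y u v)"
proof -
  have 2: "linear (\<lambda>v. H y u v w)" for u w
    unfolding H_swap12[OF y, of u] by (rule linear_compose_neg[OF linear_H1[OF y]])
  then show "linear (\<lambda>v. H y u v w)" .
  have "linear (\<lambda>w. H y u v w)"
    unfolding H_swap23[OF y, of u v] by (rule linear_compose_neg[OF 2])
  then show "linear (H y u v)" .
qed

lemma smooth_H: "smooth_on U (\<lambda>z. H z u v w)"
proof -
  have 1: "smooth_on U (\<lambda>z. H z (axis m 1) (axis n 1) w)" for m n
    by (rule smooth_on_axis_imp[OF open_chart linear_H3 smooth_H_axis])
  have 2: "smooth_on U (\<lambda>z. H z (axis m 1) v w)" for m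
    by (rule smooth_on_axis_imp[where L = "\<lambda>z v. H z (axis m 1) v w", OF open_chart linear_H2 1])
  show ?thesis
    by (rule smooth_on_axis_imp[where L = "\<lambda>z u. H z u v w", OF open_chart linear_H1 2])
qed

lemma smooth_H_fields:
  "smooth_on U X \<Longrightarrow> smooth_on U Y \<Longrightarrow> smooth_on U Z \<Longrightarrow> smooth_on U (\<lambda>z. H z (X z) (Y z) (Z z))"
  by (rule smooth_on_family3[OF open_chart linear_H1 linear_H2 linear_H3 smooth_H])

definition "nabH y u v w x =
  pd u (\<lambda>z. H z v w x) y - H y (lc y u v) w x - H y v (lc y u w) x - H y v w (lc y u x)"

lemma pd_H_fields:
  assumes "smooth_on U X" "smooth_on U Y" "smooth_on U Z" "y \<in> U"
  shows "pd u (\<lambda>z. H z (X z) (Y z) (Z z)) y = nabH y u (X y) (Y y) (Z y)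
    + H y (nab u X y) (Y y) (Z y) + H y (X y) (nab u Y y) (Z y) + H y (X y) (Y y) (nab u Z y)"
proof -
  have "pd u (\<lambda>z. H z (X z) (Y z) (Z z)) y = pd u (\<lambda>z. H z (X y) (Y y) (Z y)) y
    + H y (pd u X y) (Y y) (Z y) + H y (X y) (pd u Y y) (Z y) + H y (X y) (Y y) (pd u Z y)"
    by (rule pd_family3[OF open_chart linear_H1 linear_H2 linear_H3 smooth_H assms])
  then show ?thesis
    by (simp add: nabH_def nab_def linear_add[OF linear_H1[OF assms(4)]]
        linear_add[OF linear_H2[OF assms(4)]] linear_add[OF linear_H3[OF assms(4)]])
qed

lemma nabH_swap:
  assumes y: "y \<in> U"
  shows nabH_swap12: "nabH y u w v x = - nabH y u v w x" and nabH_swap23: "nabH y u v x w = - nabH y u v w x"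
proof -
  have neg: "pd u (\<lambda>z. - H z v w x) y = - pd u (\<lambda>z. H z v w x) y" for v w x
    by (rule pd_linear[OF bounded_linear_minus[OF bounded_linear_ident] smooth_H y])
  have "pd u (\<lambda>z. H z w v x) y = - pd u (\<lambda>z. H z v w x) y"
    unfolding neg[symmetric] by (rule pd_cong[OF open_chart H_swap12 y])
  then show "nabH y u w v x = - nabH y u v w x"
    by (simp add: nabH_def H_swap12[OF y, of w "lc y u v"] H_swap12[OF y, of "lc y u w" v] H_swap12[OF y, of w v])
  have "pd u (\<lambda>z. H z v x w) y = - pd u (\<lambda>z. H z v w x) y"
    unfolding neg[symmetric] by (rule pd_cong[OF open_chart H_swap23 y])
  then show "nabH y u v x w = - nabH y u v w x"
    by (simp add: nabH_def H_swap23[OF y, of _ x "lc y u w"] H_swap23[OF y, of _ "lc y u x" w] H_swap23[OF y, of _ x w])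
qed

text \<open>Alternation pairs the connection terms, which cancel because the Levi-Civita connection
  is symmetric.\<close>

lemma ext_d3_eq:
  assumes y: "y \<in> U"
  shows "ext_d3 H y u v w x = nabH y u v w x - nabH y v u w x + nabH y w u v x - nabH y x u v w"
  unfolding ext_d3_def nabH_def
  using lc_sym[OF y, of u v] lc_sym[OF y, of u w] lc_sym[OF y, of u x] lc_sym[OF y, of v w]
    lc_sym[OF y, of v x] lc_sym[OF y, of w x]
    H_swap12[OF y, of v "lc y u w" x] H_swap12[OF y, of u "lc y v w" x]
    H_swap12[OF y, of u "lc y v x" w] H_swap12[OF y, of v "lc y u x" w]
    H_swap23[OF y, of v "lc y u x" w] H_swap23[OF y, of v w "lc y u x"]
    H_swap23[OF y, of u "lc y v x" w] H_swap23[OF y, of u w "lc y v x"]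
    H_swap23[OF y, of u "lc y w x" v] H_swap23[OF y, of u v "lc y w x"]
    H_swap12[OF y, of "lc y u x" v w]
  by simp

definition "Hc y i j k = H y (e i y) (e j y) (e k y)"

definition "nHc y i j k l = nabH y (e i y) (e j y) (e k y) (e l y)"

lemma torsion_curvature_frame:
  assumes "y \<in> U"
  shows "torsion_curvature (riem y) (Hc y) (nHc y)"
  by (rule torsion_curvature.intro)
    (use assms in \<open>auto simp: riemann_like_riem skew3_def Hc_def nHc_def
      intro: H_swap12 H_swap23 nabH_swap\<close>)

lemma ext_d3_frame:
  assumes "y \<in> U"
  shows "ext_d3 H y (e i y) (e j y) (e k y) (e l y) = torsion_curvature.dH (nHc y) i j k l"
  by (simp add: torsion_curvature.dH_def[OF torsion_curvature_frame[OF assms]] ext_d3_eq[OF assms] nHc_def)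

text \<open>Coefficients in the orthonormal frame, here for the Levi-Civita connection and in
  \<open>connp\<close> for \<open>\<nabla>\<^sup>+\<close>. The direction \<open>u\<close> is a
  vector and not a frame index, so it can be held constant under differentiation.\<close>

definition "conn0 y u b c = g y (nab u (e b) y) (e c y)"

definition "connp y u b c = conn0 y u b c + 1/2 * H y u (e b y) (e c y)"

lemma smooth_conn0: "smooth_on U (\<lambda>z. conn0 z u b c)"
  unfolding conn0_def by (rule smooth_g_fields[OF smooth_nab[OF smooth_e] smooth_e])

lemma smooth_connp: "smooth_on U (\<lambda>z. connp z u b c)"
  unfolding connp_def
  by (intro smooth_on_add smooth_on_mult open_chart smooth_conn0 smooth_on_const smooth_H_fields smooth_e)

lemma conn0_skew:
  assumes y: "y \<in> U"
  shows "conn0 y u c b = - conn0 y u b c"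
proof -
  have "pd u (\<lambda>z. g z (e b z) (e c z)) y = pd u (\<lambda>z. if b = c then 1 else 0) y"
    by (rule pd_cong[OF open_chart orthonormal y])
  then show ?thesis
    by (simp add: pd_g_fields[OF smooth_e smooth_e y] conn0_def sym_g[OF y, of "e b y"])
qed

lemma connp_skew: "y \<in> U \<Longrightarrow> connp y u c b = - connp y u b c"
  using conn0_skew[of y u c b] H_swap23[of y u "e c y" "e b y"] by (simp add: connp_def)

lemma linear_nab: "y \<in> U \<Longrightarrow> smooth_on U X \<Longrightarrow> linear (\<lambda>u. nab u X y)"
  by (rule linearI) (simp_all add: nab_def linear_add[OF linear_pd] linear_scale[OF linear_pd]
      linear_add[OF lc.linear_conn_vector] linear_scale[OF lc.linear_conn_vector] algebra_simps)

lemma linear_connp: "y \<in> U \<Longrightarrow> linear (\<lambda>u. connp y u b c)"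
  by (rule linearI) (simp_all add: connp_def conn0_def linear_add[OF linear_nab[OF _ smooth_e]]
      linear_scale[OF linear_nab[OF _ smooth_e]] linear_add[OF linear_g1] linear_scale[OF linear_g1]
      linear_add[OF linear_H1] linear_scale[OF linear_H1] algebra_simps)

lemma nab_frame: "y \<in> U \<Longrightarrow> nab u (e b) y = (\<Sum>d\<in>UNIV. conn0 y u b d *\<^sub>R e d y)"
  unfolding conn0_def by (rule frame_expansion)

lemma nabla_plus_eq:
  "nabla_plus g H e X Y y = nab (X y) Y y + (1/2) *\<^sub>R (\<Sum>a\<in>UNIV. H y (X y) (Y y) (e a y) *\<^sub>R e a y)"
  by (simp add: nabla_plus_def covd_lc)

lemma nabla_plus_frame:
  assumes y: "y \<in> U"
  shows "g y (nabla_plus g H e X (e a) y) (e b y) = connp y (X y) a b"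
  unfolding nabla_plus_eq connp_def conn0_def
  by (simp add: linear_add[OF linear_g1[OF y]] linear_scale[OF linear_g1[OF y]]
      linear_sum[OF linear_g1[OF y]] orthonormal[OF y] if_distrib[of "\<lambda>x. _ * x"] cong: if_cong)

text \<open>The second structure equation: the curvature of \<open>\<nabla>\<^sup>+\<close> computed
  from its frame coefficients agrees with the expression \<open>Rp\<close>.\<close>

lemma connp_curvature:
  assumes y: "y \<in> U"
  shows "pd u (\<lambda>z. connp z v b c) y - pd v (\<lambda>z. connp z u b c) y
      - (\<Sum>d\<in>UNIV. connp y v b d * connp y u c d - connp y u b d * connp y v c d)
    = g y (curv_op (levi_civita g) y u v (e b y)) (e c y)
      + 1/2 * (nabH y u v (e b y) (e c y) - nabH y v u (e b y) (e c y))
      + 1/4 * (\<Sum>k\<in>UNIV. H y v (e b y) (e k y) * H y u (e k y) (e c y)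
                        - H y u (e b y) (e k y) * H y v (e k y) (e c y))"
proof -
  define w where "w = conn0 y"
  define h where "h = (\<lambda>u b c. H y u (e b y) (e c y))"
  have hh: "H y u (e b y) (e c y) = h u b c" for u b c
    by (simp add: h_def)
  have hs: "h u c d = - h u d c" for u c d
    unfolding h_def by (rule H_swap23[OF y])
  have P: "pd u (\<lambda>z. connp z v b c) y = g y (nab u (nab v (e b)) y) (e c y) + (\<Sum>d\<in>UNIV. w v b d * w u c d)
      + 1/2 * (nabH y u v (e b y) (e c y) + H y (lc y u v) (e b y) (e c y)
        + (\<Sum>d\<in>UNIV. w u b d * h v d c) + (\<Sum>d\<in>UNIV. w u c d * h v b d))" for u v
  proof -
    have "pd u (\<lambda>z. connp z v b c) y = pd u (\<lambda>z. conn0 z v b c) y + 1/2 * pd u (\<lambda>z. H z v (e b z) (e c z)) y"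
    proof -
      have "pd u (\<lambda>z. 1/2 * H z v (e b z) (e c z)) y = 1/2 * pd u (\<lambda>z. H z v (e b z) (e c z)) y"
        by (rule pd_linear[OF bounded_linear_mult_right smooth_H_fields[OF smooth_on_const smooth_e smooth_e] y])
      moreover have "smooth_on U (\<lambda>z. 1/2 * H z v (e b z) (e c z))"
        by (intro smooth_on_mult open_chart smooth_on_const smooth_H_fields smooth_e)
      ultimately show ?thesis
        unfolding connp_def by (simp only: pd_add[OF smooth_conn0 _ y])
    qed
    also have "pd u (\<lambda>z. conn0 z v b c) y = g y (nab u (nab v (e b)) y) (e c y) + g y (nab v (e b) y) (nab u (e c) y)"
      unfolding conn0_def by (rule pd_g_fields[OF smooth_nab[OF smooth_e] smooth_e y])
    also have "g y (nab v (e b) y) (nab u (e c) y) = (\<Sum>d\<in>UNIV. w v b d * w u c d)"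
      unfolding w_def conn0_def by (rule g_frame[OF y])
    also have "pd u (\<lambda>z. H z v (e b z) (e c z)) y = nabH y u v (e b y) (e c y) + H y (lc y u v) (e b y) (e c y)
        + H y v (nab u (e b) y) (e c y) + H y v (e b y) (nab u (e c) y)"
      using pd_H_fields[OF smooth_on_const[of U v] smooth_e[of b] smooth_e[of c] y, of u] by (simp add: nab_def)
    also have "H y v (nab u (e b) y) (e c y) = (\<Sum>d\<in>UNIV. w u b d * h v d c)"
      unfolding nab_frame[OF y] w_def h_def
      by (simp add: linear_sum[OF linear_H2[OF y]] linear_scale[OF linear_H2[OF y]])
    also have "H y v (e b y) (nab u (e c) y) = (\<Sum>d\<in>UNIV. w u c d * h v b d)"
      unfolding nab_frame[OF y] w_def h_def
      by (simp add: linear_sum[OF linear_H3[OF y]] linear_scale[OF linear_H3[OF y]])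
    finally show ?thesis by (simp add: algebra_simps)
  qed
  \<comment> \<open>For each \<open>d\<close> the products of two \<open>w\<close> cancel, the mixed
    ones cancel by skewness of \<open>h\<close>, and only products of two \<open>h\<close>
    remain.\<close>
  have q: "(\<Sum>d\<in>UNIV. w v b d * w u c d) + 1/2 * ((\<Sum>d\<in>UNIV. w u b d * h v d c) + (\<Sum>d\<in>UNIV. w u c d * h v b d))
      - ((\<Sum>d\<in>UNIV. w u b d * w v c d) + 1/2 * ((\<Sum>d\<in>UNIV. w v b d * h u d c) + (\<Sum>d\<in>UNIV. w v c d * h u b d)))
      - (\<Sum>d\<in>UNIV. connp y v b d * connp y u c d - connp y u b d * connp y v c d)
    = 1/4 * (\<Sum>k\<in>UNIV. h v b k * h u k c - h u b k * h v k c)"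
    unfolding sum_distrib_left sum.distrib[symmetric] sum_subtractf[symmetric]
  proof (rule sum.cong[OF refl])
    fix d
    show "w v b d * w u c d + 1/2 * (w u b d * h v d c + w u c d * h v b d)
      - (w u b d * w v c d + 1/2 * (w v b d * h u d c + w v c d * h u b d))
      - (connp y v b d * connp y u c d - connp y u b d * connp y v c d)
    = 1/4 * (h v b d * h u d c - h u b d * h v d c)"
      unfolding connp_def w_def[symmetric] hh
      by (simp add: hs[of _ d c] field_simps)
  qed
  have N: "g y (nab u (nab v (e b)) y) (e c y) - g y (nab v (nab u (e b)) y) (e c y)
      = g y (curv_op (levi_civita g) y u v (e b y)) (e c y)"
    by (simp add: linear_diff[OF linear_g1[OF y], symmetric] nab_nab[OF smooth_e y])
  show ?thesis
    using q N lc_sym[OF y, of u v] unfolding P h_def by (simp add: algebra_simps)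
qed

end

section \<open>Parallel spinors\<close>

context framed_chart
begin

definition hess :: "(real^'d \<Rightarrow> real) \<Rightarrow> real^'d \<Rightarrow> real^'d \<Rightarrow> real^'d \<Rightarrow> real" where
  "hess f y u v = pd u (pd v f) y - pd (lc y u v) f y"

lemma hess_sym: "smooth_on U f \<Longrightarrow> y \<in> U \<Longrightarrow> hess f y u v = hess f y v u"
  using lc_sym[of y u v] pd_commute[OF open_chart, where f = f and y = y and u = u and v = v]
  by (simp add: hess_def)

lemma pd_gradient:
  assumes f: "smooth_on U f" and y: "y \<in> U"
  shows "pd u (\<lambda>z. pd (e c z) f z) y = hess f y u (e c y) + pd (nab u (e c) y) f y"
  by (simp add: lc.pd_pd_field[OF f smooth_e y] hess_def nab_def linear_add[OF linear_pd[OF f y]])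

lemma hessian_eq: "smooth_on U f \<Longrightarrow> y \<in> U \<Longrightarrow> hessian g e f y i j = hess f y (e i y) (e j y)"
  by (simp add: hessian_def pd_gradient covd_lc)

end

locale parallel_spinor = torsion_chart U g e H + clifford_module \<gamma>
  for U :: "(real^'d::finite) set" and g :: "'d metric" and e :: "'d frame" and H :: "'d tensor3"
    and \<gamma> :: "'d \<Rightarrow> 'v::euclidean_space \<Rightarrow> 'v" +
  fixes \<epsilon> :: "real^'d \<Rightarrow> 'v"
  assumes smooth_spinor: "smooth_on U \<epsilon>"
    and parallel_frame: "\<And>y a. y \<in> U \<Longrightarrow> pd (e a y) \<epsilon> y = (1/4) *\<^sub>R c2 (connp y (e a y)) (\<epsilon> y)"
begin

lemma linear_c2_connp:
  assumes y: "y \<in> U"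
  shows "linear (\<lambda>u. c2 (connp y u) \<psi>)"
proof (rule linearI)
  have "connp y (u + v) = (\<lambda>b c. connp y u b c + connp y v b c)" for u v
    by (intro ext) (rule linear_add[OF linear_connp[OF y]])
  then show "c2 (connp y (u + v)) \<psi> = c2 (connp y u) \<psi> + c2 (connp y v) \<psi>" for u v
    by (simp only: c2_add)
  have "connp y (r *\<^sub>R u) = (\<lambda>b c. r * connp y u b c)" for r u
    by (intro ext) (simp add: linear_scale[OF linear_connp[OF y]])
  then show "c2 (connp y (r *\<^sub>R u)) \<psi> = r *\<^sub>R c2 (connp y u) \<psi>" for r u
    by (simp only: c2_scale)
qed

lemma parallel:
  assumes y: "y \<in> U"
  shows "pd u \<epsilon> y = (1/4) *\<^sub>R c2 (connp y u) (\<epsilon> y)"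
  by (simp add: linear_frame[OF y linear_pd[OF smooth_spinor y], of u]
      linear_frame[OF y linear_c2_connp[OF y], of u] parallel_frame[OF y] scaleR_sum_right mult.commute)

section \<open>Differentiating Clifford contractions of the spinor\<close>

lemma bounded_linear_gamma: "bounded_linear (\<gamma> m)"
  using linear_gamma linear_conv_bounded_linear by blast

lemma smooth_gamma: "smooth_on U \<psi> \<Longrightarrow> smooth_on U (\<lambda>z. \<gamma> m (\<psi> z))"
  by (rule smooth_on_linear[OF bounded_linear_gamma open_chart])

lemma pd_gamma: "smooth_on U \<psi> \<Longrightarrow> y \<in> U \<Longrightarrow> pd u (\<lambda>z. \<gamma> m (\<psi> z)) y = \<gamma> m (pd u \<psi> y)"
  by (rule pd_linear[OF bounded_linear_gamma])

lemma smooth_c1: "(\<And>m. smooth_on U (w m)) \<Longrightarrow> smooth_on U \<psi> \<Longrightarrow> smooth_on U (\<lambda>z. c1 (\<lambda>m. w m z) (\<psi> z))"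
  unfolding c1_def by (intro smooth_on_sum smooth_on_scaleR smooth_gamma open_chart)

lemma pd_c1:
  assumes w: "\<And>m. smooth_on U (w m)" and \<psi>: "smooth_on U \<psi>" and y: "y \<in> U"
  shows "pd u (\<lambda>z. c1 (\<lambda>m. w m z) (\<psi> z)) y = c1 (\<lambda>m. pd u (w m) y) (\<psi> y) + c1 (\<lambda>m. w m y) (pd u \<psi> y)"
  unfolding c1_def
  by (subst pd_sum[of _ U])
    (simp_all add: y smooth_on_scaleR smooth_gamma open_chart w \<psi> pd_scaleR[OF w smooth_gamma[OF \<psi>] y]
      pd_gamma[OF \<psi> y] sum.distrib)

lemma smooth_c2:
  "(\<And>m n. smooth_on U (F m n)) \<Longrightarrow> smooth_on U \<psi> \<Longrightarrow> smooth_on U (\<lambda>z. c2 (\<lambda>m n. F m n z) (\<psi> z))"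
  unfolding c2_as_c1 by (intro smooth_on_sum smooth_c1 smooth_gamma open_chart)

lemma pd_c2:
  assumes F: "\<And>m n. smooth_on U (F m n)" and \<psi>: "smooth_on U \<psi>" and y: "y \<in> U"
  shows "pd u (\<lambda>z. c2 (\<lambda>m n. F m n z) (\<psi> z)) y =
    c2 (\<lambda>m n. pd u (F m n) y) (\<psi> y) + c2 (\<lambda>m n. F m n y) (pd u \<psi> y)"
  unfolding c2_as_c1
  by (subst pd_sum[of _ U])
    (simp_all add: y smooth_c1 smooth_gamma F \<psi> pd_c1[OF F smooth_gamma[OF \<psi>] y] pd_gamma[OF \<psi> y] sum.distrib)

lemma pd_c3:
  assumes T: "\<And>j a b. smooth_on U (T j a b)" and \<psi>: "smooth_on U \<psi>" and y: "y \<in> U"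
  shows "pd u (\<lambda>z. c3 (\<lambda>j a b. T j a b z) (\<psi> z)) y =
    c3 (\<lambda>j a b. pd u (T j a b) y) (\<psi> y) + c3 (\<lambda>j a b. T j a b y) (pd u \<psi> y)"
  unfolding c3_eq_c2
  by (subst pd_sum[of _ U])
    (simp_all add: y smooth_c2 smooth_gamma T \<psi> pd_gamma[OF smooth_c2[OF T \<psi>] y] pd_c2[OF T \<psi> y]
      gamma.add sum.distrib)

text \<open>Integrability of the parallel spinor. The frame vectors at \<open>y\<close> are frozen
  to constants, so partial derivatives commute and no bracket appears.\<close>

lemma connp_curvature_annihilates:
  assumes y: "y \<in> U"
  shows "c2 (torsion_curvature.Rp (riem y) (Hc y) (nHc y) i j) (\<epsilon> y) = 0"
proof -
  have W: "connp y u n m = - connp y u m n" for u m n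
    by (rule connp_skew[OF y])
  have D: "pd u (pd v \<epsilon>) y = (1/4) *\<^sub>R c2 (\<lambda>b c. pd u (\<lambda>z. connp z v b c) y) (\<epsilon> y)
      + (1/16) *\<^sub>R c2 (connp y v) (c2 (connp y u) (\<epsilon> y))" for u v
  proof -
    have "pd u (pd v \<epsilon>) y = pd u (\<lambda>z. (1/4) *\<^sub>R c2 (connp z v) (\<epsilon> z)) y"
      by (rule pd_cong[OF open_chart parallel y])
    also have "\<dots> = (1/4) *\<^sub>R pd u (\<lambda>z. c2 (connp z v) (\<epsilon> z)) y"
      by (rule pd_linear[OF bounded_linear_scaleR_right smooth_c2[OF smooth_connp smooth_spinor] y])
    also have "\<dots> = (1/4) *\<^sub>R (c2 (\<lambda>b c. pd u (\<lambda>z. connp z v b c) y) (\<epsilon> y) + c2 (connp y v) (pd u \<epsilon> y))"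
      by (simp only: pd_c2[OF smooth_connp smooth_spinor y])
    finally show ?thesis by (simp add: parallel[OF y] c2.scaleR scaleR_add_right)
  qed
  let ?u = "e i y" and ?v = "e j y"
  have "0 = 4 *\<^sub>R (pd ?u (pd ?v \<epsilon>) y - pd ?v (pd ?u \<epsilon>) y)"
    using pd_commute[OF open_chart smooth_spinor y, where u = ?u and v = ?v] by simp
  also have "\<dots> = c2 (\<lambda>b c. pd ?u (\<lambda>z. connp z ?v b c) y) (\<epsilon> y) - c2 (\<lambda>b c. pd ?v (\<lambda>z. connp z ?u b c) y) (\<epsilon> y)
      + (1/4) *\<^sub>R (c2 (connp y ?v) (c2 (connp y ?u) (\<epsilon> y)) - c2 (connp y ?u) (c2 (connp y ?v) (\<epsilon> y)))"
    unfolding D by (simp add: algebra_simps)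
  \<comment> \<open>The 4 in \<open>c2_c2\<close> absorbs the remaining 1/4.\<close>
  also have "\<dots> = c2 (\<lambda>b c. pd ?u (\<lambda>z. connp z ?v b c) y) (\<epsilon> y) - c2 (\<lambda>b c. pd ?v (\<lambda>z. connp z ?u b c) y) (\<epsilon> y)
      - c2 (\<lambda>m n. (\<Sum>k\<in>UNIV. connp y ?u k n * connp y ?v k m) + (\<Sum>k\<in>UNIV. connp y ?u m k * connp y ?v k n)) (\<epsilon> y)"
    by (subst c2_c2[OF W]) simp
  also have "\<dots> = c2 (\<lambda>b c. pd ?u (\<lambda>z. connp z ?v b c) y - pd ?v (\<lambda>z. connp z ?u b c) y
      - (\<Sum>d\<in>UNIV. connp y ?v b d * connp y ?u c d - connp y ?u b d * connp y ?v c d)) (\<epsilon> y)"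
  proof -
    have "(\<Sum>k\<in>UNIV. connp y ?u k n * connp y ?v k m) + (\<Sum>k\<in>UNIV. connp y ?u m k * connp y ?v k n)
      = (\<Sum>d\<in>UNIV. connp y ?v m d * connp y ?u n d - connp y ?u m d * connp y ?v n d)" for m n
      unfolding sum.distrib[symmetric]
    proof (rule sum.cong[OF refl])
      fix k
      show "connp y ?u k n * connp y ?v k m + connp y ?u m k * connp y ?v k n
        = connp y ?v m k * connp y ?u n k - connp y ?u m k * connp y ?v n k"
        unfolding W[of ?u k n] W[of ?v k m] W[of ?v k n] by (simp add: W[of ?u n k] mult.commute)
    qed
    then show ?thesis by (simp only: c2_diff)
  qed
  also have "(\<lambda>b c. pd ?u (\<lambda>z. connp z ?v b c) y - pd ?v (\<lambda>z. connp z ?u b c) y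
      - (\<Sum>d\<in>UNIV. connp y ?v b d * connp y ?u c d - connp y ?u b d * connp y ?v c d))
      = torsion_curvature.Rp (riem y) (Hc y) (nHc y) i j"
    unfolding connp_curvature[OF y]
    by (intro ext) (simp add: torsion_curvature.Rp_def[OF torsion_curvature_frame[OF y]] riem_def Hc_def nHc_def)
  finally show ?thesis by (rule sym)
qed

text \<open>Clifford multiplication is parallel: the coefficients receive their covariant
  derivative, and what is left is the spin connection acting on the whole contraction. The next two
  lemmas follow the same pattern.\<close>

lemma pd_parallel_c1:
  assumes w: "\<And>m. smooth_on U (w m)" and y: "y \<in> U"
  shows "pd u (\<lambda>z. c1 (\<lambda>m. w m z) (\<epsilon> z)) y =
    c1 (\<lambda>m. pd u (w m) y + (\<Sum>a\<in>UNIV. w a y * connp y u a m)) (\<epsilon> y)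
    + (1/4) *\<^sub>R c2 (connp y u) (c1 (\<lambda>m. w m y) (\<epsilon> y))"
  unfolding c2_c1[OF connp_skew[OF y]]
  by (simp add: pd_c1[OF w smooth_spinor y] parallel[OF y] c1_add)
    (simp add: c1_def gamma.scaleR scaleR_sum_right scaleR_diff_right mult.commute)

lemma pd_parallel_c2:
  assumes F: "\<And>m n. smooth_on U (F m n)" and y: "y \<in> U"
  shows "pd u (\<lambda>z. c2 (\<lambda>m n. F m n z) (\<epsilon> z)) y =
    c2 (\<lambda>m n. pd u (F m n) y + ((\<Sum>k\<in>UNIV. F k n y * connp y u k m) + (\<Sum>k\<in>UNIV. F m k y * connp y u k n))) (\<epsilon> y)
    + (1/4) *\<^sub>R c2 (connp y u) (c2 (\<lambda>m n. F m n y) (\<epsilon> y))"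
  unfolding c2_c2[OF connp_skew[OF y]] c2_add[of "\<lambda>m n. pd u (F m n) y"]
  by (simp add: pd_c2[OF F smooth_spinor y] parallel[OF y] c2.scaleR scaleR_diff_right)

lemma pd_parallel_c3:
  assumes T: "\<And>j a b. smooth_on U (T j a b)" and y: "y \<in> U"
  shows "pd u (\<lambda>z. c3 (\<lambda>j a b. T j a b z) (\<epsilon> z)) y =
    c3 (\<lambda>j a b. pd u (T j a b) y + ((\<Sum>k\<in>UNIV. T k a b y * connp y u k j)
      + (\<Sum>k\<in>UNIV. T j k b y * connp y u k a) + (\<Sum>k\<in>UNIV. T j a k y * connp y u k b))) (\<epsilon> y)
    + (1/4) *\<^sub>R c2 (connp y u) (c3 (\<lambda>j a b. T j a b y) (\<epsilon> y))"
  unfolding c2_c3[OF connp_skew[OF y]] c3_add[of "\<lambda>j a b. pd u (T j a b) y"]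
  by (simp add: pd_c3[OF T smooth_spinor y] parallel[OF y] scaleR_diff_right)
    (simp add: c3_eq_c2 c2.scaleR gamma.scaleR scaleR_sum_right)

text \<open>Both sides of the dilatino equation are differentiated; the spin connection terms agree
  by the equation itself at \<open>y\<close>, leaving \<open>\<nabla>\<^sup>+d\<phi>\<close> and
  \<open>\<nabla>\<^sup>+H\<close>.\<close>

lemma dilatino_derivative:
  assumes f: "smooth_on U f"
    and dil: "\<And>z. z \<in> U \<Longrightarrow> c1 (\<lambda>m. pd (e m z) f z) (\<epsilon> z) = (1/12) *\<^sub>R c3 (Hc z) (\<epsilon> z)"
    and y: "y \<in> U"
  shows "c1 (\<lambda>j. hess f y (e i y) (e j y) - 1/2 * (\<Sum>k\<in>UNIV. Hc y i j k * pd (e k y) f y)) (\<epsilon> y)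
    = (1/12) *\<^sub>R c3 (torsion_curvature.np (Hc y) (nHc y) i) (\<epsilon> y)"
proof -
  let ?u = "e i y" and ?w = "\<lambda>m z. pd (e m z) f z" and ?T = "\<lambda>j a b z. Hc z j a b"
  note H = torsion_curvature.H[OF torsion_curvature_frame[OF y]]
  have sw: "smooth_on U (?w m)" for m
    by (rule lc.smooth_on_pd_field[OF f smooth_e])
  have sT: "smooth_on U (?T j a b)" for j a b
    unfolding Hc_def by (rule smooth_H_fields[OF smooth_e smooth_e smooth_e])
  have sc3: "smooth_on U (\<lambda>z. c3 (Hc z) (\<epsilon> z))"
    unfolding c3_eq_c2 by (intro smooth_on_sum smooth_gamma smooth_c2 sT smooth_spinor open_chart)
  have "pd ?u (\<lambda>z. c1 (\<lambda>m. ?w m z) (\<epsilon> z)) y = pd ?u (\<lambda>z. (1/12) *\<^sub>R c3 (Hc z) (\<epsilon> z)) y"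
    by (rule pd_cong[OF open_chart dil y])
  also have "\<dots> = (1/12) *\<^sub>R pd ?u (\<lambda>z. c3 (Hc z) (\<epsilon> z)) y"
    by (rule pd_linear[OF bounded_linear_scaleR_right sc3 y])
  finally have "c1 (\<lambda>m. pd ?u (?w m) y + (\<Sum>a\<in>UNIV. ?w a y * connp y ?u a m)) (\<epsilon> y)
      = (1/12) *\<^sub>R c3 (\<lambda>j a b. pd ?u (?T j a b) y + ((\<Sum>k\<in>UNIV. ?T k a b y * connp y ?u k j)
      + (\<Sum>k\<in>UNIV. ?T j k b y * connp y ?u k a) + (\<Sum>k\<in>UNIV. ?T j a k y * connp y ?u k b))) (\<epsilon> y)"
    by (simp add: pd_parallel_c1[OF sw y] pd_parallel_c3[OF sT y] dil[OF y] c2.scaleR scaleR_add_right)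
  also have "(\<lambda>m. pd ?u (?w m) y + (\<Sum>a\<in>UNIV. ?w a y * connp y ?u a m))
      = (\<lambda>j. hess f y ?u (e j y) - 1/2 * (\<Sum>k\<in>UNIV. Hc y i j k * ?w k y))"
  proof
    fix j
    have "pd ?u (?w j) y = hess f y ?u (e j y) + (\<Sum>a\<in>UNIV. conn0 y ?u j a * ?w a y)"
      unfolding pd_gradient[OF f y] nab_frame[OF y]
      by (simp add: linear_sum[OF linear_pd[OF f y]] linear_scale[OF linear_pd[OF f y]])
    \<comment> \<open>The derivative of the moving frame cancels the Levi-Civita part of the
      rotation; half the torsion survives.\<close>
    moreover have "conn0 y ?u j a * ?w a y + ?w a y * connp y ?u a j = - 1/2 * (Hc y i j a * ?w a y)" for a
      unfolding connp_def conn0_skew[OF y, of ?u a j] Hc_def H_swap23[OF y, of ?u "e a y" "e j y"]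
      by (simp add: algebra_simps)
    ultimately show "pd ?u (?w j) y + (\<Sum>a\<in>UNIV. ?w a y * connp y ?u a j)
        = hess f y ?u (e j y) - 1/2 * (\<Sum>k\<in>UNIV. Hc y i j k * ?w k y)"
      by (simp add: add.assoc sum_distrib_left sum_negf flip: sum.distrib)
  qed
  also have "(\<lambda>j a b. pd ?u (?T j a b) y + ((\<Sum>k\<in>UNIV. ?T k a b y * connp y ?u k j)
      + (\<Sum>k\<in>UNIV. ?T j k b y * connp y ?u k a) + (\<Sum>k\<in>UNIV. ?T j a k y * connp y ?u k b)))
      = torsion_curvature.np (Hc y) (nHc y) i"
  proof (intro ext)
    fix j a b
    have "pd ?u (?T j a b) y = nHc y i j a b + (\<Sum>k\<in>UNIV. conn0 y ?u j k * Hc y k a b)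
        + (\<Sum>k\<in>UNIV. conn0 y ?u a k * Hc y j k b) + (\<Sum>k\<in>UNIV. conn0 y ?u b k * Hc y j a k)"
      unfolding Hc_def nHc_def pd_H_fields[OF smooth_e smooth_e smooth_e y] nab_frame[OF y]
      by (simp add: linear_sum[OF linear_H1[OF y]] linear_scale[OF linear_H1[OF y]]
          linear_sum[OF linear_H2[OF y]] linear_scale[OF linear_H2[OF y]]
          linear_sum[OF linear_H3[OF y]] linear_scale[OF linear_H3[OF y]])
    moreover have "conn0 y ?u j k * Hc y k a b + conn0 y ?u a k * Hc y j k b + conn0 y ?u b k * Hc y j a k
        + (Hc y k a b * connp y ?u k j + Hc y j k b * connp y ?u k a + Hc y j a k * connp y ?u k b)
      = - 1/2 * (Hc y i j k * Hc y k a b + Hc y i a k * Hc y j k b + Hc y i b k * Hc y j a k)" for k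
      unfolding connp_def conn0_skew[OF y, of ?u k j] conn0_skew[OF y, of ?u k a] conn0_skew[OF y, of ?u k b]
        Hc_def[symmetric] skew3D(2)[OF H, of i k j] skew3D(2)[OF H, of i k a] skew3D(2)[OF H, of i k b]
      by (simp add: algebra_simps)
    ultimately show "pd ?u (?T j a b) y + ((\<Sum>k\<in>UNIV. ?T k a b y * connp y ?u k j)
      + (\<Sum>k\<in>UNIV. ?T j k b y * connp y ?u k a) + (\<Sum>k\<in>UNIV. ?T j a k y * connp y ?u k b))
      = torsion_curvature.np (Hc y) (nHc y) i j a b"
      unfolding torsion_curvature.np_def[OF torsion_curvature_frame[OF y]]
      by (simp add: add.assoc sum_distrib_left sum_negf flip: sum.distrib)
  qed
  finally show ?thesis .
qed

end

section \<open>The gauge field\<close>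

locale gauge_instanton = parallel_spinor U g e H \<gamma> \<epsilon> + chart_connection U A
  for U :: "(real^'d::finite) set" and g :: "'d metric" and e :: "'d frame" and H :: "'d tensor3"
    and \<gamma> :: "'d \<Rightarrow> 'v::euclidean_space \<Rightarrow> 'v" and \<epsilon> :: "real^'d \<Rightarrow> 'v"
    and A :: "('d,'r::finite) conn" +
  assumes gaugino: "\<And>y k l. y \<in> U \<Longrightarrow> c2 (\<lambda>m n. curv_op A y (e m y) (e n y) (axis k 1) $ l) (\<epsilon> y) = 0"
begin

abbreviation "F y u v s \<equiv> curv_op A y u v s"

definition "Fc y m n k l = F y (e m y) (e n y) (axis k 1) $ l"

text \<open>The derivative by the Levi-Civita connection in the form slots and by \<open>A\<close>
  in the fibre; torsion is added in \<open>Gc\<close>.\<close>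

definition "covF y u v w s = cov_curv y u v w s - F y (lc y u v) w s - F y v (lc y u w) s"

lemma covF_skew:
  assumes y: "y \<in> U"
  shows "covF y u w v s = - covF y u v w s"
proof -
  have "pd u (\<lambda>z. F z w v s) y = pd u (\<lambda>z. - F z v w s) y"
    by (rule pd_cong[OF open_U curv_op_skew y])
  also have "\<dots> = - pd u (\<lambda>z. F z v w s) y"
    by (rule pd_linear[OF bounded_linear_minus[OF bounded_linear_ident] smooth_on_curv_op y])
  finally show ?thesis
    unfolding covF_def cov_curv_def curv_op_skew[of y w v] curv_op_skew[of y "lc y u w" v]
      curv_op_skew[of y w "lc y u v"]
    using matrix_vector_mult_diff_distrib[of "A y u" 0 "F y v w s"] by simp
qed

lemma covF_bianchi:
  assumes y: "y \<in> U"
  shows "covF y u v w s + covF y v w u s + covF y w u v s = 0"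
  using differential_bianchi[OF y, of u v w s] lc_sym[OF y, of u v] lc_sym[OF y, of v w] lc_sym[OF y, of u w]
    curv_op_skew[of y w "lc y u v" s] curv_op_skew[of y u "lc y v w" s] curv_op_skew[of y v "lc y w u" s]
  unfolding covF_def by (simp add: algebra_simps)

lemma smooth_F_fields: "smooth_on U X \<Longrightarrow> smooth_on U Y \<Longrightarrow> smooth_on U (\<lambda>z. F z (X z) (Y z) s)"
  by (rule smooth_on_family2[where B = "\<lambda>z u v. F z u v s", OF open_U linear_curv_op1 linear_curv_op2 smooth_on_curv_op])

lemma pd_F_fields:
  assumes "smooth_on U X" "smooth_on U Y" "y \<in> U"
  shows "pd u (\<lambda>z. F z (X z) (Y z) s) y = covF y u (X y) (Y y) s
    - A y u *v F y (X y) (Y y) s + F y (X y) (Y y) (A y u *v s)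
    + F y (nab u X y) (Y y) s + F y (X y) (nab u Y y) s"
proof -
  have "pd u (\<lambda>z. F z (X z) (Y z) s) y = pd u (\<lambda>z. F z (X y) (Y y) s) y
      + F y (pd u X y) (Y y) s + F y (X y) (pd u Y y) s"
    by (rule pd_family2[where B = "\<lambda>z u v. F z u v s", OF open_U linear_curv_op1 linear_curv_op2 smooth_on_curv_op assms])
  then show ?thesis
    by (simp add: covF_def cov_curv_def nab_def linear_add[OF linear_curv_op1[OF assms(3)]]
        linear_add[OF linear_curv_op2[OF assms(3)]])
qed

text \<open>\<open>Gc y p m n k l\<close> is \<open>(\<nabla>\<^sup>+\<^sub>p F)\<^sub>m\<^sub>n\<^sub>k\<^sub>l\<close>.\<close>
definition "Gc y p m n k l = covF y (e p y) (e m y) (e n y) (axis k 1) $ l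
  - 1/2 * (\<Sum>d\<in>UNIV. Hc y p m d * Fc y d n k l + Hc y p n d * Fc y m d k l)"

lemma Fc_skew: "Fc y n m k l = - Fc y m n k l"
  unfolding Fc_def by (subst curv_op_skew) simp

lemma Gc_skew:
  assumes y: "y \<in> U"
  shows "Gc y p n m k l = - Gc y p m n k l"
proof -
  have "Hc y p n d * Fc y d m k l + Hc y p m d * Fc y n d k l
      = - (Hc y p m d * Fc y d n k l + Hc y p n d * Fc y m d k l)" for d
    unfolding Fc_skew[of y d m k l] Fc_skew[of y n d k l] by simp
  then have "(\<Sum>d\<in>UNIV. Hc y p n d * Fc y d m k l + Hc y p m d * Fc y n d k l)
      = - (\<Sum>d\<in>UNIV. Hc y p m d * Fc y d n k l + Hc y p n d * Fc y m d k l)"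
    by (simp only: sum_negf)
  then show ?thesis
    unfolding Gc_def covF_skew[OF y, of "e p y" "e n y" "e m y"] vector_uminus_component by argo
qed

text \<open>The Levi-Civita part vanishes by the Bianchi identity; every product of \<open>H\<close>
  and \<open>F\<close> occurs twice, which cancels the 1/2 in \<open>Gc\<close>.\<close>

lemma Gc_cyclic:
  assumes y: "y \<in> U"
  shows "Gc y p m n k l + Gc y m n p k l + Gc y n p m k l
    = - ((\<Sum>d\<in>UNIV. Hc y d m n * Fc y d p k l) + (\<Sum>d\<in>UNIV. Hc y d n p * Fc y d m k l)
        + (\<Sum>d\<in>UNIV. Hc y d p m * Fc y d n k l))"
proof -
  note H = torsion_curvature.H[OF torsion_curvature_frame[OF y]]
  have "(Hc y p m d * Fc y d n k l + Hc y p n d * Fc y m d k l)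
      + (Hc y m n d * Fc y d p k l + Hc y m p d * Fc y n d k l)
      + (Hc y n p d * Fc y d m k l + Hc y n m d * Fc y p d k l)
    = 2 * (Hc y d m n * Fc y d p k l + Hc y d n p * Fc y d m k l + Hc y d p m * Fc y d n k l)" for d
    unfolding Fc_skew[of y m d] Fc_skew[of y n d] Fc_skew[of y p d]
      skew3D(4)[OF H, of p m d] skew3D(4)[OF H, of m n d] skew3D(4)[OF H, of n p d]
      skew3D(3)[OF H, of p n d] skew3D(3)[OF H, of m p d] skew3D(3)[OF H, of n m d]
    by simp
  then have "(\<Sum>d\<in>UNIV. Hc y p m d * Fc y d n k l + Hc y p n d * Fc y m d k l)
      + (\<Sum>d\<in>UNIV. Hc y m n d * Fc y d p k l + Hc y m p d * Fc y n d k l)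
      + (\<Sum>d\<in>UNIV. Hc y n p d * Fc y d m k l + Hc y n m d * Fc y p d k l)
    = 2 * ((\<Sum>d\<in>UNIV. Hc y d m n * Fc y d p k l) + (\<Sum>d\<in>UNIV. Hc y d n p * Fc y d m k l)
        + (\<Sum>d\<in>UNIV. Hc y d p m * Fc y d n k l))"
    by (simp only: sum.distrib[symmetric] sum_distrib_left)
  moreover have "covF y (e p y) (e m y) (e n y) (axis k 1) $ l + covF y (e m y) (e n y) (e p y) (axis k 1) $ l
      + covF y (e n y) (e p y) (e m y) (axis k 1) $ l = 0"
    unfolding vector_add_component[symmetric] covF_bianchi[OF y] by simp
  ultimately show ?thesis unfolding Gc_def by argo
qed

text \<open>The gaugino equation is differentiated. The terms from the connection on the
  endomorphism indices are linear combinations of components of \<open>F\<close>, each of which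
  annihilates the spinor.\<close>

lemma Gc_annihilates:
  assumes y: "y \<in> U"
  shows "c2 (\<lambda>m n. Gc y p m n k l) (\<epsilon> y) = 0"
proof -
  let ?u = "e p y" and ?f = "\<lambda>m n z. Fc z m n k l"
  have sf: "smooth_on U (?f m n)" for m n
    unfolding Fc_def
    by (rule smooth_on_linear[OF bounded_linear_vec_nth open_U smooth_F_fields[OF smooth_e smooth_e]])
  have g: "c2 (\<lambda>m n. Fc z m n k l) (\<epsilon> z) = 0" if "z \<in> U" for z k l
    unfolding Fc_def by (rule gaugino[OF that])
  have "pd ?u (\<lambda>z. c2 (\<lambda>m n. ?f m n z) (\<epsilon> z)) y = pd ?u (\<lambda>z. 0) y"
    by (rule pd_cong[OF open_U g y])
  then have 1: "c2 (\<lambda>m n. pd ?u (?f m n) y + ((\<Sum>d\<in>UNIV. ?f d n y * connp y ?u d m)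
      + (\<Sum>d\<in>UNIV. ?f m d y * connp y ?u d n))) (\<epsilon> y) = 0"
    by (simp add: pd_parallel_c2[OF sf y] g[OF y] c2_zero)
  have "(\<lambda>m n. pd ?u (?f m n) y + ((\<Sum>d\<in>UNIV. ?f d n y * connp y ?u d m)
      + (\<Sum>d\<in>UNIV. ?f m d y * connp y ?u d n)))
    = (\<lambda>m n. Gc y p m n k l + (\<Sum>j\<in>UNIV. (A y ?u *v axis k 1) $ j * Fc y m n j l)
        - (\<Sum>j\<in>UNIV. A y ?u $ l $ j * Fc y m n k j))"
  proof (intro ext)
    fix m n
    have "pd ?u (?f m n) y = pd ?u (\<lambda>z. F z (e m z) (e n z) (axis k 1)) y $ l"
      unfolding Fc_def
      by (rule pd_linear[OF bounded_linear_vec_nth smooth_F_fields[OF smooth_e smooth_e] y])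
    also have "\<dots> = covF y ?u (e m y) (e n y) (axis k 1) $ l
        - (A y ?u *v F y (e m y) (e n y) (axis k 1)) $ l + F y (e m y) (e n y) (A y ?u *v axis k 1) $ l
        + F y (nab ?u (e m) y) (e n y) (axis k 1) $ l + F y (e m y) (nab ?u (e n) y) (axis k 1) $ l"
      by (simp add: pd_F_fields[OF smooth_e smooth_e y])
    also have "(A y ?u *v F y (e m y) (e n y) (axis k 1)) $ l = (\<Sum>j\<in>UNIV. A y ?u $ l $ j * Fc y m n k j)"
      by (simp add: matrix_vector_mult_def Fc_def)
    also have "F y (e m y) (e n y) (A y ?u *v axis k 1) $ l = (\<Sum>j\<in>UNIV. (A y ?u *v axis k 1) $ j * Fc y m n j l)"
      by (subst vec_axis_expand[of "A y ?u *v axis k 1"])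
        (simp add: linear_sum[OF linear_curv_op3[OF y]] linear_scale[OF linear_curv_op3[OF y]] Fc_def)
    also have "F y (nab ?u (e m) y) (e n y) (axis k 1) $ l = (\<Sum>d\<in>UNIV. conn0 y ?u m d * Fc y d n k l)"
      unfolding nab_frame[OF y]
      by (simp add: linear_sum[OF linear_curv_op1[OF y]] linear_scale[OF linear_curv_op1[OF y]] Fc_def)
    also have "F y (e m y) (nab ?u (e n) y) (axis k 1) $ l = (\<Sum>d\<in>UNIV. conn0 y ?u n d * Fc y m d k l)"
      unfolding nab_frame[OF y]
      by (simp add: linear_sum[OF linear_curv_op2[OF y]] linear_scale[OF linear_curv_op2[OF y]] Fc_def)
    finally have P: "pd ?u (?f m n) y = covF y ?u (e m y) (e n y) (axis k 1) $ l
        - (\<Sum>j\<in>UNIV. A y ?u $ l $ j * Fc y m n k j) + (\<Sum>j\<in>UNIV. (A y ?u *v axis k 1) $ j * Fc y m n j l)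
        + (\<Sum>d\<in>UNIV. conn0 y ?u m d * Fc y d n k l) + (\<Sum>d\<in>UNIV. conn0 y ?u n d * Fc y m d k l)" .
    have "conn0 y ?u m d * Fc y d n k l + conn0 y ?u n d * Fc y m d k l
        + (?f d n y * connp y ?u d m + ?f m d y * connp y ?u d n)
      = - 1/2 * (Hc y p m d * Fc y d n k l + Hc y p n d * Fc y m d k l)" for d
      unfolding connp_def conn0_skew[OF y, of ?u d m] conn0_skew[OF y, of ?u d n] Hc_def
        H_swap23[OF y, of ?u "e d y" "e m y"] H_swap23[OF y, of ?u "e d y" "e n y"]
      by (simp add: algebra_simps)
    then have "(\<Sum>d\<in>UNIV. conn0 y ?u m d * Fc y d n k l) + (\<Sum>d\<in>UNIV. conn0 y ?u n d * Fc y m d k l)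
        + ((\<Sum>d\<in>UNIV. ?f d n y * connp y ?u d m) + (\<Sum>d\<in>UNIV. ?f m d y * connp y ?u d n))
      = - 1/2 * (\<Sum>d\<in>UNIV. Hc y p m d * Fc y d n k l + Hc y p n d * Fc y m d k l)"
      by (simp only: sum.distrib[symmetric] sum_distrib_left)
    then show "pd ?u (?f m n) y + ((\<Sum>d\<in>UNIV. ?f d n y * connp y ?u d m)
        + (\<Sum>d\<in>UNIV. ?f m d y * connp y ?u d n))
      = Gc y p m n k l + (\<Sum>j\<in>UNIV. (A y ?u *v axis k 1) $ j * Fc y m n j l)
        - (\<Sum>j\<in>UNIV. A y ?u $ l $ j * Fc y m n k j)"
      unfolding P Gc_def by argo
  qed
  with 1 show ?thesis
    by (simp add: c2_add c2_diff c2_sum c2_scale g[OF y])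
qed

lemma gauge_field_divergence:
  assumes y: "y \<in> U" and \<epsilon>: "\<epsilon> y \<noteq> 0"
    and dil: "c1 \<phi> (\<epsilon> y) = (1/12) *\<^sub>R c3 (Hc y) (\<epsilon> y)"
  shows "(\<Sum>j\<in>UNIV. Gc y j j b k l) = 2 * (\<Sum>j\<in>UNIV. \<phi> j * Fc y j b k l)"
proof (rule gauge_field_equation[where f = "\<lambda>m n. Fc y m n k l" and G = "\<lambda>p m n. Gc y p m n k l"])
  show "c2 (\<lambda>m n. Fc y m n k l) (\<epsilon> y) = 0"
    unfolding Fc_def by (rule gaugino[OF y])
qed (rule Fc_skew Gc_skew[OF y] torsion_curvature.H[OF torsion_curvature_frame[OF y]]
    Gc_annihilates[OF y] dil refl Gc_cyclic[OF y] \<epsilon>)+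

end

section \<open>The equivalence\<close>

lemma pd_exp_scaleR:
  fixes f :: "real^'d \<Rightarrow> real"
  assumes "smooth_on S f" "smooth_on S Q" "y \<in> S"
  shows "pd u (\<lambda>z. exp (- 2 * f z) *\<^sub>R Q z) y = exp (- 2 * f y) *\<^sub>R (pd u Q y - (2 * pd u f y) *\<^sub>R Q y)"
proof -
  have "((\<lambda>z. exp (- 2 * f z) *\<^sub>R Q z) has_derivative
      (\<lambda>u. exp (- 2 * f y) *\<^sub>R (pd u Q y - (2 * pd u f y) *\<^sub>R Q y))) (at y)"
    by (rule derivative_eq_intros smooth_on_has_derivative[OF assms(1,3)] smooth_on_has_derivative[OF assms(2,3)] refl)+
      (simp add: scaleR_diff_right algebra_simps)
  then show ?thesis by (rule pd_eqI)
qed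

lemma (in torsion_chart) H_equation_term:
  assumes f: "smooth_on U f" and y: "y \<in> U"
  shows "cov_tensor3 g (\<lambda>z u v w. exp (- 2 * f z) * H z u v w) (e a) (e a) (e b) (e c) y
    = exp (- 2 * f y) * (nHc y a a b c - 2 * (pd (e a y) f y * Hc y a b c))"
proof -
  have "pd (e a y) (\<lambda>z. exp (- 2 * f z) * H z (e a z) (e b z) (e c z)) y
      = exp (- 2 * f y) * (pd (e a y) (\<lambda>z. H z (e a z) (e b z) (e c z)) y - (2 * pd (e a y) f y) * Hc y a b c)"
    using pd_exp_scaleR[OF f smooth_H_fields[OF smooth_e smooth_e smooth_e] y] by (simp add: Hc_def)
  then show ?thesis
    by (simp add: cov_tensor3_def covd_lc pd_H_fields[OF smooth_e smooth_e smooth_e y] nHc_def Hc_def algebra_simps)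
qed

context gauge_instanton
begin

lemma curvE_eq: "y \<in> U \<Longrightarrow> curvE A e y m n k l = Fc y m n k l"
  by (simp add: curvE_def Fc_def curv_eq_curv_op smooth_e smooth_on_const)

lemma smooth_nabla_plus: "smooth_on U (nabla_plus g H e (e a) (e b))"
proof (rule smooth_on_cong[OF open_chart])
  have "smooth_on U (covd (levi_civita g) (e a) (e b))"
    by (rule lc.smooth_on_covd[OF smooth_e smooth_e])
  then show "smooth_on U (\<lambda>z. covd (levi_civita g) (e a) (e b) z
      + (1/2) *\<^sub>R (\<Sum>d\<in>UNIV. H z (e a z) (e b z) (e d z) *\<^sub>R e d z))"
    by (intro smooth_on_add smooth_on_scaleR smooth_on_sum smooth_on_const smooth_H_fields smooth_e open_chart)
qed (simp add: nabla_plus_def)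

lemma F_equation_term:
  assumes f: "smooth_on U f" and y: "y \<in> U"
  shows "cov_plus_endo2 g H e A (\<lambda>Y Z s z. exp (- 2 * f z) *\<^sub>R curv A Y Z s z) (e a) (e a) (e b) (\<lambda>_. axis k 1) y $ l
    = exp (- 2 * f y) * (Gc y a a b k l - 2 * (pd (e a y) f y * Fc y a b k l))"
proof -
  let ?s = "axis k 1 :: real^'r" and ?E = "exp (- 2 * f y)" and ?u = "e a y"
  note lin1 = linear_curv_op1[OF y] and lin2 = linear_curv_op2[OF y]
  have sF: "smooth_on U (\<lambda>z. F z (e a z) (e b z) ?s)"
    by (rule smooth_F_fields[OF smooth_e smooth_e])
  have c: "curv A X Y (\<lambda>_. ?s) z = F z (X z) (Y z) ?s" if "smooth_on U X" "smooth_on U Y" "z \<in> U" for X Y z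
    by (rule curv_eq_curv_op[OF that(1,2) smooth_on_const that(3)])
  have "pd ?u (\<lambda>z. exp (- 2 * f z) *\<^sub>R curv A (e a) (e b) (\<lambda>_. ?s) z) y
      = pd ?u (\<lambda>z. exp (- 2 * f z) *\<^sub>R F z (e a z) (e b z) ?s) y"
    by (rule pd_cong[OF open_chart _ y]) (simp only: c[OF smooth_e smooth_e])
  also have "\<dots> = ?E *\<^sub>R (pd ?u (\<lambda>z. F z (e a z) (e b z) ?s) y - (2 * pd ?u f y) *\<^sub>R F y ?u (e b y) ?s)"
    by (rule pd_exp_scaleR[OF f sF y])
  finally have 1: "covd A (e a) (\<lambda>z. exp (- 2 * f z) *\<^sub>R curv A (e a) (e b) (\<lambda>_. ?s) z) y
      = ?E *\<^sub>R (pd ?u (\<lambda>z. F z (e a z) (e b z) ?s) y - (2 * pd ?u f y) *\<^sub>R F y ?u (e b y) ?s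
        + A y ?u *v F y ?u (e b y) ?s)"
    by (simp add: covd_def c[OF smooth_e smooth_e y] matrix_vector_mult_scaleR scaleR_add_right)
  have 2: "curv A (nabla_plus g H e (e a) (e a)) (e b) (\<lambda>_. ?s) y
      = F y (nab ?u (e a) y) (e b y) ?s + (1/2) *\<^sub>R (\<Sum>d\<in>UNIV. Hc y a a d *\<^sub>R F y (e d y) (e b y) ?s)"
    unfolding c[OF smooth_nabla_plus smooth_e y] nabla_plus_eq
    by (simp add: linear_add[OF lin1] linear_scale[OF lin1] linear_sum[OF lin1] Hc_def)
  have 3: "curv A (e a) (nabla_plus g H e (e a) (e b)) (\<lambda>_. ?s) y
      = F y ?u (nab ?u (e b) y) ?s + (1/2) *\<^sub>R (\<Sum>d\<in>UNIV. Hc y a b d *\<^sub>R F y ?u (e d y) ?s)"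
    unfolding c[OF smooth_e smooth_nabla_plus y] nabla_plus_eq
    by (simp add: linear_add[OF lin2] linear_scale[OF lin2] linear_sum[OF lin2] Hc_def)
  have 4: "curv A (e a) (e b) (covd A (e a) (\<lambda>_. ?s)) y = F y ?u (e b y) (A y ?u *v ?s)"
    by (simp add: curv_eq_curv_op[OF smooth_e smooth_e smooth_on_covd[OF smooth_on_const smooth_e] y] covd_def)
  show ?thesis
    unfolding cov_plus_endo2_def 1 2 3 4 pd_F_fields[OF smooth_e smooth_e y]
    by (simp add: Gc_def Fc_def sum.distrib algebra_simps)
qed

end

section \<open>All fields in one chart\<close>

locale heterotic_chart = gauge_instanton U g e H \<gamma> \<epsilon> A + tangent: chart_connection U C
  for U :: "(real^'d::finite) set" and g :: "'d metric" and e :: "'d frame" and H :: "'d tensor3"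
    and \<gamma> :: "'d \<Rightarrow> 'v::euclidean_space \<Rightarrow> 'v" and \<epsilon> :: "real^'d \<Rightarrow> 'v"
    and A :: "('d,'r::finite) conn" and C :: "('d,'d) conn" +
  fixes f :: "real^'d \<Rightarrow> real" and \<alpha> :: real
  assumes smooth_f: "smooth_on U f" and alpha_pos: "\<alpha> > 0"
    and spinor_nonzero: "\<And>y. y \<in> U \<Longrightarrow> \<epsilon> y \<noteq> 0"
    and dilatino: "\<And>y. y \<in> U \<Longrightarrow> c1 (\<lambda>m. pd (e m y) f y) (\<epsilon> y) = (1/12) *\<^sub>R c3 (Hc y) (\<epsilon> y)"
    and anomaly: "\<And>y a b c d. y \<in> U \<Longrightarrow> ext_d3 H y (e a y) (e b y) (e c y) (e d y)
      = \<alpha> / 4 * (tr_wedge (curvT C g e y) a b c d - tr_wedge (curvE A e y) a b c d)"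
begin

lemma curvT_skew:
  assumes y: "y \<in> U"
  shows "curvT C g e y j i k l = - curvT C g e y i j k l"
  unfolding curvT_def tangent.curv_eq_curv_op[OF smooth_e smooth_e smooth_e y] tangent.curv_op_skew[of y "e j y"]
  by (rule linear_neg[OF linear_g1[OF y]])

lemma gauge_equation:
  assumes y: "y \<in> U"
  shows "(\<Sum>a\<in>UNIV. cov_plus_endo2 g H e A (\<lambda>Y Z s z. exp (- 2 * f z) *\<^sub>R curv A Y Z s z)
    (e a) (e a) (e b) (\<lambda>_. axis k 1) y) = 0"
proof (rule vec_eq_iff[THEN iffD2, rule_format])
  fix l
  have "(\<Sum>a\<in>UNIV. exp (- 2 * f y) * (Gc y a a b k l - 2 * (pd (e a y) f y * Fc y a b k l)))
      = exp (- 2 * f y) * ((\<Sum>a\<in>UNIV. Gc y a a b k l) - 2 * (\<Sum>a\<in>UNIV. pd (e a y) f y * Fc y a b k l))"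
    by (simp only: sum_distrib_left[symmetric] sum_subtractf)
  also have "\<dots> = 0"
    by (simp add: gauge_field_divergence[OF y spinor_nonzero[OF y] dilatino[OF y]])
  finally show "(\<Sum>a\<in>UNIV. cov_plus_endo2 g H e A (\<lambda>Y Z s z. exp (- 2 * f z) *\<^sub>R curv A Y Z s z)
      (e a) (e a) (e b) (\<lambda>_. axis k 1) y) $ l = 0 $ l"
    by (simp only: sum_component F_equation_term[OF smooth_f y] zero_index)
qed

lemma H_equation_iff:
  assumes y: "y \<in> U"
  shows "(\<Sum>a\<in>UNIV. cov_tensor3 g (\<lambda>z u v w. exp (- 2 * f z) * H z u v w) (e a) (e a) (e b) (e c) y) = 0
    \<longleftrightarrow> (\<Sum>j\<in>UNIV. nHc y j j b c) - 2 * (\<Sum>j\<in>UNIV. pd (e j y) f y * Hc y j b c) = 0"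
proof -
  have "(\<Sum>a\<in>UNIV. cov_tensor3 g (\<lambda>z u v w. exp (- 2 * f z) * H z u v w) (e a) (e a) (e b) (e c) y)
    = exp (- 2 * f y) * ((\<Sum>j\<in>UNIV. nHc y j j b c) - 2 * (\<Sum>j\<in>UNIV. pd (e j y) f y * Hc y j b c))"
    by (simp only: H_equation_term[OF smooth_f y] sum_distrib_left[symmetric] sum_subtractf)
  then show ?thesis by simp
qed

lemma equations_iff:
  assumes y: "y \<in> U"
  shows "(\<forall>a b. ricci g e y a b
        - 1/4 * (\<Sum>m\<in>UNIV. \<Sum>n\<in>UNIV. H y (e a y) (e m y) (e n y) * H y (e b y) (e m y) (e n y))
        + 2 * hessian g e f y a b
        - \<alpha> / 4 * ((\<Sum>m\<in>UNIV. \<Sum>n\<in>UNIV. \<Sum>s\<in>UNIV. curvE A e y a m n s * curvE A e y b m n s)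
           - (\<Sum>m\<in>UNIV. \<Sum>n\<in>UNIV. \<Sum>s\<in>UNIV. curvT C g e y a m n s * curvT C g e y b m n s)) = 0)
    \<and> (\<forall>b c. (\<Sum>a\<in>UNIV. cov_tensor3 g (\<lambda>z u v w. exp (- 2 * f z) * H z u v w) (e a) (e a) (e b) (e c) y) = 0)
    \<longleftrightarrow> (\<forall>k l. c2 (\<lambda>m n. curvT C g e y m n k l) (\<epsilon> y) = 0)"
proof -
  \<comment> \<open>The Euclidean inner product, with no invariance claimed, is the starting point
    of the averaging.\<close>
  have "invariant_form {} (\<bullet>)"
    by (auto simp: invariant_form_def inner_commute bounded_linear.linear[OF bounded_linear_inner_right])
  then obtain B where B: "invariant_form UNIV B"
    using invariant_form_exists[of "(\<bullet>)" UNIV] by auto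
  have hess: "hessian g e f y a b = hess f y (e a y) (e b y)" for a b
    by (rule hessian_eq[OF smooth_f y])
  show ?thesis
    unfolding H_equation_iff[OF y] ricci_eq[OF y] hess Hc_def[symmetric]
  proof (rule equations_of_motion_iff_instanton[OF torsion_curvature_frame[OF y] _ _ _ _ _ _ _ alpha_pos spinor_nonzero[OF y] B])
    show "hess f y (e i y) (e j y) = hess f y (e j y) (e i y)" for i j
      by (rule hess_sym[OF smooth_f y])
    show "curvT C g e y j i s t = - curvT C g e y i j s t" for i j s t
      by (rule curvT_skew[OF y])
    show "curvE A e y j i s t = - curvE A e y i j s t" for i j s t
      unfolding curvE_eq[OF y] by (rule Fc_skew)
    show "c2 (\<lambda>k l. curvE A e y k l s t) (\<epsilon> y) = 0" for s t
      unfolding curvE_eq[OF y] Fc_def by (rule gaugino[OF y])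
    show "c2 (torsion_curvature.Rp (riem y) (Hc y) (nHc y) i j) (\<epsilon> y) = 0" for i j
      by (rule connp_curvature_annihilates[OF y])
    show "c1 (\<lambda>j. hess f y (e i y) (e j y) - 1/2 * (\<Sum>k\<in>UNIV. Hc y i j k * pd (e k y) f y)) (\<epsilon> y)
        = (1/12) *\<^sub>R c3 (torsion_curvature.np (Hc y) (nHc y) i) (\<epsilon> y)" for i
      by (rule dilatino_derivative[OF smooth_f dilatino y])
    show "torsion_curvature.dH (nHc y) i j a b
        = \<alpha> / 4 * (tr_wedge (curvT C g e y) i j a b - tr_wedge (curvE A e y) i j a b)" for i j a b
      using anomaly[OF y] unfolding ext_d3_frame[OF y] .
  qed
qed

end

section \<open>Matrix spinors as Clifford modules\<close>

lemma matrix_scaleR_vector: "(r *\<^sub>R M) *v v = r *\<^sub>R (M *v v)" for M :: "'s::finite cmat"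
  by (simp add: vec_eq_iff matrix_vector_mult_def scaleR_sum_right)

lemma clifford_module_matrix:
  fixes \<Gamma> :: "'d::finite \<Rightarrow> 's::finite cmat"
  assumes "clifford_generators \<Gamma>"
  shows "clifford_module (\<lambda>m \<psi>. \<Gamma> m *v \<psi>)"
proof
  fix m n :: 'd and u v :: "complex^'s" and r :: real
  show "\<Gamma> m *v (u + v) = \<Gamma> m *v u + \<Gamma> m *v v" by (rule matrix_vector_right_distrib)
  show "\<Gamma> m *v (r *\<^sub>R u) = r *\<^sub>R (\<Gamma> m *v u)"
    by (simp add: vec_eq_iff matrix_vector_mult_def scaleR_sum_right)
  have "(\<Gamma> m ** \<Gamma> n + \<Gamma> n ** \<Gamma> m) *v v = (if m = n then 2 *\<^sub>R mat 1 else 0) *v v"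
    using assms unfolding clifford_generators_def by simp
  then show "\<Gamma> m *v (\<Gamma> n *v v) + \<Gamma> n *v (\<Gamma> m *v v) = (if m = n then 2 *\<^sub>R v else 0)"
    by (simp add: matrix_vector_mult_add_rdistrib matrix_scaleR_vector matrix_vector_mul_assoc split: if_splits)
qed

context
  fixes \<Gamma> :: "'d::finite \<Rightarrow> 's::finite cmat"
  assumes \<Gamma>: "clifford_generators \<Gamma>"
begin

interpretation clifford_module "\<lambda>m \<psi>. \<Gamma> m *v \<psi>"
  by (rule clifford_module_matrix[OF \<Gamma>])

lemma gamma2_sum:
  assumes W: "\<And>m n. W n m = - W m n"
  shows "(\<Sum>m\<in>UNIV. \<Sum>n\<in>UNIV. W m n *\<^sub>R (gamma2 \<Gamma> m n *v \<psi>)) = c2 W \<psi>"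
proof -
  have "(\<Sum>m\<in>UNIV. \<Sum>n\<in>UNIV. W m n *\<^sub>R (\<Gamma> n *v (\<Gamma> m *v \<psi>))) = - c2 W \<psi>"
    unfolding c2_def by (subst sum.swap, subst W) (simp add: sum_negf)
  then have "2 *\<^sub>R (\<Sum>m\<in>UNIV. \<Sum>n\<in>UNIV. W m n *\<^sub>R (gamma2 \<Gamma> m n *v \<psi>)) = 2 *\<^sub>R c2 W \<psi>"
    by (simp add: gamma2_def matrix_scaleR_vector matrix_vector_mult_diff_rdistrib matrix_vector_mul_assoc[symmetric]
        scaleR_sum_right scaleR_diff_right sum_subtractf)
      (simp add: c2_def scaleR_2)
  then show ?thesis by simp
qed

text \<open>On totally skew coefficients all six signed orderings contribute equally, which cancels
  the 1/6 in \<open>gamma3\<close>.\<close>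

lemma gamma3_sum:
  assumes T: "skew3 T"
  shows "(\<Sum>m\<in>UNIV. \<Sum>n\<in>UNIV. \<Sum>p\<in>UNIV. T m n p *\<^sub>R (gamma3 \<Gamma> m n p *v \<psi>)) = c3 T \<psi>"
proof -
  let ?g = "\<lambda>m n p. \<Gamma> m *v (\<Gamma> n *v (\<Gamma> p *v \<psi>))"
  let ?S = "\<lambda>h. \<Sum>m\<in>UNIV. \<Sum>n\<in>UNIV. \<Sum>p\<in>UNIV. T m n p *\<^sub>R h m n p"
  have r1: "?S (\<lambda>m n p. ?g n p m) = c3 T \<psi>"
    unfolding c3_def by (subst sum_rotate, subst skew3D(4)[OF T]) (rule refl)
  have r2: "?S (\<lambda>m n p. ?g p m n) = c3 T \<psi>"
    unfolding c3_def by (subst sum_rotate, subst sum_rotate, subst skew3D(5)[OF T]) (rule refl)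
  have s: "?S (\<lambda>m n p. ?g n m p) = - c3 T \<psi>"
    unfolding c3_def by (subst sum.swap, subst skew3D(1)[OF T]) (simp add: sum_negf)
  have s1: "?S (\<lambda>m n p. ?g m p n) = - c3 T \<psi>"
    unfolding c3_def by (subst (2) sum.swap, subst skew3D(2)[OF T]) (simp add: sum_negf)
  have s2: "?S (\<lambda>m n p. ?g p n m) = - c3 T \<psi>"
    unfolding c3_def by (subst sum_rotate, subst sum.swap, subst skew3D(3)[OF T]) (simp add: sum_negf)
  have "6 *\<^sub>R (\<Sum>m\<in>UNIV. \<Sum>n\<in>UNIV. \<Sum>p\<in>UNIV. T m n p *\<^sub>R (gamma3 \<Gamma> m n p *v \<psi>))
      = ?S ?g + ?S (\<lambda>m n p. ?g n p m) + ?S (\<lambda>m n p. ?g p m n)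
        - ?S (\<lambda>m n p. ?g n m p) - ?S (\<lambda>m n p. ?g m p n) - ?S (\<lambda>m n p. ?g p n m)"
    by (simp add: gamma3_def matrix_scaleR_vector matrix_vector_mult_diff_rdistrib matrix_vector_mult_add_rdistrib
        matrix_vector_mul_assoc[symmetric] scaleR_sum_right scaleR_diff_right scaleR_add_right
        sum_subtractf sum.distrib)
  also have "\<dots> = 6 *\<^sub>R c3 T \<psi>"
    unfolding r1 r2 s s1 s2 c3_def[symmetric] by (simp add: vec_eq_iff scaleR_conv_of_real)
  finally show ?thesis by simp
qed

lemma curv_annihilates_iff:
  assumes "\<And>i j k l. R j i k l = - R i j k l"
  shows "curv_annihilates \<Gamma> R \<psi> \<longleftrightarrow> (\<forall>k l. c2 (\<lambda>m n. R m n k l) \<psi> = 0)"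
  unfolding curv_annihilates_def gamma2_sum[where W = "\<lambda>m n. R m n k l" for k l, OF assms] ..

end

lemma chart_connection_of_connection:
  fixes T :: "('i, 'm, 'd::finite) atlas" and A :: "'i \<Rightarrow> ('d, 'r::finite) conn"
  assumes "smooth_manifold M T" "connection T h A" "i \<in> idx T"
  shows "chart_connection (img T i) (A i)"
proof (rule chart_connection.intro)
  show op: "open (img T i)" using assms(1,3) unfolding smooth_manifold_def by blast
  have lin: "linear (A i y)" if "y \<in> img T i" for y
    using assms(2,3) that unfolding connection_def by blast
  then show "\<And>y. y \<in> img T i \<Longrightarrow> linear (A i y)" .
  show "smooth_on (img T i) (\<lambda>z. A i z u *v s)" for u s
  proof (rule smooth_on_linear[where L = "\<lambda>M. M *v s" and f = "\<lambda>z. A i z u", OF _ op])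
    show "bounded_linear (\<lambda>M :: real^'r^'r. M *v s)"
      by (intro linear_conv_bounded_linear[THEN iffD1] linearI)
        (simp_all add: matrix_vector_mult_add_rdistrib scaleR_matrix_vector_assoc)
    show "smooth_on (img T i) (\<lambda>z. A i z u)"
      by (rule smooth_on_axis_imp[OF op lin]) (use assms(2,3) in \<open>auto simp: connection_def\<close>)
  qed
qed

theorem theorem1p1:
  fixes M :: "'m topology"
    and T :: "('i, 'm, 'd::finite) atlas"
    and \<alpha> :: real
    and g :: "'i \<Rightarrow> 'd metric"
    and H :: "'i \<Rightarrow> 'd tensor3"
    and \<phi> :: "'m \<Rightarrow> real"
    and e :: "'i \<Rightarrow> 'd frame"
    and \<Gamma> :: "'d \<Rightarrow> 's::finite cmat"
    and J :: "complex^'s \<Rightarrow> complex^'s"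
    and \<sigma> :: "'i \<Rightarrow> 'i \<Rightarrow> real^'d \<Rightarrow> 's cmat"
    and \<epsilon> :: "'i \<Rightarrow> real^'d \<Rightarrow> complex^'s"
    and h :: "'i \<Rightarrow> 'i \<Rightarrow> real^'d \<Rightarrow> real^'r::finite^'r"
    and A :: "'i \<Rightarrow> ('d,'r) conn"
    and C :: "'i \<Rightarrow> ('d,'d) conn"
  assumes dim: "CARD('d) \<in> {5, 6, 7, 8}"
    and alpha: "\<alpha> > 0"
    and manifold: "smooth_manifold M T"
    and metric: "riemannian_metric T g"
    and torsion: "three_form T H"
    and dilaton: "smooth_function T \<phi>"
    and clifford: "clifford_generators \<Gamma>"
    and real_str: "CARD('d) \<in> {7, 8} \<Longrightarrow> real_structure \<Gamma> J"
    and spin: "spin_structure T g e \<Gamma> \<sigma>"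
    and spinor: "spinor_field T \<sigma> \<epsilon>"
    and spinor_alg: "\<And>i y. i \<in> idx T \<Longrightarrow> y \<in> img T i \<Longrightarrow> spinor_type \<Gamma> J (\<epsilon> i y)"
    and gauge_bundle: "metric_bundle T h"
    and gauge_conn: "metric_connection T h A"
    and tangent_conn: "connection T (tangent_transitions T) C"
    and gravitino: "gravitino_eq T g H e \<Gamma> \<epsilon>"
    and dilatino: "dilatino_eq T H \<phi> e \<Gamma> \<epsilon>"
    and gaugino: "gaugino_eq T A e \<Gamma> \<epsilon>"
    and anomaly: "anomaly_cancellation \<alpha> T g H e A C"
  shows "metric_eom \<alpha> T g H \<phi> e A C \<and> H_eom T g H \<phi> e \<and> F_eom T g H \<phi> e A
    \<longleftrightarrow> instanton T g e \<Gamma> \<epsilon> C"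
proof -
  note cg = clifford
  interpret clifford_module "\<lambda>m \<psi>. \<Gamma> m *v \<psi>"
    by (rule clifford_module_matrix[OF cg])
  have local: "heterotic_chart (img T i) (g i) (e i) (H i) (\<lambda>m \<psi>. \<Gamma> m *v \<psi>) (\<epsilon> i) (A i) (C i) (\<phi> \<circ> pt T i) \<alpha>"
    if i: "i \<in> idx T" for i
  proof -
    have op: "open (img T i)" using manifold i unfolding smooth_manifold_def by blast
    interpret framed_chart "img T i" "g i" "e i"
      by (rule framed_chart.intro[OF op])
        (use metric spin i in \<open>auto simp: riemannian_metric_def spin_structure_def orthonormal_frames_def\<close>)
    interpret torsion_chart "img T i" "g i" "e i" "H i"
    proof (rule torsion_chart.intro[OF framed_chart_axioms], rule torsion_chart_axioms.intro)
      show "linear (\<lambda>u. H i y u v w)" "H i y v u w = - H i y u v w" "H i y u w v = - H i y u v w"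
        if "y \<in> img T i" for y u v w
        using torsion i that unfolding three_form_def by blast+
      show "smooth_on (img T i) (\<lambda>y. H i y (axis m 1) (axis n 1) (axis p 1))" for m n p
        using torsion i unfolding three_form_def by blast
    qed
    interpret parallel_spinor "img T i" "g i" "e i" "H i" "\<lambda>m \<psi>. \<Gamma> m *v \<psi>" "\<epsilon> i"
    proof
      show "smooth_on (img T i) (\<epsilon> i)" using spinor i unfolding spinor_field_def by blast
      show "pd (e i a y) (\<epsilon> i) y = (1/4) *\<^sub>R c2 (connp y (e i a y)) (\<epsilon> i y)" if "y \<in> img T i" for y a
      proof -
        have "spin_nabla_plus (g i) (H i) (e i) \<Gamma> (e i a) (\<epsilon> i) y = 0"
          using gravitino i that unfolding gravitino_eq_def by blast
        then show ?thesis
          unfolding spin_nabla_plus_def nabla_plus_frame[OF that] gamma2_sum[OF cg connp_skew[OF that]]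
          by simp
      qed
    qed
    interpret chart_connection "img T i" "A i"
      using chart_connection_of_connection[OF manifold _ i] gauge_conn unfolding metric_connection_def by blast
    have curvE: "curvE (A i) (e i) y m n k l = curv_op (A i) y (e i m y) (e i n y) (axis k 1) $ l"
      if "y \<in> img T i" for y m n k l
      by (simp add: curvE_def curv_eq_curv_op[OF smooth_e smooth_e smooth_on_const that])
    have skewE: "curvE (A i) (e i) y n m k l = - curvE (A i) (e i) y m n k l" if "y \<in> img T i" for y m n k l
      unfolding curvE[OF that] curv_op_skew[of y "e i n y"] by simp
    interpret gauge_instanton "img T i" "g i" "e i" "H i" "\<lambda>m \<psi>. \<Gamma> m *v \<psi>" "\<epsilon> i" "A i"
    proof
      show "c2 (\<lambda>m n. curv_op (A i) y (e i m y) (e i n y) (axis k 1) $ l) (\<epsilon> i y) = 0" if "y \<in> img T i" for y k l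
      proof -
        have "curv_annihilates \<Gamma> (curvE (A i) (e i) y) (\<epsilon> i y)"
          using gaugino i that unfolding gaugino_eq_def by blast
        then show ?thesis
          unfolding curv_annihilates_iff[OF cg skewE[OF that]] curvE[OF that] by blast
      qed
    qed
    interpret C: chart_connection "img T i" "C i"
      by (rule chart_connection_of_connection[OF manifold tangent_conn i])
    show ?thesis
    proof unfold_locales
      show "smooth_on (img T i) (\<phi> \<circ> pt T i)" using dilaton i unfolding smooth_function_def by blast
      show "\<alpha> > 0" by (rule alpha)
      fix y assume y: "y \<in> img T i"
      show "\<epsilon> i y \<noteq> 0" using spinor_alg[OF i y] unfolding spinor_type_def by blast
      \<comment> \<open>The 1/12 is the 1/2 of the dilatino equation times the 1/6 of Clifford
        multiplication by a 3-form.\<close>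
      show "c1 (\<lambda>m. pd (e i m y) (\<phi> \<circ> pt T i) y) (\<epsilon> i y) = (1/12) *\<^sub>R c3 (Hc y) (\<epsilon> i y)"
        using dilatino i y gamma3_sum[OF cg torsion_curvature.H[OF torsion_curvature_frame[OF y]], of "\<epsilon> i y"]
        unfolding dilatino_eq_def c1_def Hc_def by simp
      show "ext_d3 (H i) y (e i a y) (e i b y) (e i c y) (e i d y)
        = \<alpha> / 4 * (tr_wedge (curvT (C i) (g i) (e i) y) a b c d - tr_wedge (curvE (A i) (e i) y) a b c d)" for a b c d
        using anomaly i y unfolding anomaly_cancellation_def by blast
    qed
  qed
  have "F_eom T g H \<phi> e A"
    unfolding F_eom_def
  proof (intro ballI allI)
    fix i y b k assume "i \<in> idx T" and y: "y \<in> img T i"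
    then interpret heterotic_chart "img T i" "g i" "e i" "H i" "\<lambda>m \<psi>. \<Gamma> m *v \<psi>" "\<epsilon> i" "A i" "C i" "\<phi> \<circ> pt T i" \<alpha>
      by (intro local)
    show "(\<Sum>a\<in>UNIV. cov_plus_endo2 (g i) (H i) (e i) (A i)
        (\<lambda>Y Z s z. exp (- 2 * \<phi> (pt T i z)) *\<^sub>R curv (A i) Y Z s z)
        (e i a) (e i a) (e i b) (\<lambda>_. axis k 1) y) = 0"
      using gauge_equation[OF y, of b k] by (simp add: o_def)
  qed
  \<comment> \<open>The equivalence holds at each single point of each chart, so it passes to the
    universally quantified equations.\<close>
  moreover have "metric_eom \<alpha> T g H \<phi> e A C \<and> H_eom T g H \<phi> e \<longleftrightarrow> instanton T g e \<Gamma> \<epsilon> C"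
  proof -
    have "curv_annihilates \<Gamma> (curvT (C i) (g i) (e i) y) (\<epsilon> i y) \<longleftrightarrow>
      (\<forall>a b. ricci (g i) (e i) y a b
        - 1/4 * (\<Sum>m\<in>UNIV. \<Sum>n\<in>UNIV.
            H i y (e i a y) (e i m y) (e i n y) * H i y (e i b y) (e i m y) (e i n y))
        + 2 * hessian (g i) (e i) (\<phi> \<circ> pt T i) y a b
        - \<alpha> / 4 *
          ((\<Sum>m\<in>UNIV. \<Sum>n\<in>UNIV. \<Sum>s\<in>UNIV.
              curvE (A i) (e i) y a m n s * curvE (A i) (e i) y b m n s)
           - (\<Sum>m\<in>UNIV. \<Sum>n\<in>UNIV. \<Sum>s\<in>UNIV.
              curvT (C i) (g i) (e i) y a m n s * curvT (C i) (g i) (e i) y b m n s)) = 0)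
      \<and> (\<forall>b c. (\<Sum>a\<in>UNIV. cov_tensor3 (g i) (\<lambda>z u v w. exp (- 2 * \<phi> (pt T i z)) * H i z u v w)
           (e i a) (e i a) (e i b) (e i c) y) = 0)" if i: "i \<in> idx T" and y: "y \<in> img T i" for i y
    proof -
      interpret heterotic_chart "img T i" "g i" "e i" "H i" "\<lambda>m \<psi>. \<Gamma> m *v \<psi>" "\<epsilon> i" "A i" "C i" "\<phi> \<circ> pt T i" \<alpha>
        by (rule local[OF i])
      show ?thesis
        unfolding curv_annihilates_iff[OF cg curvT_skew[OF y]]
        using equations_iff[OF y] by (simp only: o_def)
    qed
    then show ?thesis
      unfolding metric_eom_def H_eom_def instanton_def by blast
  qed
  ultimately show ?thesis by blast
qed

end
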